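(* Let $q\ge2$ be an integer and let $(\lambda_{x,s})$ be the formal table $T_q$ described in the context. Put $\mathfrak{c}_s=\sum_x|\lambda_{x,s}|^2$ and, for rows $x,y,z$, $N_{x,y}^z=\sum_s\lambda_{x,s}\lambda_{y,s}\overline{\lambda_{z,s}}/\mathfrak{c}_s$. Then the numbers $N_{x,y}^z$ are the structure constants of an integral commutative fusion ring $\mathcal{R}_q$ (with basis the set of rows, unit the row $x_{1,1}$) whose eigentable is $T_q$. Moreover, if $q\ge4$ then $\mathcal{R}_q$ is simple, and if $q$ is not a prime power then $\mathcal{R}_q$ is not isomorphic to the Grothendieck ring of $\mathrm{Rep}(G)$ for any finite group $G$.
   Context: $\zeta_n=\exp(2\pi i/n)$. A fusion ring is a ring which is a free $\mathbb{Z}$-module with finite basis $\{b_1,\dots,b_r\}$, $b_ib_j=\sum_kN_{i,j}^kb_k$, $N_{i,j}^k\in\mathbb{Z}_{\ge0}$, associative, unit $b_1$, duality $i\mapsto i^*$ with $N_{i,k}^1=N_{k,i}^1=\delta_{i^*,k}$, and $N_{i,j}^k=N_{i^*,k}^j=N_{k,j^*}^i$. For a commutative fusion ring the fusion matrices $(N_{i,j}^k)_{k,j}$ are simultaneously diagonalizable; the table of their joint eigenvalues $\lambda_{i,j}$ (row $i$ = basis element, column $j$ = common eigenvector) is its eigentable. $\mathrm{FPdim}$ is the unique ring homomorphism to $\mathbb{C}$ positive on the basis; the ring is integral if all $\mathrm{FPdim}(b_i)\in\mathbb{Z}$. It is simple if the only subsets of the basis containing $b_1$, closed under duality and such that all products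 decompose within their span, are $\{b_1\}$ and the whole basis. The table $T_q$ (for integer $q\ge2$; rows named $x_{d,c}$, columns grouped into blocks indexed by $k$, entries listed per row in the column order given): Case $q$ even. Columns: $C_0$; $C_1$; $A_k$ ($1\le k\le\frac{q-2}{2}$); $B_k$ ($1\le k\le\frac q2$). Rows: $x_{1,1}$: $1,1,1,1$. $x_{q-1,c}$ ($1\le c\le \frac q2$): $q-1,\,-1,\,0,\,-\zeta_{q+1}^{kc}-\zeta_{q+1}^{-kc}$. $x_{q,1}$: $q,0,1,-1$. $x_{q+1,c}$ ($1\le c\le\frac{q-2}{2}$): $q+1,\,1,\,\zeta_{q-1}^{kc}+\zeta_{q-1}^{-kc},\,0$. Case $q\equiv-1\pmod 4$. Columns: $C_0$; $D_k$ ($k\in\{1,2\}$); $A_k$ ($1\le k\le\frac{q-3}{4}$); $B_k$ ($1\le k\le\frac{q-3}{4}$); $E$ (with $k=\frac{q+1}{4}$). Rows: $x_{1,1}$: all $1$. $x_{\frac{q-1}{2},c}$ ($c\in\{1,2\}$): $\frac{q-1}2,\ \frac{-1+i(-1)^{k+c}\sqrt q}{2},\ 0,\ (-1)^{k+1},\ (-1)^{k+1}$. $x_{q-1,c}$ ($1\le c\le\frac{q-3}4$): $q-1,\,-1,\,0,\,-\zeta_{q+1}^{2kc}-\zeta_{q+1}^{-2kc},\,-2(-1)^c$. $x_{q,1}$: $q,0,1,-1,-1$. $x_{q+1,c}$ ($1\le c\le\frac{q-3}4$): $q+1,\,1,\,\zeta_{q-1}^{2kc}+\zeta_{q-1}^{-2kc},\,0,\,0$.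 Case $q\equiv1\pmod4$. Columns: $C_0$; $D_k$ ($k\in\{1,2\}$); $A_k$ ($1\le k\le\frac{q-5}4$); $E$ (with $k=\frac{q-1}4$); $B_k$ ($1\le k\le\frac{q-1}4$). Rows: $x_{1,1}$: all $1$. $x_{\frac{q+1}2,c}$ ($c\in\{1,2\}$): $\frac{q+1}2,\ \frac{1+(-1)^{k+c}\sqrt q}{2},\ (-1)^k,\ (-1)^k,\ 0$. $x_{q-1,c}$ ($1\le c\le\frac{q-1}4$): $q-1,\,-1,\,0,\,0,\,-\zeta_{q+1}^{2kc}-\zeta_{q+1}^{-2kc}$. $x_{q,1}$: $q,0,1,1,-1$. $x_{q+1,c}$ ($1\le c\le\frac{q-5}4$): $q+1,\,1,\,\zeta_{q-1}^{2kc}+\zeta_{q-1}^{-2kc},\,2(-1)^c,\,0$. (For $q$ a prime power, $T_q$ is the generic character table of $\mathrm{PSL}(2,q)$.) *)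

theory Defs
  imports Complex_Main "HOL-Algebra.Group" "Jordan_Normal_Form.Matrix"
    "HOL-Computational_Algebra.Primes"
begin

text \<open>Row labels: X1 = x_{1,1}; Xh c = x_{(q-+1)/2,c} (only for odd q);
  Xm c = x_{q-1,c}; Xq = x_{q,1}; Xp c = x_{q+1,c}.
  Column labels: C0, C1, CA k = A_k, CB k = B_k, CD k = D_k, CE = E.\<close>

datatype row = X1 | Xh nat | Xm nat | Xq | Xp nat
datatype col = C0 | C1 | CA nat | CB nat | CD nat | CE

definition zeta :: "nat \<Rightarrow> complex" where
  "zeta n = exp (2 * of_real pi * \<i> / of_nat n)"

definition cs :: "nat \<Rightarrow> nat \<Rightarrow> complex" where
  "cs n m = zeta n powi (int m) + zeta n powi (- int m)"

definition rows :: "nat \<Rightarrow> row set" where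
  "rows q = (if even q then
       {X1} \<union> Xm ` {1..q div 2} \<union> {Xq} \<union> Xp ` {1..(q - 2) div 2}
     else if q mod 4 = 3 then
       {X1} \<union> Xh ` {1,2} \<union> Xm ` {1..(q - 3) div 4} \<union> {Xq} \<union> Xp ` {1..(q - 3) div 4}
     else
       {X1} \<union> Xh ` {1,2} \<union> Xm ` {1..(q - 1) div 4} \<union> {Xq} \<union> Xp ` {1..(q - 5) div 4})"

definition cols :: "nat \<Rightarrow> col set" where
  "cols q = (if even q then
       {C0, C1} \<union> CA ` {1..(q - 2) div 2} \<union> CB ` {1..q div 2}
     else if q mod 4 = 3 then
       {C0} \<union> CD ` {1,2} \<union> CA ` {1..(q - 3) div 4} \<union> CB ` {1..(q - 3) div 4} \<union> {CE}
     else
       {C0} \<union> CD ` {1,2} \<union> CA ` {1..(q - 5) div 4} \<union> {CE} \<union> CB ` {1..(q - 1) div 4})"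

fun lam_even :: "nat \<Rightarrow> row \<Rightarrow> col \<Rightarrow> complex" where
  "lam_even q X1 s = 1"
| "lam_even q (Xm c) s = (case s of C0 \<Rightarrow> of_nat q - 1 | C1 \<Rightarrow> -1 | CA k \<Rightarrow> 0
       | CB k \<Rightarrow> - cs (q + 1) (k * c) | _ \<Rightarrow> 0)"
| "lam_even q Xq s = (case s of C0 \<Rightarrow> of_nat q | C1 \<Rightarrow> 0 | CA k \<Rightarrow> 1 | CB k \<Rightarrow> -1 | _ \<Rightarrow> 0)"
| "lam_even q (Xp c) s = (case s of C0 \<Rightarrow> of_nat q + 1 | C1 \<Rightarrow> 1
       | CA k \<Rightarrow> cs (q - 1) (k * c) | CB k \<Rightarrow> 0 | _ \<Rightarrow> 0)"
| "lam_even q (Xh c) s = 0"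

fun lam_3 :: "nat \<Rightarrow> row \<Rightarrow> col \<Rightarrow> complex" where
  "lam_3 q X1 s = 1"
| "lam_3 q (Xh c) s = (case s of C0 \<Rightarrow> (of_nat q - 1) / 2
       | CD k \<Rightarrow> (-1 + \<i> * (-1) ^ (k + c) * of_real (sqrt (real q))) / 2
       | CA k \<Rightarrow> 0 | CB k \<Rightarrow> (-1) ^ (k + 1) | CE \<Rightarrow> (-1) ^ ((q + 1) div 4 + 1) | _ \<Rightarrow> 0)"
| "lam_3 q (Xm c) s = (case s of C0 \<Rightarrow> of_nat q - 1 | CD k \<Rightarrow> -1 | CA k \<Rightarrow> 0
       | CB k \<Rightarrow> - cs (q + 1) (2 * k * c) | CE \<Rightarrow> - 2 * (-1) ^ c | _ \<Rightarrow> 0)"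
| "lam_3 q Xq s = (case s of C0 \<Rightarrow> of_nat q | CD k \<Rightarrow> 0 | CA k \<Rightarrow> 1 | CB k \<Rightarrow> -1
       | CE \<Rightarrow> -1 | _ \<Rightarrow> 0)"
| "lam_3 q (Xp c) s = (case s of C0 \<Rightarrow> of_nat q + 1 | CD k \<Rightarrow> 1
       | CA k \<Rightarrow> cs (q - 1) (2 * k * c) | CB k \<Rightarrow> 0 | CE \<Rightarrow> 0 | _ \<Rightarrow> 0)"

fun lam_1 :: "nat \<Rightarrow> row \<Rightarrow> col \<Rightarrow> complex" where
  "lam_1 q X1 s = 1"
| "lam_1 q (Xh c) s = (case s of C0 \<Rightarrow> (of_nat q + 1) / 2
       | CD k \<Rightarrow> (1 + (-1) ^ (k + c) * of_real (sqrt (real q))) / 2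
       | CA k \<Rightarrow> (-1) ^ k | CE \<Rightarrow> (-1) ^ ((q - 1) div 4) | CB k \<Rightarrow> 0 | _ \<Rightarrow> 0)"
| "lam_1 q (Xm c) s = (case s of C0 \<Rightarrow> of_nat q - 1 | CD k \<Rightarrow> -1 | CA k \<Rightarrow> 0
       | CE \<Rightarrow> 0 | CB k \<Rightarrow> - cs (q + 1) (2 * k * c) | _ \<Rightarrow> 0)"
| "lam_1 q Xq s = (case s of C0 \<Rightarrow> of_nat q | CD k \<Rightarrow> 0 | CA k \<Rightarrow> 1 | CE \<Rightarrow> 1
       | CB k \<Rightarrow> -1 | _ \<Rightarrow> 0)"
| "lam_1 q (Xp c) s = (case s of C0 \<Rightarrow> of_nat q + 1 | CD k \<Rightarrow> 1
       | CA k \<Rightarrow> cs (q - 1) (2 * k * c) | CE \<Rightarrow> 2 * (-1) ^ c | CB k \<Rightarrow> 0 | _ \<Rightarrow> 0)"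

definition lam :: "nat \<Rightarrow> row \<Rightarrow> col \<Rightarrow> complex" where
  "lam q = (if even q then lam_even q else if q mod 4 = 3 then lam_3 q else lam_1 q)"

definition cc :: "nat \<Rightarrow> col \<Rightarrow> complex" where
  "cc q s = of_real (\<Sum>x\<in>rows q. (cmod (lam q x s))\<^sup>2)"

definition Ncoef :: "nat \<Rightarrow> row \<Rightarrow> row \<Rightarrow> row \<Rightarrow> complex" where
  "Ncoef q x y z = (\<Sum>s\<in>cols q. lam q x s * lam q y s * cnj (lam q z s) / cc q s)"

definition fusion_ring :: "'a set \<Rightarrow> ('a \<Rightarrow> 'a \<Rightarrow> 'a \<Rightarrow> nat) \<Rightarrow> 'a \<Rightarrow> bool" where
  "fusion_ring B N e \<longleftrightarrow> finite B \<and> e \<in> B \<and>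
     (\<forall>i\<in>B. \<forall>k\<in>B. N e i k = (if i = k then 1 else 0) \<and> N i e k = (if i = k then 1 else 0)) \<and>
     (\<forall>i\<in>B. \<forall>j\<in>B. \<forall>k\<in>B. \<forall>l\<in>B.
        (\<Sum>m\<in>B. N i j m * N m k l) = (\<Sum>m\<in>B. N j k m * N i m l)) \<and>
     (\<exists>d. (\<forall>i\<in>B. d i \<in> B) \<and>
        (\<forall>i\<in>B. \<forall>k\<in>B. N i k e = (if d i = k then 1 else 0) \<and> N k i e = (if d i = k then 1 else 0)) \<and>
        (\<forall>i\<in>B. \<forall>j\<in>B. \<forall>k\<in>B. N i j k = N (d i) k j \<and> N i j k = N k (d j) i))"

definition commutative_fr :: "'a set \<Rightarrow> ('a \<Rightarrow> 'a \<Rightarrow> 'a \<Rightarrow> nat) \<Rightarrow> bool" where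
  "commutative_fr B N \<longleftrightarrow> (\<forall>i\<in>B. \<forall>j\<in>B. \<forall>k\<in>B. N i j k = N j i k)"

text \<open>Ring homomorphisms to the complex numbers that are positive on the basis
  (such a homomorphism is real-valued on the basis).\<close>
definition fpdim_hom :: "'a set \<Rightarrow> ('a \<Rightarrow> 'a \<Rightarrow> 'a \<Rightarrow> nat) \<Rightarrow> 'a \<Rightarrow> ('a \<Rightarrow> real) \<Rightarrow> bool" where
  "fpdim_hom B N e f \<longleftrightarrow> f e = 1 \<and> (\<forall>i\<in>B. f i > 0) \<and>
     (\<forall>i\<in>B. \<forall>j\<in>B. f i * f j = (\<Sum>k\<in>B. real (N i j k) * f k))"

definition integral_fr :: "'a set \<Rightarrow> ('a \<Rightarrow> 'a \<Rightarrow> 'a \<Rightarrow> nat) \<Rightarrow> 'a \<Rightarrow> bool" where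
  "integral_fr B N e \<longleftrightarrow> (\<exists>f. fpdim_hom B N e f) \<and>
     (\<forall>f. fpdim_hom B N e f \<longrightarrow> (\<forall>i\<in>B. f i \<in> \<int>))"

definition is_eigentable :: "'a set \<Rightarrow> ('a \<Rightarrow> 'a \<Rightarrow> 'a \<Rightarrow> nat) \<Rightarrow> 'c set \<Rightarrow> ('a \<Rightarrow> 'c \<Rightarrow> complex) \<Rightarrow> bool" where
  "is_eigentable B N C T \<longleftrightarrow> finite C \<and> card C = card B \<and>
     (\<exists>v :: 'c \<Rightarrow> 'a \<Rightarrow> complex.
        (\<forall>a. (\<forall>x\<in>B. (\<Sum>s\<in>C. a s * v s x) = 0) \<longrightarrow> (\<forall>s\<in>C. a s = 0)) \<and>
        (\<forall>i\<in>B. \<forall>s\<in>C. \<forall>k\<in>B. (\<Sum>j\<in>B. of_nat (N i j k) * v s j) = T i s * v s k))"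

definition simple_fr :: "'a set \<Rightarrow> ('a \<Rightarrow> 'a \<Rightarrow> 'a \<Rightarrow> nat) \<Rightarrow> 'a \<Rightarrow> bool" where
  "simple_fr B N e \<longleftrightarrow> (\<forall>S. S \<subseteq> B \<and> e \<in> S \<and>
      (\<forall>i\<in>S. \<forall>k\<in>B. N i k e \<noteq> 0 \<longrightarrow> k \<in> S) \<and>
      (\<forall>i\<in>S. \<forall>j\<in>S. \<forall>k\<in>B. N i j k \<noteq> 0 \<longrightarrow> k \<in> S)
      \<longrightarrow> S = {e} \<or> S = B)"

definition is_rep :: "('g, 'b) monoid_scheme \<Rightarrow> nat \<Rightarrow> ('g \<Rightarrow> complex mat) \<Rightarrow> bool" where
  "is_rep G n \<rho> \<longleftrightarrow> (\<forall>g\<in>carrier G. \<rho> g \<in> carrier_mat n n) \<and>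
     (\<forall>g\<in>carrier G. \<forall>h\<in>carrier G. \<rho> (g \<otimes>\<^bsub>G\<^esub> h) = \<rho> g * \<rho> h) \<and>
     \<rho> \<one>\<^bsub>G\<^esub> = 1\<^sub>m n"

definition invariant_subspace :: "('g, 'b) monoid_scheme \<Rightarrow> nat \<Rightarrow> ('g \<Rightarrow> complex mat) \<Rightarrow> complex vec set \<Rightarrow> bool" where
  "invariant_subspace G n \<rho> W \<longleftrightarrow> W \<subseteq> carrier_vec n \<and> 0\<^sub>v n \<in> W \<and>
     (\<forall>v\<in>W. \<forall>w\<in>W. v + w \<in> W) \<and> (\<forall>a. \<forall>v\<in>W. a \<cdot>\<^sub>v v \<in> W) \<and>
     (\<forall>g\<in>carrier G. \<forall>v\<in>W. \<rho> g *\<^sub>v v \<in> W)"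

definition irreducible_rep :: "('g, 'b) monoid_scheme \<Rightarrow> nat \<Rightarrow> ('g \<Rightarrow> complex mat) \<Rightarrow> bool" where
  "irreducible_rep G n \<rho> \<longleftrightarrow> is_rep G n \<rho> \<and> n > 0 \<and>
     (\<forall>W. invariant_subspace G n \<rho> W \<longrightarrow> W = {0\<^sub>v n} \<or> W = carrier_vec n)"

definition mat_trace :: "nat \<Rightarrow> complex mat \<Rightarrow> complex" where
  "mat_trace n A = (\<Sum>i<n. A $$ (i, i))"

text \<open>Irreducible characters (one per isomorphism class of irreducible representations).\<close>
definition irr_chars :: "('g, 'b) monoid_scheme \<Rightarrow> ('g \<Rightarrow> complex) set" where
  "irr_chars G = {\<chi>. \<exists>n \<rho>. irreducible_rep G n \<rho> \<and>
      \<chi> = (\<lambda>g. if g \<in> carrier G then mat_trace n (\<rho> g) else 0)}"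

text \<open>Multiplicity of the irreducible with character phi in the tensor product of those
  with characters chi and psi.\<close>
definition groth_N :: "('g, 'b) monoid_scheme \<Rightarrow> ('g \<Rightarrow> complex) \<Rightarrow> ('g \<Rightarrow> complex) \<Rightarrow> ('g \<Rightarrow> complex) \<Rightarrow> complex" where
  "groth_N G \<chi> \<psi> \<phi> = (\<Sum>g\<in>carrier G. \<chi> g * \<psi> g * cnj (\<phi> g)) / of_nat (card (carrier G))"

definition iso_to_RepG :: "'a set \<Rightarrow> ('a \<Rightarrow> 'a \<Rightarrow> 'a \<Rightarrow> nat) \<Rightarrow> 'a \<Rightarrow> ('g, 'b) monoid_scheme \<Rightarrow> bool" where
  "iso_to_RepG B N e G \<longleftrightarrow> (\<exists>\<phi>. bij_betw \<phi> B (irr_chars G) \<and>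
      \<phi> e = (\<lambda>g. if g \<in> carrier G then 1 else 0) \<and>
      (\<forall>x\<in>B. \<forall>y\<in>B. \<forall>z\<in>B. of_nat (N x y z) = groth_N G (\<phi> x) (\<phi> y) (\<phi> z)))"

definition prime_power :: "nat \<Rightarrow> bool" where
  "prime_power q \<longleftrightarrow> (\<exists>p k. prime p \<and> k > 0 \<and> q = p ^ k)"

end

theory Submission
  imports Defs "Jordan_Normal_Form.Spectral_Radius" "HOL-Algebra.Sylow" "HOL-Algebra.Multiplicative_Group"
begin

text \<open>
  A table with orthonormal weighted rows and as many rows as columns has orthogonal columns, so integral
  nonnegative Verlinde numbers are all that is needed for the ring structure. Every row of \<open>T\<^sub>q\<close> is a
  combination of the functions attached to the characters of the two tori of orders \<open>(q - 1) / e\<close> and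
  \<open>(q + 1) / e\<close>, \<open>e = gcd 2 (q - 1)\<close>, and of one function supported on the unipotent columns; triple products
  of these reduce to counting solutions of \<open>\<plusminus>a \<plusminus> b \<plusminus> c = 0\<close> modulo the order of a torus. The square of
  \<open>x\<^bsub>q,1\<^esub>\<close> contains every row, and \<open>x\<^bsub>q,1\<^esub>\<close> lies in every nontrivial fusion subring, whence simplicity.

  If the ring came from a finite group \<open>G\<close>, each element of \<open>G\<close> would evaluate to a column, distinct
  conjugacy classes to distinct columns, with centralizer orders given by the column norms. Only the at most
  two unipotent columns have a norm sharing a prime with \<open>q\<close>, apart from the column of the identity. Two
  primes dividing \<open>q\<close> would produce commuting elements \<open>g\<close>, \<open>b\<close> of these orders, and \<open>g\<close>, \<open>b\<close>, \<open>g b\<close> would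
  lie in three such columns.
\<close>

section \<open>Block triangular matrices\<close>

text \<open>The obstacle in the group part is that \<open>groth_N\<close> is only an inner product.
  That a product of irreducible characters is the corresponding combination of irreducible
  characters requires these to span the class functions, and this half of character theory is proved
  from scratch, through the functions counting the x with g x = x h. The other half is free:
  orthogonality is read off from the assumed isomorphism (multiplication by the unit row), and
  finiteness of \<open>irr_chars G\<close> from the bijection with the rows.

  In the table part the column norms are never summed directly. The weights are guessed as the
  centralizer orders in PSL(2,q), written in terms of q; orthonormality of the rows for these
  weights then forces them to be the norms.\<close>

lemma mat_trace_comm:
  assumes "A \<in> carrier_mat n m" "B \<in> carrier_mat m n"
  shows "mat_trace n (A * B) = mat_trace m (B * A)"
proof -
  have "mat_trace n (A * B) = (\<Sum>i<n. \<Sum>j<m. A $$ (i, j) * B $$ (j, i))"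
    using assms by (auto simp: mat_trace_def scalar_prod_def atLeast0LessThan intro!: sum.cong)
  also have "\<dots> = (\<Sum>j<m. \<Sum>i<n. B $$ (j, i) * A $$ (i, j))"
    by (subst sum.swap) (simp add: mult.commute)
  also have "\<dots> = mat_trace m (B * A)"
    using assms by (auto simp: mat_trace_def scalar_prod_def atLeast0LessThan intro!: sum.cong)
  finally show ?thesis .
qed

lemma square_assoc:
  fixes A B C :: "'a :: semiring_0 mat"
  assumes "A \<in> carrier_mat n n" "B \<in> carrier_mat n n"
  shows "C \<in> carrier_mat n n \<Longrightarrow> A * B * C = A * (B * C)" "A * B \<in> carrier_mat n n"
    "v \<in> carrier_vec n \<Longrightarrow> A * B *\<^sub>v v = A *\<^sub>v (B *\<^sub>v v)"
  using assoc_mult_mat[OF assms] mult_carrier_mat[OF assms] assoc_mult_mat_vec[OF assms] by auto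

lemma swaprows_mat_fix:
  fixes v :: "'a :: comm_ring_1 vec"
  assumes "v \<in> carrier_vec n" "k < n" "l < n" "v $ k = 0" "v $ l = 0"
  shows "swaprows_mat n k l *\<^sub>v v = v"
proof (rule eq_vecI)
  fix i assume "i < dim_vec v"
  hence i: "i < n" using assms by auto
  have "(swaprows_mat n k l *\<^sub>v v) $ i
      = (\<Sum>j<n. (if k = i \<and> l = j \<or> k = j \<and> l = i \<or> i = j \<and> i \<noteq> k \<and> i \<noteq> l then 1 else 0) * v $ j)"
    using i assms by (auto simp: swaprows_mat_def scalar_prod_def atLeast0LessThan intro!: sum.cong)
  also have "\<dots> = (\<Sum>j<n. (if j = i then v $ j else 0))"
    using assms by (intro sum.cong) auto
  finally show "(swaprows_mat n k l *\<^sub>v v) $ i = v $ i" using i by simp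
qed (use assms in \<open>auto simp: swaprows_mat_def\<close>)

lemma swaprows_mat_index:
  fixes v :: "'a :: comm_ring_1 vec"
  assumes "v \<in> carrier_vec n" "k < n" "l < n"
  shows "(swaprows_mat n k l *\<^sub>v v) $ k = v $ l"
proof -
  have "(swaprows_mat n k l *\<^sub>v v) $ k
      = (\<Sum>j<n. (if k = k \<and> l = j \<or> k = j \<and> l = k \<or> k = j \<and> k \<noteq> k \<and> k \<noteq> l then 1 else 0) * v $ j)"
    using assms by (auto simp: swaprows_mat_def scalar_prod_def atLeast0LessThan intro!: sum.cong)
  also have "\<dots> = (\<Sum>j<n. (if j = l then v $ j else 0))"
    using assms by (intro sum.cong) auto
  finally show ?thesis using assms by simp
qed

text \<open>Basis extension phrased with matrices: the columns of \<open>P\<close> form a basis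
  whose first \<open>m\<close> members lie in \<open>W\<close>, with \<open>m\<close> maximal.
  Membership in \<open>W\<close> then becomes the vanishing of all coordinates from \<open>m\<close>
  on.\<close>

lemma subspace_adapted_basis:
  fixes W :: "'a :: field vec set"
  assumes sub: "W \<subseteq> carrier_vec n" and zero: "0\<^sub>v n \<in> W"
    and add: "\<And>v w. v \<in> W \<Longrightarrow> w \<in> W \<Longrightarrow> v + w \<in> W"
    and smult: "\<And>a v. v \<in> W \<Longrightarrow> a \<cdot>\<^sub>v v \<in> W"
    and proper: "W \<noteq> {0\<^sub>v n}" "W \<noteq> carrier_vec n"
  obtains m P Q where "0 < m" "m < n" "P \<in> carrier_mat n n" "Q \<in> carrier_mat n n" "Q * P = 1\<^sub>m n" "P * Q = 1\<^sub>m n"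
    "\<And>v. v \<in> W \<longleftrightarrow> v \<in> carrier_vec n \<and> (\<forall>i. m \<le> i \<and> i < n \<longrightarrow> (Q *\<^sub>v v) $ i = 0)"
proof -
  define good where "good m P Q \<longleftrightarrow> P \<in> carrier_mat n n \<and> Q \<in> carrier_mat n n \<and> Q * P = 1\<^sub>m n \<and> m \<le> n \<and>
      (\<forall>u \<in> carrier_vec n. (\<forall>i. m \<le> i \<and> i < n \<longrightarrow> u $ i = 0) \<longrightarrow> P *\<^sub>v u \<in> W)" for m and P Q :: "'a mat"
  have "good 0 (1\<^sub>m n) (1\<^sub>m n)"
    unfolding good_def
  proof (intro conjI ballI impI)
    fix u :: "'a vec" assume "u \<in> carrier_vec n" "\<forall>i. 0 \<le> i \<and> i < n \<longrightarrow> u $ i = 0"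
    hence "u = 0\<^sub>v n" by (intro eq_vecI) auto
    thus "1\<^sub>m n *\<^sub>v u \<in> W" using zero by simp
  qed auto
  hence "\<exists>m. (\<exists>P Q. good m P Q) \<and> (\<forall>m'. (\<exists>P Q. good m' P Q) \<longrightarrow> m' \<le> m)"
    using ex_has_greatest_nat[of "\<lambda>m. \<exists>P Q. good m P Q" 0 "\<lambda>m. m" "Suc n"]
    by (metis good_def less_Suc_eq_le)
  then obtain m P Q where g: "good m P Q" and max: "\<And>m' P Q. good m' P Q \<Longrightarrow> m' \<le> m" by blast
  hence P: "P \<in> carrier_mat n n" and Q: "Q \<in> carrier_mat n n" and QP: "Q * P = 1\<^sub>m n" and "m \<le> n"
    and PW: "\<And>u. u \<in> carrier_vec n \<Longrightarrow> (\<forall>i. m \<le> i \<and> i < n \<longrightarrow> u $ i = 0) \<Longrightarrow> P *\<^sub>v u \<in> W"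
    by (auto simp: good_def)
  have PQ: "P * Q = 1\<^sub>m n" using mat_mult_left_right_inverse[OF Q P QP] .
  have WQ: "(Q *\<^sub>v w) $ i = 0" if w: "w \<in> W" and i: "m \<le> i" "i < n" for w i
  proof (rule ccontr)
    assume nz: "(Q *\<^sub>v w) $ i \<noteq> 0"
    have wc: "w \<in> carrier_vec n" using w sub by auto
    \<comment> \<open>Exchanging the coordinates \<open>m\<close> and \<open>i\<close> brings the
      nonzero coordinate of \<open>Q *\<^sub>v w\<close> into position \<open>m\<close>.\<close>
    define S where "S = (swaprows_mat n m i :: 'a mat)"
    have mn: "m < n" using i by simp
    have S: "S \<in> carrier_mat n n" unfolding S_def by simp
    have SS: "S * S = 1\<^sub>m n" unfolding S_def using mn i by (intro swaprows_mat_inv) auto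
    define u where "u = S *\<^sub>v (Q *\<^sub>v w)"
    have u: "u \<in> carrier_vec n" unfolding u_def using S Q wc by auto
    have um: "u $ m \<noteq> 0" unfolding u_def S_def using nz swaprows_mat_index[of "Q *\<^sub>v w" n m i] Q wc mn i by auto
    \<comment> \<open>\<open>E\<close> is the identity with column \<open>m\<close> replaced by
      \<open>u\<close>, and \<open>F\<close> inverts it by one elimination step with pivot
      \<open>u $ m\<close>. Column \<open>m\<close> of \<open>P * S * E\<close> is \<open>w\<close>,
      while the columns before it are those of \<open>P\<close>, so \<open>m\<close> was not
      maximal.\<close>
    define E where "E = mat n n (\<lambda>(a, b). if b = m then u $ a else if a = b then 1 else 0)"
    define F where "F = mat n n (\<lambda>(a, b). if b = m then (if a = m then 1 / u $ m else - u $ a / u $ m) else if a = b then 1 else 0)"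
    have E: "E \<in> carrier_mat n n" and F: "F \<in> carrier_mat n n" by (auto simp: E_def F_def)
    have FE: "F * E = 1\<^sub>m n"
    proof (rule eq_matI)
      fix a b assume "a < dim_row (1\<^sub>m n :: 'a mat)" "b < dim_col (1\<^sub>m n :: 'a mat)"
      hence ab: "a < n" "b < n" by auto
      have eq: "(F * E) $$ (a, b) = (\<Sum>c<n. F $$ (a, c) * E $$ (c, b))"
        using ab E F by (auto simp: scalar_prod_def atLeast0LessThan)
      show "(F * E) $$ (a, b) = (1\<^sub>m n :: 'a mat) $$ (a, b)"
      proof (cases "b = m")
        case False
        have "(\<Sum>c<n. F $$ (a, c) * E $$ (c, b)) = (\<Sum>c<n. if c = b then F $$ (a, c) else 0)"
          using False ab by (intro sum.cong) (auto simp: E_def)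
        thus ?thesis using eq ab False by (simp add: F_def)
      next
        case True
        have "(\<Sum>c<n. F $$ (a, c) * E $$ (c, b)) = (\<Sum>c<n. (if c = m then F $$ (a, m) * u $ m else 0) + (if c = a then (if a = m then 0 else u $ a) else 0))"
          using True ab by (intro sum.cong) (auto simp: E_def F_def)
        also have "\<dots> = F $$ (a, m) * u $ m + (if a = m then 0 else u $ a)"
          using ab mn by (simp add: sum.distrib)
        also have "\<dots> = (if a = m then 1 else 0)" using ab um mn by (simp add: F_def)
        finally show ?thesis using eq ab True by simp
      qed
    qed (use E F in auto)
    have "good (Suc m) (P * S * E) (F * S * Q)"
      unfolding good_def
    proof (intro conjI ballI impI)
      have "F * S * Q * (P * S * E) = F * (S * (Q * P) * S) * E"
        using P Q S E F by (simp add: square_assoc[of _ n] del: mult_carrier_mat)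
      also have "\<dots> = 1\<^sub>m n" using QP SS FE S F by simp
      finally show "F * S * Q * (P * S * E) = 1\<^sub>m n" .
      fix v :: "'a vec" assume v: "v \<in> carrier_vec n" "\<forall>j. Suc m \<le> j \<and> j < n \<longrightarrow> v $ j = 0"
      \<comment> \<open>The part of \<open>v\<close> in positions before \<open>m\<close>; both
        coordinates exchanged by \<open>S\<close> vanish on it.\<close>
      define v' where "v' = vec n (\<lambda>j. if j = m then 0 else v $ j)"
      have v'c: "v' \<in> carrier_vec n" by (simp add: v'_def)
      have v'0: "v' $ j = 0" if "m \<le> j" "j < n" for j using v that by (auto simp: v'_def)
      have Ev: "E *\<^sub>v v = (v $ m) \<cdot>\<^sub>v u + v'"
      proof (rule eq_vecI)
        fix j assume "j < dim_vec ((v $ m) \<cdot>\<^sub>v u + v')"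
        hence j: "j < n" by (simp add: v'_def)
        have "(E *\<^sub>v v) $ j = (\<Sum>c<n. E $$ (j, c) * v $ c)"
          using j E v by (auto simp: scalar_prod_def atLeast0LessThan)
        also have "\<dots> = (\<Sum>c<n. (if c = m then u $ j * v $ m else 0) + (if c = j then (if j = m then 0 else v $ j) else 0))"
          using j by (intro sum.cong) (auto simp: E_def)
        also have "\<dots> = u $ j * v $ m + (if j = m then 0 else v $ j)" using j mn by (simp add: sum.distrib)
        finally show "(E *\<^sub>v v) $ j = ((v $ m) \<cdot>\<^sub>v u + v') $ j" using j u by (simp add: v'_def)
      qed (use E in \<open>auto simp: v'_def\<close>)
      have Sv': "S *\<^sub>v v' = v'" unfolding S_def
        using v'c mn i v'0 by (intro swaprows_mat_fix) auto
      have "S *\<^sub>v u = (S * S) *\<^sub>v (Q *\<^sub>v w)" using S Q wc by (simp add: u_def)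
      hence Su: "S *\<^sub>v u = Q *\<^sub>v w" using SS Q wc by simp
      have "P *\<^sub>v (S *\<^sub>v u) = (P * Q) *\<^sub>v w" using Su P Q wc by simp
      hence PSu: "P *\<^sub>v (S *\<^sub>v u) = w" using PQ wc by simp
      have "(P * S * E) *\<^sub>v v = P *\<^sub>v (S *\<^sub>v (E *\<^sub>v v))" using P S E v by (simp add: square_assoc[of _ n] del: mult_carrier_mat)
      also have "S *\<^sub>v (E *\<^sub>v v) = (v $ m) \<cdot>\<^sub>v (S *\<^sub>v u) + v'"
        unfolding Ev using S u v'c by (simp add: mult_add_distrib_mat_vec mult_mat_vec Sv')
      also have "P *\<^sub>v \<dots> = (v $ m) \<cdot>\<^sub>v w + P *\<^sub>v v'"
        using P S u v'c by (simp add: mult_add_distrib_mat_vec mult_mat_vec PSu)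
      also have "\<dots> \<in> W" using w v'c v'0 by (intro add smult PW) auto
      finally show "(P * S * E) *\<^sub>v v \<in> W" .
    qed (use P Q S E F mn in auto)
    from max[OF this] show False by simp
  qed
  have char: "v \<in> W \<longleftrightarrow> v \<in> carrier_vec n \<and> (\<forall>i. m \<le> i \<and> i < n \<longrightarrow> (Q *\<^sub>v v) $ i = 0)" for v
  proof
    assume *: "v \<in> carrier_vec n \<and> (\<forall>i. m \<le> i \<and> i < n \<longrightarrow> (Q *\<^sub>v v) $ i = 0)"
    hence "P *\<^sub>v (Q *\<^sub>v v) \<in> W" using Q by (intro PW) auto
    moreover have "P *\<^sub>v (Q *\<^sub>v v) = (P * Q) *\<^sub>v v" using P Q * by simp
    ultimately show "v \<in> W" using PQ * by simp
  qed (use sub WQ in auto)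
  have "m \<noteq> n"
  proof
    assume "m = n"
    hence "W = carrier_vec n" using char by auto
    thus False using proper by simp
  qed
  moreover have "m \<noteq> 0"
  proof
    assume m0: "m = 0"
    have "v = 0\<^sub>v n" if "v \<in> W" for v
    proof -
      have vc: "v \<in> carrier_vec n" using that sub by auto
      have "Q *\<^sub>v v = 0\<^sub>v n" using that char[of v] m0 Q by (intro eq_vecI) auto
      moreover have "(P * Q) *\<^sub>v v = P *\<^sub>v (Q *\<^sub>v v)" using P Q vc by simp
      ultimately have "1\<^sub>m n *\<^sub>v v = P *\<^sub>v 0\<^sub>v n" using PQ by simp
      also have "\<dots> = 0\<^sub>v n" using P by (intro eq_vecI) auto
      finally show ?thesis using vc by simp
    qed
    hence "W = {0\<^sub>v n}" using zero by blast
    thus False using proper by simp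
  qed
  ultimately have "0 < m" "m < n" using \<open>m \<le> n\<close> by auto
  thus ?thesis using P Q QP PQ char by (rule that)
qed

definition upper_block :: "nat \<Rightarrow> 'a mat \<Rightarrow> 'a mat" where
  "upper_block m A = mat m m (\<lambda>ij. A $$ ij)"

definition lower_block :: "nat \<Rightarrow> nat \<Rightarrow> 'a mat \<Rightarrow> 'a mat" where
  "lower_block m k A = mat k k (\<lambda>(i, j). A $$ (i + m, j + m))"

definition block_triangular :: "nat \<Rightarrow> nat \<Rightarrow> 'a :: zero mat \<Rightarrow> bool" where
  "block_triangular m k A \<longleftrightarrow> A \<in> carrier_mat (m + k) (m + k) \<and> (\<forall>i<k. \<forall>j<m. A $$ (i + m, j) = 0)"

lemma block_carrier [simp]:
  "upper_block m A \<in> carrier_mat m m" "lower_block m k A \<in> carrier_mat k k"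
  by (simp_all add: upper_block_def lower_block_def)

lemma sum_lessThan_add: "(\<Sum>i<m + k. f i) = (\<Sum>i<m. f i) + (\<Sum>i<k. f (i + m))" for f :: "nat \<Rightarrow> 'a :: comm_monoid_add"
  by (induction k) (simp_all add: ac_simps)

lemma block_triangular_mult:
  fixes A B :: "'a :: comm_ring_1 mat"
  assumes A: "block_triangular m k A" and B: "block_triangular m k B"
  shows "upper_block m (A * B) = upper_block m A * upper_block m B"
    "lower_block m k (A * B) = lower_block m k A * lower_block m k B"
    "block_triangular m k (A * B)"
proof -
  have c: "A \<in> carrier_mat (m + k) (m + k)" "B \<in> carrier_mat (m + k) (m + k)" using A B by (auto simp: block_triangular_def)
  have a0: "A $$ (i + m, j) = 0" if "i < k" "j < m" for i j using that A by (auto simp: block_triangular_def)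
  have b0: "B $$ (i + m, j) = 0" if "i < k" "j < m" for i j using that B by (auto simp: block_triangular_def)
  have mult: "(A * B) $$ (i, j) = (\<Sum>l<m. A $$ (i, l) * B $$ (l, j)) + (\<Sum>l<k. A $$ (i, l + m) * B $$ (l + m, j))"
    if "i < m + k" "j < m + k" for i j
    using that c by (auto simp: scalar_prod_def atLeast0LessThan sum_lessThan_add)
  show "upper_block m (A * B) = upper_block m A * upper_block m B"
    proof (rule eq_matI)
    fix i j assume "i < dim_row (upper_block m A * upper_block m B)" "j < dim_col (upper_block m A * upper_block m B)"
    hence ij: "i < m" "j < m" by (auto simp: upper_block_def)
    have "(upper_block m A * upper_block m B) $$ (i, j) = (\<Sum>l<m. upper_block m A $$ (i, l) * upper_block m B $$ (l, j))"
      using ij by (auto simp: upper_block_def scalar_prod_def atLeast0LessThan)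
    thus "upper_block m (A * B) $$ (i, j) = (upper_block m A * upper_block m B) $$ (i, j)"
      using ij by (simp add: upper_block_def mult b0 del: index_mult_mat(1))
  qed (auto simp: upper_block_def)
  show "lower_block m k (A * B) = lower_block m k A * lower_block m k B"
    proof (rule eq_matI)
    fix i j assume "i < dim_row (lower_block m k A * lower_block m k B)" "j < dim_col (lower_block m k A * lower_block m k B)"
    hence ij: "i < k" "j < k" by (auto simp: lower_block_def)
    have "(lower_block m k A * lower_block m k B) $$ (i, j) = (\<Sum>l<k. lower_block m k A $$ (i, l) * lower_block m k B $$ (l, j))"
      using ij by (auto simp: lower_block_def scalar_prod_def atLeast0LessThan)
    thus "lower_block m k (A * B) $$ (i, j) = (lower_block m k A * lower_block m k B) $$ (i, j)"
      using ij by (simp add: lower_block_def mult a0 del: index_mult_mat(1))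
  qed (auto simp: lower_block_def)
  show "block_triangular m k (A * B)"
    using c unfolding block_triangular_def by (auto simp: mult a0 b0 simp del: index_mult_mat(1))
qed

lemma block_triangular_one:
  "upper_block m (1\<^sub>m (m + k)) = 1\<^sub>m m" "lower_block m k (1\<^sub>m (m + k)) = 1\<^sub>m k"
  by (auto simp: upper_block_def lower_block_def)

lemma mat_trace_blocks:
  assumes "A \<in> carrier_mat (m + k) (m + k)"
  shows "mat_trace (m + k) A = mat_trace m (upper_block m A) + mat_trace k (lower_block m k A)"
  using assms by (simp add: mat_trace_def sum_lessThan_add upper_block_def lower_block_def)

section \<open>Characters span the class functions\<close>

text \<open>A sum over an infinite set is 0, so the lemmas that exhibit characters as members assume
  \<open>irr_chars G\<close> to be finite.\<close>

definition char_span :: "('g, 'b) monoid_scheme \<Rightarrow> ('g \<Rightarrow> complex) set" where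
  "char_span G = {f. \<exists>a. \<forall>g\<in>carrier G. f g = (\<Sum>\<chi>\<in>irr_chars G. a \<chi> * \<chi> g)}"

lemma char_spanI:
  "(\<And>g. g \<in> carrier G \<Longrightarrow> f g = (\<Sum>\<chi>\<in>irr_chars G. a \<chi> * \<chi> g)) \<Longrightarrow> f \<in> char_span G"
  by (auto simp: char_span_def)

lemma char_span_add: "f \<in> char_span G \<Longrightarrow> h \<in> char_span G \<Longrightarrow> (\<lambda>g. f g + h g) \<in> char_span G"
proof -
  assume "f \<in> char_span G" "h \<in> char_span G"
  then obtain a b where "\<forall>g\<in>carrier G. f g = (\<Sum>\<chi>\<in>irr_chars G. a \<chi> * \<chi> g)"
     "\<forall>g\<in>carrier G. h g = (\<Sum>\<chi>\<in>irr_chars G. b \<chi> * \<chi> g)" by (auto simp: char_span_def)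
  thus ?thesis
    by (intro char_spanI[where a = "\<lambda>\<chi>. a \<chi> + b \<chi>"]) (simp add: distrib_right sum.distrib)
qed

lemma char_span_zero: "(\<lambda>_. 0) \<in> char_span G"
  by (rule char_spanI[where a = "\<lambda>_. 0"]) simp

lemma char_span_smult: "f \<in> char_span G \<Longrightarrow> (\<lambda>g. c * f g) \<in> char_span G"
proof -
  assume "f \<in> char_span G"
  then obtain a where "\<forall>g\<in>carrier G. f g = (\<Sum>\<chi>\<in>irr_chars G. a \<chi> * \<chi> g)" by (auto simp: char_span_def)
  thus ?thesis
    by (intro char_spanI[where a = "\<lambda>\<chi>. c * a \<chi>"]) (simp add: sum_distrib_left mult.assoc)
qed

lemma char_span_sum: "(\<And>i. i \<in> I \<Longrightarrow> f i \<in> char_span G) \<Longrightarrow> (\<lambda>g. \<Sum>i\<in>I. f i g) \<in> char_span G"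
  by (induction I rule: infinite_finite_induct) (simp_all add: char_span_zero char_span_add)

lemma char_span_cong: "f \<in> char_span G \<Longrightarrow> (\<And>g. g \<in> carrier G \<Longrightarrow> f g = h g) \<Longrightarrow> h \<in> char_span G"
  by (auto simp: char_span_def)

lemma char_span_irr:
  assumes "finite (irr_chars G)" "irreducible_rep G n \<rho>"
  shows "(\<lambda>g. mat_trace n (\<rho> g)) \<in> char_span G"
proof -
  define \<chi> where "\<chi> = (\<lambda>g. if g \<in> carrier G then mat_trace n (\<rho> g) else 0)"
  have \<chi>: "\<chi> \<in> irr_chars G" using assms by (auto simp: irr_chars_def \<chi>_def)
  show ?thesis
  proof (rule char_spanI[where a = "\<lambda>\<psi>. if \<psi> = \<chi> then 1 else 0"])
    fix g assume g: "g \<in> carrier G"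
    have "(\<Sum>\<psi>\<in>irr_chars G. (if \<psi> = \<chi> then 1 else 0) * \<psi> g) = (\<Sum>\<psi>\<in>irr_chars G. if \<psi> = \<chi> then \<psi> g else 0)"
      by (intro sum.cong) auto
    thus "mat_trace n (\<rho> g) = (\<Sum>\<psi>\<in>irr_chars G. (if \<psi> = \<chi> then 1 else 0) * \<psi> g)"
      using \<chi> assms(1) g by (simp add: \<chi>_def)
  qed
qed

text \<open>In coordinates, the diagonal blocks are the subrepresentation on an invariant subspace
  and its quotient. Inserting \<open>P * Q\<close> between two factors makes conjugation
  multiplicative.\<close>

lemma is_rep_conj_blocks:
  assumes rep: "is_rep G (m + k) \<rho>"
    and P: "P \<in> carrier_mat (m + k) (m + k)" and Q: "Q \<in> carrier_mat (m + k) (m + k)"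
    and QP: "Q * P = 1\<^sub>m (m + k)" and PQ: "P * Q = 1\<^sub>m (m + k)"
    and tri: "\<And>g. g \<in> carrier G \<Longrightarrow> block_triangular m k (Q * \<rho> g * P)"
    and mon: "monoid G"
  shows "is_rep G m (\<lambda>g. upper_block m (Q * \<rho> g * P))" "is_rep G k (\<lambda>g. lower_block m k (Q * \<rho> g * P))"
proof -
  let ?n = "m + k"
  have rc: "\<rho> g \<in> carrier_mat ?n ?n" if "g \<in> carrier G" for g using rep that by (auto simp: is_rep_def)
  have mult: "Q * \<rho> (g \<otimes>\<^bsub>G\<^esub> h) * P = (Q * \<rho> g * P) * (Q * \<rho> h * P)" if gh: "g \<in> carrier G" "h \<in> carrier G" for g h
  proof -
    have "(Q * \<rho> g * P) * (Q * \<rho> h * P) = Q * \<rho> g * (P * Q) * \<rho> h * P"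
      using P Q rc gh by (simp add: square_assoc[of _ ?n] del: mult_carrier_mat)
    also have "\<dots> = Q * (\<rho> g * \<rho> h) * P"
    proof -
      have "Q * \<rho> g * 1\<^sub>m ?n = Q * \<rho> g" using Q rc[OF gh(1)] by (intro right_mult_one_mat[of _ ?n]) simp
      thus ?thesis unfolding PQ using Q rc[OF gh(1)] rc[OF gh(2)]
        by (simp add: square_assoc[of _ ?n] del: mult_carrier_mat)
    qed
    finally have "(Q * \<rho> g * P) * (Q * \<rho> h * P) = Q * (\<rho> g * \<rho> h) * P" .
    moreover have "\<rho> (g \<otimes>\<^bsub>G\<^esub> h) = \<rho> g * \<rho> h" using rep gh unfolding is_rep_def by blast
    ultimately show ?thesis by (simp only:)
  qed
  have one: "Q * \<rho> \<one>\<^bsub>G\<^esub> * P = 1\<^sub>m ?n"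
  proof -
    have "\<rho> \<one>\<^bsub>G\<^esub> = 1\<^sub>m ?n" using rep unfolding is_rep_def by blast
    thus ?thesis using Q QP by simp
  qed
  show "is_rep G m (\<lambda>g. upper_block m (Q * \<rho> g * P))"
    unfolding is_rep_def using block_triangular_mult[OF tri tri] monoid.m_closed[OF mon]
    by (simp add: mult one block_triangular_one)
  show "is_rep G k (\<lambda>g. lower_block m k (Q * \<rho> g * P))"
    unfolding is_rep_def using block_triangular_mult[OF tri tri] monoid.m_closed[OF mon]
    by (simp add: mult one block_triangular_one)
qed

text \<open>For \<open>j < m\<close> column \<open>j\<close> of \<open>P\<close> lies in
  \<open>W\<close>, hence so does its image under \<open>A\<close>; the coordinates of that image
  from \<open>m\<close> on are the lower left part of column \<open>j\<close>.\<close>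

lemma adapted_block_triangular:
  fixes A P Q :: "'a :: field mat"
  assumes A: "A \<in> carrier_mat (m + k) (m + k)"
    and P: "P \<in> carrier_mat (m + k) (m + k)" and Q: "Q \<in> carrier_mat (m + k) (m + k)"
    and QP: "Q * P = 1\<^sub>m (m + k)"
    and W: "\<And>v. v \<in> W \<longleftrightarrow> v \<in> carrier_vec (m + k) \<and> (\<forall>i. m \<le> i \<and> i < m + k \<longrightarrow> (Q *\<^sub>v v) $ i = 0)"
    and inv: "\<And>v. v \<in> W \<Longrightarrow> A *\<^sub>v v \<in> W"
  shows "block_triangular m k (Q * A * P)"
  unfolding block_triangular_def
proof (intro conjI allI impI)
  fix i j assume i: "i < k" and j: "j < m"
  let ?n = "m + k"
  let ?e = "unit_vec ?n j"
  have QPe: "Q *\<^sub>v (P *\<^sub>v ?e) = ?e"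
    using square_assoc(3)[OF Q P, of ?e] QP by simp
  have "P *\<^sub>v ?e \<in> W" unfolding W QPe using P j by auto
  hence "A *\<^sub>v (P *\<^sub>v ?e) \<in> W" by (rule inv)
  hence "(Q *\<^sub>v (A *\<^sub>v (P *\<^sub>v ?e))) $ (i + m) = 0" using W i by auto
  moreover have "Q *\<^sub>v (A *\<^sub>v (P *\<^sub>v ?e)) = (Q * A * P) *\<^sub>v ?e" using A P Q
    by (simp add: square_assoc[of _ ?n] del: mult_carrier_mat)
  moreover have "((Q * A * P) *\<^sub>v ?e) $ (i + m) = (Q * A * P) $$ (i + m, j)"
  proof -
    have "Q * A * P \<in> carrier_mat ?n ?n" using A P Q by (simp add: square_assoc[of _ ?n] del: mult_carrier_mat)
    thus ?thesis using i j by (subst index_mult_mat_vec) (auto simp: row_def simp del: index_mult_mat)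
  qed
  ultimately show "(Q * A * P) $$ (i + m, j) = 0" by simp
qed (use A P Q in auto)

text \<open>Instead of decomposing representations into a direct sum, it suffices to triangularise them:
  traces only see the composition factors. Allowing an intertwiner \<open>R\<close> makes the induction
  work along the eigenspaces of \<open>R\<close>, and yields Schur's lemma on the way.\<close>

lemma trace_intertwiner_in_char_span:
  assumes mon: "monoid G" and fin: "finite (irr_chars G)"
  shows "is_rep G n \<rho> \<Longrightarrow> R \<in> carrier_mat n n \<Longrightarrow> (\<And>g. g \<in> carrier G \<Longrightarrow> \<rho> g * R = R * \<rho> g) \<Longrightarrow>
    (\<lambda>g. mat_trace n (\<rho> g * R)) \<in> char_span G"
proof (induction n arbitrary: \<rho> R rule: less_induct)
  case (less n)
  note rep = less.prems(1) and R = less.prems(2) and comm = less.prems(3)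
  have rc: "\<rho> g \<in> carrier_mat n n" if "g \<in> carrier G" for g using rep that by (auto simp: is_rep_def)
  \<comment> \<open>The split is on subspaces invariant under \<rho> and \<open>R\<close> together:
    a proper one makes both block triangular, and the two diagonal blocks are smaller
    instances.\<close>
  show ?case
  proof (cases "\<exists>W. invariant_subspace G n \<rho> W \<and> (\<forall>v\<in>W. R *\<^sub>v v \<in> W) \<and> W \<noteq> {0\<^sub>v n} \<and> W \<noteq> carrier_vec n")
    case True
    then obtain W where inv: "invariant_subspace G n \<rho> W" and RW: "\<And>v. v \<in> W \<Longrightarrow> R *\<^sub>v v \<in> W"
      and proper: "W \<noteq> {0\<^sub>v n}" "W \<noteq> carrier_vec n" by blast
    obtain m P Q where m: "0 < m" "m < n" and P: "P \<in> carrier_mat n n" and Q: "Q \<in> carrier_mat n n"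
      and QP: "Q * P = 1\<^sub>m n" and PQ: "P * Q = 1\<^sub>m n"
      and W: "\<And>v. v \<in> W \<longleftrightarrow> v \<in> carrier_vec n \<and> (\<forall>i. m \<le> i \<and> i < n \<longrightarrow> (Q *\<^sub>v v) $ i = 0)"
      by (rule subspace_adapted_basis[of W n]) (use inv proper in \<open>auto simp: invariant_subspace_def\<close>)
    define k where "k = n - m"
    have n: "n = m + k" using m by (simp add: k_def)
    define R' where "R' = Q * R * P"
    define \<rho>' where "\<rho>' g = Q * \<rho> g * P" for g
    have tR: "block_triangular m k R'"
      unfolding R'_def using adapted_block_triangular[OF _ _ _ _ W[unfolded n] RW] P Q QP R
      unfolding n by blast
    have t\<rho>: "block_triangular m k (\<rho>' g)" if g: "g \<in> carrier G" for g
    proof -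
      have "\<And>v. v \<in> W \<Longrightarrow> \<rho> g *\<^sub>v v \<in> W" using inv g by (auto simp: invariant_subspace_def)
      from adapted_block_triangular[OF _ _ _ _ W[unfolded n] this] show ?thesis
        unfolding \<rho>'_def using P Q QP rc[OF g] unfolding n by blast
    qed
    have prod: "\<rho>' g * R' = Q * (\<rho> g * R) * P" "R' * \<rho>' g = Q * (R * \<rho> g) * P" if g: "g \<in> carrier G" for g
    proof -
      have "A * P * (Q * B) = A * B" if "A \<in> carrier_mat n n" "B \<in> carrier_mat n n" for A B
      proof -
        have "A * P * (Q * B) = A * (P * Q) * B" using that P Q by (simp add: square_assoc[of _ n] del: mult_carrier_mat)
        thus ?thesis using PQ that by simp
      qed
      note * = this
      have "\<rho>' g * R' = (Q * \<rho> g) * P * (Q * (R * P))" unfolding \<rho>'_def R'_def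
        using P Q R rc[OF g] by (simp add: square_assoc[of _ n] del: mult_carrier_mat)
      also have "\<dots> = (Q * \<rho> g) * (R * P)" using P Q R rc[OF g] by (intro *) auto
      also have "\<dots> = Q * (\<rho> g * R) * P" using P Q R rc[OF g] by (simp add: square_assoc[of _ n] del: mult_carrier_mat)
      finally show "\<rho>' g * R' = Q * (\<rho> g * R) * P" .
      have "R' * \<rho>' g = (Q * R) * P * (Q * (\<rho> g * P))" unfolding \<rho>'_def R'_def
        using P Q R rc[OF g] by (simp add: square_assoc[of _ n] del: mult_carrier_mat)
      also have "\<dots> = (Q * R) * (\<rho> g * P)" using P Q R rc[OF g] by (intro *) auto
      also have "\<dots> = Q * (R * \<rho> g) * P" using P Q R rc[OF g] by (simp add: square_assoc[of _ n] del: mult_carrier_mat)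
      finally show "R' * \<rho>' g = Q * (R * \<rho> g) * P" .
    qed
    have comm': "\<rho>' g * R' = R' * \<rho>' g" if "g \<in> carrier G" for g using prod[OF that] comm[OF that] by simp
    have reps: "is_rep G m (\<lambda>g. upper_block m (\<rho>' g))" "is_rep G k (\<lambda>g. lower_block m k (\<rho>' g))"
      unfolding \<rho>'_def
      by (rule is_rep_conj_blocks[OF rep[unfolded n] P[unfolded n] Q[unfolded n] QP[unfolded n] PQ[unfolded n] _ mon],
          use t\<rho> in \<open>simp add: \<rho>'_def\<close>)+
    have cu: "upper_block m (\<rho>' g) * upper_block m R' = upper_block m R' * upper_block m (\<rho>' g)"
      and cl: "lower_block m k (\<rho>' g) * lower_block m k R' = lower_block m k R' * lower_block m k (\<rho>' g)"
      if g: "g \<in> carrier G" for g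
      using block_triangular_mult[OF t\<rho>[OF g] tR] block_triangular_mult[OF tR t\<rho>[OF g]] comm'[OF g] by metis+
    have "(\<lambda>g. mat_trace m (upper_block m (\<rho>' g) * upper_block m R')) \<in> char_span G"
      by (rule less.IH[OF m(2) reps(1) block_carrier(1) cu])
    moreover have "(\<lambda>g. mat_trace k (lower_block m k (\<rho>' g) * lower_block m k R')) \<in> char_span G"
      by (rule less.IH[OF _ reps(2) block_carrier(2) cl]) (use m in \<open>simp_all add: k_def\<close>)
    ultimately have sum: "(\<lambda>g. mat_trace m (upper_block m (\<rho>' g) * upper_block m R') + mat_trace k (lower_block m k (\<rho>' g) * lower_block m k R')) \<in> char_span G"
      by (rule char_span_add)
    show ?thesis
    proof (rule char_span_cong[OF sum])
      fix g assume g: "g \<in> carrier G"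
      have "mat_trace m (upper_block m (\<rho>' g) * upper_block m R') + mat_trace k (lower_block m k (\<rho>' g) * lower_block m k R')
          = mat_trace (m + k) (\<rho>' g * R')"
        unfolding block_triangular_mult(1,2)[OF t\<rho>[OF g] tR, symmetric]
        using block_triangular_mult(3)[OF t\<rho>[OF g] tR]
        by (intro mat_trace_blocks[symmetric]) (simp add: block_triangular_def)
      also have "\<dots> = mat_trace n (Q * ((\<rho> g * R) * P))"
        unfolding n[symmetric] prod[OF g] using P Q R rc[OF g] by (simp add: square_assoc[of _ n] del: mult_carrier_mat)
      also have "\<dots> = mat_trace n ((\<rho> g * R) * P * Q)"
        using P Q R rc[OF g] by (intro mat_trace_comm) (simp_all add: square_assoc[of _ n] del: mult_carrier_mat)
      also have "(\<rho> g * R) * P * Q = \<rho> g * R"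
        using P Q R rc[OF g] PQ by (simp add: square_assoc[of _ n] del: mult_carrier_mat)
      finally show "mat_trace m (upper_block m (\<rho>' g) * upper_block m R') + mat_trace k (lower_block m k (\<rho>' g) * lower_block m k R')
          = mat_trace n (\<rho> g * R)" .
    qed
  next
    case False
    hence triv: "W = {0\<^sub>v n} \<or> W = carrier_vec n"
      if "invariant_subspace G n \<rho> W" "\<And>v. v \<in> W \<Longrightarrow> R *\<^sub>v v \<in> W" for W
      using that by blast
    show ?thesis
    proof (cases "n = 0")
      case True
      thus ?thesis by (simp add: mat_trace_def char_span_zero)
    next
      case n: False
      have "spectrum R \<noteq> {}" using spectrum_non_empty[OF R] n by simp
      then obtain c where "eigenvalue R c" by (auto simp: spectrum_def)
      then obtain v where v: "v \<in> carrier_vec n" "v \<noteq> 0\<^sub>v n" "R *\<^sub>v v = c \<cdot>\<^sub>v v"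
        using R by (auto simp: eigenvalue_def eigenvector_def)
      \<comment> \<open>Without a proper jointly invariant subspace the eigenspace of
        \<open>R\<close> is everything, because \<rho> commutes with \<open>R\<close>. So
        \<open>R\<close> is a scalar, every \<rho>-invariant subspace is invariant under
        \<open>R\<close>, and \<rho> is irreducible.\<close>
      define W where "W = {v \<in> carrier_vec n. R *\<^sub>v v = c \<cdot>\<^sub>v v}"
      have "W = {0\<^sub>v n} \<or> W = carrier_vec n"
      proof (rule triv)
        show "invariant_subspace G n \<rho> W"
          unfolding invariant_subspace_def
        proof (intro conjI ballI allI)
          show "0\<^sub>v n \<in> W" using R by (auto simp: W_def)
          fix v assume v: "v \<in> W"
          show "v + w \<in> W" if "w \<in> W" for w
            using v that R by (auto simp: W_def mult_add_distrib_mat_vec smult_add_distrib_vec)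
          show "a \<cdot>\<^sub>v v \<in> W" for a
            using v R by (auto simp: W_def mult_mat_vec smult_smult_assoc mult.commute)
          fix g assume g: "g \<in> carrier G"
          have vc: "v \<in> carrier_vec n" using v by (auto simp: W_def)
          have "R *\<^sub>v (\<rho> g *\<^sub>v v) = (R * \<rho> g) *\<^sub>v v" using R rc[OF g] vc by simp
          also have "R * \<rho> g = \<rho> g * R" using comm[OF g] by simp
          also have "\<dots> *\<^sub>v v = \<rho> g *\<^sub>v (R *\<^sub>v v)" using R rc[OF g] vc by simp
          also have "\<dots> = c \<cdot>\<^sub>v (\<rho> g *\<^sub>v v)" using v rc[OF g] by (simp add: W_def mult_mat_vec)
          finally show "\<rho> g *\<^sub>v v \<in> W" using rc[OF g] vc by (auto simp: W_def)
        qed (auto simp: W_def)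
        show "R *\<^sub>v v \<in> W" if "v \<in> W" for v
          using that R by (auto simp: W_def mult_mat_vec)
      qed
      moreover have "v \<in> W" using v by (auto simp: W_def)
      ultimately have Wall: "W = carrier_vec n" using v by auto
      have Rv: "R *\<^sub>v w = c \<cdot>\<^sub>v w" if "w \<in> carrier_vec n" for w
        using that Wall by (auto simp: W_def)
      have irr: "irreducible_rep G n \<rho>"
        unfolding irreducible_rep_def
      proof (intro conjI allI impI)
        fix U assume U: "invariant_subspace G n \<rho> U"
        show "U = {0\<^sub>v n} \<or> U = carrier_vec n"
          by (rule triv[OF U]) (use U Rv in \<open>auto simp: invariant_subspace_def subset_iff\<close>)
      qed (use rep n in auto)
      show ?thesis
      proof (rule char_span_cong[OF char_span_smult[OF char_span_irr[OF fin irr]]])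
        fix g assume g: "g \<in> carrier G"
        have Rij: "R $$ (i, j) = (if i = j then c else 0)" if "i < n" "j < n" for i j
        proof -
          have "(R *\<^sub>v unit_vec n j) $ i = R $$ (i, j)" using that R by (auto simp: row_def)
          thus ?thesis using that by (auto simp: Rv)
        qed
        have "\<rho> g * R = c \<cdot>\<^sub>m \<rho> g"
        proof (rule eq_matI)
          fix i j assume "i < dim_row (c \<cdot>\<^sub>m \<rho> g)" "j < dim_col (c \<cdot>\<^sub>m \<rho> g)"
          hence ij: "i < n" "j < n" using rc[OF g] by auto
          have "(\<rho> g * R) $$ (i, j) = (\<Sum>l<n. \<rho> g $$ (i, l) * R $$ (l, j))"
            using ij R rc[OF g] by (auto simp: scalar_prod_def atLeast0LessThan)
          also have "\<dots> = (\<Sum>l<n. if l = j then \<rho> g $$ (i, l) * c else 0)"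
            using ij by (intro sum.cong) (auto simp: Rij)
          finally show "(\<rho> g * R) $$ (i, j) = (c \<cdot>\<^sub>m \<rho> g) $$ (i, j)"
            using ij rc[OF g] by (simp add: mult.commute)
        qed (use R rc[OF g] in auto)
        thus "c * mat_trace n (\<rho> g) = mat_trace n (\<rho> g * R)"
          using rc[OF g] by (simp add: mat_trace_def sum_distrib_left)
      qed
    qed
  qed
qed

text \<open>The order of the centralizer of g if g and h are conjugate, and 0 otherwise. Classically
  it is the sum over the irreducible \<chi> of \<chi>(g) times the conjugate of \<chi>(h).\<close>

definition conj_count :: "('g, 'b) monoid_scheme \<Rightarrow> 'g \<Rightarrow> 'g \<Rightarrow> nat" where
  "conj_count G h g = card {x \<in> carrier G. g \<otimes>\<^bsub>G\<^esub> x = x \<otimes>\<^bsub>G\<^esub> h}"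

context group
begin

text \<open>The count is the trace of the regular representation composed with right multiplication by \<open>inv h\<close>,
  which commutes with it.\<close>

lemma conj_count_in_char_span:
  assumes fin: "finite (carrier G)" and irr: "finite (irr_chars G)" and h: "h \<in> carrier G"
  shows "(\<lambda>g. of_nat (conj_count G h g)) \<in> char_span G"
proof -
  define n where "n = card (carrier G)"
  obtain f where f: "bij_betw f {..<n} (carrier G)"
    using ex_bij_betw_nat_finite[OF fin] by (auto simp: n_def atLeast0LessThan)
  have fc: "f i \<in> carrier G" if "i < n" for i using f that by (auto simp: bij_betw_def)
  have inj: "f i = f j \<longleftrightarrow> i = j" if "i < n" "j < n" for i j
    using f that by (auto simp: bij_betw_def inj_on_def)
  have reindex: "(\<Sum>l<n. F (f l)) = (\<Sum>y\<in>carrier G. F y)" for F :: "'a \<Rightarrow> complex"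
    using sum.reindex_bij_betw[OF f] .
  \<comment> \<open>Permutation matrices: \<open>\<rho> g\<close> sends the basis vector at y to the
    one at g y, and \<open>R\<close> sends it to the one at y times \<open>inv h\<close>.\<close>
  define \<rho> where "\<rho> g = mat n n (\<lambda>(i, j). if f i = g \<otimes> f j then 1 else 0 :: complex)" for g
  define R where "R = mat n n (\<lambda>(i, j). if f i \<otimes> h = f j then 1 else 0 :: complex)"
  have prod: "(\<Sum>l<n. (if P (f l) then 1 else 0) * (if f l = a then 1 else 0 :: complex)) = (if P a then 1 else 0)"
    if "a \<in> carrier G" for P a
  proof -
    have "(\<Sum>l<n. (if P (f l) then 1 else 0) * (if f l = a then 1 else 0 :: complex))
        = (\<Sum>y\<in>carrier G. if y = a then if P y then 1 else 0 else 0)"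
      by (subst reindex[symmetric]) (auto intro!: sum.cong)
    thus ?thesis using that fin by simp
  qed
  have \<rho>\<rho>: "\<rho> (g \<otimes> k) = \<rho> g * \<rho> k" if gk: "g \<in> carrier G" "k \<in> carrier G" for g k
  proof (rule eq_matI)
    fix i j assume "i < dim_row (\<rho> g * \<rho> k)" "j < dim_col (\<rho> g * \<rho> k)"
    hence ij: "i < n" "j < n" by (auto simp: \<rho>_def)
    have "(\<rho> g * \<rho> k) $$ (i, j) = (\<Sum>l<n. (if f i = g \<otimes> f l then 1 else 0) * (if f l = k \<otimes> f j then 1 else 0))"
      using ij by (auto simp: \<rho>_def scalar_prod_def atLeast0LessThan intro!: sum.cong)
    also have "\<dots> = (if f i = g \<otimes> (k \<otimes> f j) then 1 else 0)"
      using gk fc[OF ij(2)] by (intro prod) auto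
    finally show "\<rho> (g \<otimes> k) $$ (i, j) = (\<rho> g * \<rho> k) $$ (i, j)"
      using ij gk fc by (simp add: \<rho>_def m_assoc)
  qed (auto simp: \<rho>_def)
  have rep: "is_rep G n \<rho>"
    unfolding is_rep_def
  proof (intro conjI ballI)
    show "\<rho> \<one> = 1\<^sub>m n" by (rule eq_matI) (auto simp: \<rho>_def fc inj)
  qed (auto simp: \<rho>\<rho>, auto simp: \<rho>_def)
  have \<rho>R: "(\<rho> g * R) $$ (i, j) = (\<Sum>l<n. (if f i = g \<otimes> f l then 1 else 0) * (if f l \<otimes> h = f j then 1 else 0))"
    if "i < n" "j < n" for g i j
    using that by (auto simp: \<rho>_def R_def scalar_prod_def atLeast0LessThan intro!: sum.cong)
  have comm: "\<rho> g * R = R * \<rho> g" if g: "g \<in> carrier G" for g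
  proof (rule eq_matI)
    fix i j assume "i < dim_row (R * \<rho> g)" "j < dim_col (R * \<rho> g)"
    hence ij: "i < n" "j < n" by (auto simp: \<rho>_def R_def)
    have "(\<rho> g * R) $$ (i, j) = (\<Sum>l<n. (if f l \<otimes> h = f j then 1 else 0) * (if f l = inv g \<otimes> f i then 1 else 0))"
      unfolding \<rho>R[OF ij] using g fc ij by (intro sum.cong) (auto simp: inv_solve_left mult.commute)
    also have "\<dots> = (if inv g \<otimes> f i \<otimes> h = f j then 1 else 0)"
      using g fc[OF ij(1)] by (intro prod) auto
    also have "inv g \<otimes> f i \<otimes> h = f j \<longleftrightarrow> f i \<otimes> h = g \<otimes> f j"
      using g fc ij h by (metis inv_solve_left m_assoc m_closed inv_closed)
    also have "(if f i \<otimes> h = g \<otimes> f j then 1 else 0 :: complex)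
        = (\<Sum>l<n. (if f i \<otimes> h = f l then 1 else 0) * (if f l = g \<otimes> f j then 1 else 0))"
      using g fc[OF ij(2)] by (intro prod[symmetric]) auto
    also have "\<dots> = (R * \<rho> g) $$ (i, j)"
      using ij by (auto simp: \<rho>_def R_def scalar_prod_def atLeast0LessThan intro!: sum.cong)
    finally show "(\<rho> g * R) $$ (i, j) = (R * \<rho> g) $$ (i, j)" .
  qed (auto simp: \<rho>_def R_def)
  have span: "(\<lambda>g. mat_trace n (\<rho> g * R)) \<in> char_span G"
    by (rule trace_intertwiner_in_char_span[OF monoid_axioms irr rep _ comm]) (auto simp: R_def)
  show ?thesis
  proof (rule char_span_cong[OF span])
    fix g assume g: "g \<in> carrier G"
    have "mat_trace n (\<rho> g * R)
        = (\<Sum>i<n. \<Sum>l<n. (if f i = g \<otimes> f l then 1 else 0) * (if f l \<otimes> h = f i then 1 else 0))"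
      by (simp add: mat_trace_def \<rho>R del: index_mult_mat)
    also have "\<dots> = (\<Sum>l<n. \<Sum>i<n. (if f l \<otimes> h = f i then 1 else 0) * (if f i = g \<otimes> f l then 1 else 0))"
      by (subst sum.swap) (simp add: mult.commute)
    also have "\<dots> = (\<Sum>l<n. if f l \<otimes> h = g \<otimes> f l then 1 else 0)"
      using g fc by (intro sum.cong refl prod) auto
    also have "\<dots> = (\<Sum>y\<in>carrier G. if y \<otimes> h = g \<otimes> y then 1 else 0)"
      by (rule reindex)
    also have "\<dots> = of_nat (conj_count G h g)"
    proof -
      have "{y \<in> carrier G. y \<otimes> h = g \<otimes> y} = {y \<in> carrier G. g \<otimes> y = y \<otimes> h}" by auto
      thus ?thesis using fin by (simp add: conj_count_def sum.If_cases Int_def)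
    qed
    finally show "mat_trace n (\<rho> g * R) = of_nat (conj_count G h g)" .
  qed
qed

lemma conj_count_eq_sum:
  assumes "finite (carrier G)" "g \<in> carrier G" "h \<in> carrier G"
  shows "conj_count G h g = (\<Sum>x\<in>carrier G. if h = inv x \<otimes> g \<otimes> x then 1 else 0)"
proof -
  have "g \<otimes> x = x \<otimes> h \<longleftrightarrow> h = inv x \<otimes> g \<otimes> x" if "x \<in> carrier G" for x
    using that assms by (metis inv_solve_left m_assoc m_closed inv_closed)
  hence "{x \<in> carrier G. g \<otimes> x = x \<otimes> h} = {x \<in> carrier G. h = inv x \<otimes> g \<otimes> x}" by blast
  thus ?thesis using assms by (simp add: conj_count_def sum.If_cases Int_def)
qed

text \<open>A class function is its own average over conjugates: f(g) is 1/|G| times the sum over x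
  of f(x^-1 g x). Sorting this sum by the value h of x^-1 g x exhibits f as a combination of the
  functions \<open>conj_count G h\<close>.\<close>

lemma class_function_in_char_span:
  assumes fin: "finite (carrier G)" and irr: "finite (irr_chars G)"
    and cl: "\<And>g x. g \<in> carrier G \<Longrightarrow> x \<in> carrier G \<Longrightarrow> f (inv x \<otimes> g \<otimes> x) = f g"
  shows "f \<in> char_span G"
proof -
  have "(\<lambda>g. \<Sum>h\<in>carrier G. f h / of_nat (card (carrier G)) * of_nat (conj_count G h g)) \<in> char_span G"
    using conj_count_in_char_span[OF fin irr] by (intro char_span_sum char_span_smult) auto
  thus ?thesis
  proof (rule char_span_cong)
    fix g assume g: "g \<in> carrier G"
    have "(\<Sum>h\<in>carrier G. f h * of_nat (conj_count G h g))
        = (\<Sum>h\<in>carrier G. \<Sum>x\<in>carrier G. if h = inv x \<otimes> g \<otimes> x then f h else 0)"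
    proof (intro sum.cong refl)
      fix h assume "h \<in> carrier G"
      hence "f h * of_nat (conj_count G h g) = (\<Sum>x\<in>carrier G. f h * of_nat (if h = inv x \<otimes> g \<otimes> x then 1 else 0))"
        using conj_count_eq_sum[OF fin g, of h] by (simp only: of_nat_sum sum_distrib_left)
      also have "\<dots> = (\<Sum>x\<in>carrier G. if h = inv x \<otimes> g \<otimes> x then f h else 0)"
        by (intro sum.cong) auto
      finally show "f h * of_nat (conj_count G h g) = (\<Sum>x\<in>carrier G. if h = inv x \<otimes> g \<otimes> x then f h else 0)" .
    qed
    also have "\<dots> = (\<Sum>x\<in>carrier G. f (inv x \<otimes> g \<otimes> x))"
      using fin g by (subst sum.swap) auto
    also have "\<dots> = of_nat (card (carrier G)) * f g"
      using g by (simp add: cl)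
    finally have *: "(\<Sum>h\<in>carrier G. f h * of_nat (conj_count G h g)) = of_nat (card (carrier G)) * f g" .
    have "card (carrier G) \<noteq> 0" using fin by auto
    thus "(\<Sum>h\<in>carrier G. f h / of_nat (card (carrier G)) * of_nat (conj_count G h g)) = f g"
      using * by (simp flip: sum_divide_distrib)
  qed
qed

lemma irr_chars_class_function:
  assumes "\<chi> \<in> irr_chars G" "g \<in> carrier G" "x \<in> carrier G"
  shows "\<chi> (inv x \<otimes> g \<otimes> x) = \<chi> g"
proof -
  obtain n \<rho> where rep: "is_rep G n \<rho>" and \<chi>: "\<chi> = (\<lambda>g. if g \<in> carrier G then mat_trace n (\<rho> g) else 0)"
    using assms(1) by (auto simp: irr_chars_def irreducible_rep_def)
  have c: "\<rho> y \<in> carrier_mat n n" if "y \<in> carrier G" for y using rep that by (auto simp: is_rep_def)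
  have m: "\<rho> (y \<otimes> z) = \<rho> y * \<rho> z" if "y \<in> carrier G" "z \<in> carrier G" for y z
    using rep that unfolding is_rep_def by blast
  have "mat_trace n (\<rho> (inv x \<otimes> g \<otimes> x)) = mat_trace n (\<rho> (inv x \<otimes> (g \<otimes> x)))"
    using assms by (simp add: m_assoc)
  also have "\<dots> = mat_trace n (\<rho> (inv x) * \<rho> (g \<otimes> x))" using assms by (subst m) auto
  also have "\<dots> = mat_trace n (\<rho> (g \<otimes> x) * \<rho> (inv x))" using assms by (intro mat_trace_comm c) auto
  also have "\<dots> = mat_trace n (\<rho> (g \<otimes> x \<otimes> inv x))" using assms by (subst m) auto
  finally show ?thesis using assms by (simp add: \<chi> m_assoc)
qed

text \<open>Every x conjugates g to exactly one h. This is the orbit-stabilizer count behind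
  \<open>card_centralizer\<close>.\<close>

lemma sum_conj_count:
  assumes "finite (carrier G)" "g \<in> carrier G"
  shows "(\<Sum>h\<in>carrier G. conj_count G h g) = card (carrier G)"
proof -
  have "(\<Sum>h\<in>carrier G. conj_count G h g) = (\<Sum>h\<in>carrier G. \<Sum>x\<in>carrier G. if h = inv x \<otimes> g \<otimes> x then 1 else 0)"
    using assms by (intro sum.cong refl conj_count_eq_sum) auto
  also have "\<dots> = card (carrier G)"
    using assms by (subst sum.swap) auto
  finally show ?thesis .
qed

lemma conj_count_commute: "g \<in> carrier G \<Longrightarrow> h \<in> carrier G \<Longrightarrow> conj_count G h g = conj_count G g h"
  unfolding conj_count_def
proof (rule bij_betw_same_card[of "\<lambda>x. inv x"], rule bij_betw_byWitness[of _ "\<lambda>x. inv x"])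
  have *: "(\<lambda>x. inv x) ` {x \<in> carrier G. g \<otimes> x = x \<otimes> h} \<subseteq> {x \<in> carrier G. h \<otimes> x = x \<otimes> g}"
    if "g \<in> carrier G" "h \<in> carrier G" for g h
    using that by (auto simp: inv_solve_left inv_solve_right m_assoc)
      (metis inv_closed inv_solve_left inv_solve_right m_assoc m_closed)
  show "(\<lambda>x. inv x) ` {x \<in> carrier G. g \<otimes> x = x \<otimes> h} \<subseteq> {x \<in> carrier G. h \<otimes> x = x \<otimes> g}"
    "(\<lambda>x. inv x) ` {x \<in> carrier G. h \<otimes> x = x \<otimes> g} \<subseteq> {x \<in> carrier G. g \<otimes> x = x \<otimes> h}"
    if "g \<in> carrier G" "h \<in> carrier G"
    using * that by blast+
qed auto

lemma prime_dvd_card_subgroup: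
  assumes "subgroup H G" "finite H" "x \<in> H" "x \<noteq> \<one>" "x [^] p = \<one>" "prime (p :: nat)"
  shows "p dvd card H"
proof -
  interpret H: group "G\<lparr>carrier := H\<rparr>" using assms(1) by (rule subgroup_imp_group)
  have pow: "x [^]\<^bsub>G\<lparr>carrier := H\<rparr>\<^esub> p = \<one>\<^bsub>G\<lparr>carrier := H\<rparr>\<^esub>" using assms nat_pow_consistent by simp
  hence "H.ord x dvd p" using assms H.pow_eq_id[of x p] by simp
  moreover have "H.ord x \<noteq> 1" using assms H.ord_eq_1[of x] by auto
  ultimately have "H.ord x = p" using assms(6) by (auto simp: prime_nat_iff)
  thus ?thesis using H.ord_dvd_group_order[of x] assms by (simp add: order_def)
qed

text \<open>Cauchy's theorem inside a subgroup, from Sylow's theorem for the exponent 1. It is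
  applied to the whole group and to a centralizer.\<close>

lemma ex_prime_order:
  assumes "subgroup H G" "finite H" "prime (p :: nat)" "p dvd card H"
  obtains x where "x \<in> H" "x \<noteq> \<one>" "x [^] p = \<one>"
proof -
  interpret H: group "G\<lparr>carrier := H\<rparr>" using assms(1) by (rule subgroup_imp_group)
  obtain m where "card H = p ^ 1 * m" using assms(4) by auto
  then obtain K where K: "subgroup K (G\<lparr>carrier := H\<rparr>)" "card K = p"
    using sylow_thm[of p "G\<lparr>carrier := H\<rparr>" 1 m] assms H.is_group by (auto simp: order_def)
  have KH: "K \<subseteq> H" using subgroup.subset[OF K(1)] by simp
  have KG: "subgroup K G" using K(1) assms(1) incl_subgroup by blast
  have "\<one> \<in> K" using subgroup.one_closed[OF KG] .
  moreover have "K \<noteq> {\<one>}" using K(2) assms(3) by auto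
  ultimately obtain x where x: "x \<in> K" "x \<noteq> \<one>" by blast
  interpret K: group "G\<lparr>carrier := K\<rparr>" using KG by (rule subgroup_imp_group)
  have "x [^]\<^bsub>G\<lparr>carrier := K\<rparr>\<^esub> order (G\<lparr>carrier := K\<rparr>) = \<one>\<^bsub>G\<lparr>carrier := K\<rparr>\<^esub>"
    using x by (intro K.pow_order_eq_1) auto
  hence "x [^] p = \<one>" using K(2) nat_pow_consistent by (simp add: order_def)
  thus ?thesis using that x KH by auto
qed

lemma centralizer_subgroup:
  assumes "g \<in> carrier G"
  shows "subgroup {x \<in> carrier G. g \<otimes> x = x \<otimes> g} G"
proof
  fix x y assume "x \<in> {x \<in> carrier G. g \<otimes> x = x \<otimes> g}" "y \<in> {x \<in> carrier G. g \<otimes> x = x \<otimes> g}"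
  thus "x \<otimes> y \<in> {x \<in> carrier G. g \<otimes> x = x \<otimes> g}" using assms by simp (metis m_assoc)
next
  fix x assume "x \<in> {x \<in> carrier G. g \<otimes> x = x \<otimes> g}"
  thus "inv x \<in> {x \<in> carrier G. g \<otimes> x = x \<otimes> g}" using assms
    by simp (metis inv_closed inv_solve_left inv_solve_right m_assoc m_closed)
qed (use assms in auto)

end

section \<open>Rings defined by an eigentable\<close>

text \<open>A one-sided inverse of a square matrix is two-sided, transported to sums over index sets
  of equal size. This turns row orthogonality into column orthogonality.\<close>

lemma square_sum_left_right_inverse:
  fixes a :: "'a \<Rightarrow> 'b \<Rightarrow> 'c :: field"
  assumes fin: "finite X" "finite Y" and card: "card X = card Y"
    and inv: "\<And>x x'. x \<in> X \<Longrightarrow> x' \<in> X \<Longrightarrow> (\<Sum>y\<in>Y. a x y * b y x') = (if x = x' then 1 else 0)"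
    and y: "y \<in> Y" "y' \<in> Y"
  shows "(\<Sum>x\<in>X. b y x * a x y') = (if y = y' then 1 else 0)"
proof -
  define n where "n = card X"
  obtain f where f: "bij_betw f {..<n} X"
    using ex_bij_betw_nat_finite[OF fin(1)] by (auto simp: n_def atLeast0LessThan)
  obtain g where g: "bij_betw g {..<n} Y"
    using ex_bij_betw_nat_finite[OF fin(2)] by (auto simp: n_def card atLeast0LessThan)
  define A where "A = mat n n (\<lambda>(i, j). a (f i) (g j))"
  define B where "B = mat n n (\<lambda>(i, j). b (g i) (f j))"
  have AB: "A \<in> carrier_mat n n" "B \<in> carrier_mat n n" by (auto simp: A_def B_def)
  have "A * B = 1\<^sub>m n"
  proof (rule eq_matI)
    fix i j assume "i < dim_row (1\<^sub>m n :: 'c mat)" "j < dim_col (1\<^sub>m n :: 'c mat)"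
    hence ij: "i < n" "j < n" by auto
    have "(A * B) $$ (i, j) = (\<Sum>l<n. a (f i) (g l) * b (g l) (f j))"
      using ij by (auto simp: A_def B_def scalar_prod_def atLeast0LessThan)
    also have "\<dots> = (\<Sum>y\<in>Y. a (f i) y * b y (f j))" by (rule sum.reindex_bij_betw[OF g])
    also have "\<dots> = (if f i = f j then 1 else 0)" using f ij by (intro inv) (auto simp: bij_betw_def)
    also have "f i = f j \<longleftrightarrow> i = j" using f ij by (auto simp: bij_betw_def inj_on_def)
    finally show "(A * B) $$ (i, j) = 1\<^sub>m n $$ (i, j)" using ij by simp
  qed (use AB in auto)
  hence BA: "B * A = 1\<^sub>m n" using mat_mult_left_right_inverse[OF AB] by simp
  obtain i j where ij: "i < n" "j < n" "g i = y" "g j = y'" using g y by (auto simp: bij_betw_def)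
  have "(\<Sum>x\<in>X. b y x * a x y') = (\<Sum>l<n. b y (f l) * a (f l) y')"
    by (rule sum.reindex_bij_betw[OF f, symmetric])
  also have "\<dots> = (B * A) $$ (i, j)"
    using ij by (auto simp: A_def B_def scalar_prod_def atLeast0LessThan)
  also have "\<dots> = (if i = j then 1 else 0)" using ij by (simp add: BA)
  also have "i = j \<longleftrightarrow> y = y'" using g ij by (auto simp: bij_betw_def inj_on_def)
  finally show ?thesis .
qed

text \<open>The weights \<open>w\<close> are a parameter and not defined as column norms:
  \<open>col_norm\<close> recovers the norms from orthonormality, so that a closed formula can be
  supplied. \<open>M\<close> names the natural numbers that the Verlinde sums are assumed to be, and
  \<open>c0\<close> is the column of dimensions.\<close>

locale eigentable =
  fixes B :: "'a set" and C :: "'c set" and lam :: "'a \<Rightarrow> 'c \<Rightarrow> complex" and w :: "'c \<Rightarrow> real"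
    and e :: 'a and c0 :: 'c and d :: "'a \<Rightarrow> 'a" and M :: "'a \<Rightarrow> 'a \<Rightarrow> 'a \<Rightarrow> nat"
  assumes finite_B: "finite B" and finite_C: "finite C" and card_eq: "card C = card B"
    and w_pos: "s \<in> C \<Longrightarrow> w s > 0"
    and row_orth: "x \<in> B \<Longrightarrow> z \<in> B \<Longrightarrow>
      (\<Sum>s\<in>C. lam x s * cnj (lam z s) / of_real (w s)) = (if x = z then 1 else 0)"
    and e: "e \<in> B" "s \<in> C \<Longrightarrow> lam e s = 1"
    and d: "x \<in> B \<Longrightarrow> d x \<in> B" "x \<in> B \<Longrightarrow> s \<in> C \<Longrightarrow> lam (d x) s = cnj (lam x s)"
    and c0: "c0 \<in> C" "x \<in> B \<Longrightarrow> lam x c0 \<in> \<real>" "x \<in> B \<Longrightarrow> Re (lam x c0) > 0"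
    and M: "x \<in> B \<Longrightarrow> y \<in> B \<Longrightarrow> z \<in> B \<Longrightarrow>
      (\<Sum>s\<in>C. lam x s * lam y s * cnj (lam z s) / of_real (w s)) = of_nat (M x y z)"
begin

lemma w_nonzero: "s \<in> C \<Longrightarrow> w s \<noteq> 0"
  using w_pos by force

lemma col_orth:
  assumes "s \<in> C" "t \<in> C"
  shows "(\<Sum>x\<in>B. cnj (lam x s) * lam x t) = (if s = t then of_real (w s) else 0)"
proof -
  have "(\<Sum>x\<in>B. cnj (lam x s) / of_real (w s) * lam x t) = (if s = t then 1 else 0)"
    using row_orth assms by (intro square_sum_left_right_inverse[OF finite_B finite_C]) (simp_all add: card_eq)
  moreover have "(\<Sum>x\<in>B. cnj (lam x s) / of_real (w s) * lam x t) = (\<Sum>x\<in>B. cnj (lam x s) * lam x t) / of_real (w s)"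
    by (simp add: sum_divide_distrib)
  ultimately show ?thesis using w_pos[OF assms(1)] by (auto simp: field_simps split: if_splits)
qed

lemma col_norm: "s \<in> C \<Longrightarrow> (\<Sum>x\<in>B. (cmod (lam x s))\<^sup>2) = w s"
proof -
  assume s: "s \<in> C"
  have "of_real (\<Sum>x\<in>B. (cmod (lam x s))\<^sup>2) = (\<Sum>x\<in>B. cnj (lam x s) * lam x s)"
    unfolding of_real_sum
  proof (intro sum.cong refl)
    fix x show "of_real ((cmod (lam x s))\<^sup>2) = cnj (lam x s) * lam x s"
      by (simp only: complex_norm_square mult.commute)
  qed
  also have "\<dots> = of_real (w s)" using col_orth[OF s s] by simp
  finally show ?thesis by (simp only: of_real_eq_iff)
qed

text \<open>Every column is a ring homomorphism: substitute the Verlinde sum for \<open>M\<close>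
  and collapse it by column orthogonality.\<close>

lemma lam_mult:
  assumes "x \<in> B" "y \<in> B" "s \<in> C"
  shows "lam x s * lam y s = (\<Sum>z\<in>B. of_nat (M x y z) * lam z s)"
proof -
  have "(\<Sum>z\<in>B. of_nat (M x y z) * lam z s)
      = (\<Sum>z\<in>B. \<Sum>t\<in>C. lam x t * lam y t / of_real (w t) * (cnj (lam z t) * lam z s))"
    using assms by (intro sum.cong refl) (simp add: sum_distrib_right mult.assoc flip: M)
  also have "\<dots> = (\<Sum>t\<in>C. lam x t * lam y t / of_real (w t) * (\<Sum>z\<in>B. cnj (lam z t) * lam z s))"
    by (subst sum.swap) (simp add: sum_distrib_left)
  also have "\<dots> = (\<Sum>t\<in>C. if t = s then lam x t * lam y t else 0)"
    using assms w_nonzero by (intro sum.cong refl) (auto simp: col_orth)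
  also have "\<dots> = lam x s * lam y s" using assms finite_C by simp
  finally show ?thesis ..
qed

lemma dual_twice: "x \<in> B \<Longrightarrow> s \<in> C \<Longrightarrow> cnj (lam (d x) s) = lam x s"
  by (simp add: d)

lemma fusion: "fusion_ring B M e"
  unfolding fusion_ring_def
proof (intro conjI ballI exI[of _ d])
  fix i k assume ik: "i \<in> B" "k \<in> B"
  have "(of_nat (M e i k) :: complex) = (if i = k then 1 else 0)"
    using ik e row_orth[of i k] by (simp flip: M)
  thus 1: "M e i k = (if i = k then 1 else 0)" by (simp split: if_splits)
  have "(of_nat (M i e k) :: complex) = (if i = k then 1 else 0)"
    using ik e row_orth[of i k] by (simp flip: M)
  thus 2: "M i e k = (if i = k then 1 else 0)" by (simp split: if_splits)
  have sw: "(\<Sum>s\<in>C. lam i s * lam k s / of_real (w s)) = (\<Sum>s\<in>C. lam k s * lam i s / of_real (w s))"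
    by (simp add: mult.commute)
  have *: "(\<Sum>s\<in>C. lam i s * lam k s / of_real (w s)) = (if d i = k then 1 else 0)"
    unfolding sw using ik d row_orth[of k "d i"] by (auto simp: dual_twice)
  have "(of_nat (M i k e) :: complex) = (if d i = k then 1 else 0)"
    using ik e * by (simp flip: M)
  thus "M i k e = (if d i = k then 1 else 0)" by (simp split: if_splits)
  have "(of_nat (M k i e) :: complex) = (if d i = k then 1 else 0)"
    using ik e * sw by (simp flip: M)
  thus "M k i e = (if d i = k then 1 else 0)" by (simp split: if_splits)
next
  fix i j k l assume B: "i \<in> B" "j \<in> B" "k \<in> B" "l \<in> B"
  \<comment> \<open>Both sides of associativity equal the weighted sum over the columns of the
    product of the four entries, the last one conjugated.\<close>
  have "(of_nat (\<Sum>m\<in>B. M i j m * M m k l) :: complex)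
      = (\<Sum>s\<in>C. (\<Sum>m\<in>B. of_nat (M i j m) * lam m s) * lam k s * cnj (lam l s) / of_real (w s))"
    using B by (simp add: sum_distrib_left sum_distrib_right sum_divide_distrib mult.assoc flip: M[of _ k l])
      (rule sum.swap)
  also have "\<dots> = (\<Sum>s\<in>C. lam i s * lam j s * lam k s * cnj (lam l s) / of_real (w s))"
    using B by (simp add: lam_mult)
  also have "\<dots> = (\<Sum>s\<in>C. lam i s * (\<Sum>m\<in>B. of_nat (M j k m) * lam m s) * cnj (lam l s) / of_real (w s))"
    using B by (simp add: mult.assoc flip: lam_mult)
  also have "\<dots> = of_nat (\<Sum>m\<in>B. M j k m * M i m l)"
    using B by (simp add: sum_distrib_left sum_distrib_right sum_divide_distrib ac_simps flip: M[of i _ l])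
      (rule sum.swap)
  finally show "(\<Sum>m\<in>B. M i j m * M m k l) = (\<Sum>m\<in>B. M j k m * M i m l)"
    by (simp only: of_nat_eq_iff)
next
  fix i j k assume B: "i \<in> B" "j \<in> B" "k \<in> B"
  \<comment> \<open>Natural numbers are their own conjugates. Conjugating the Verlinde sum moves the
    duals between the factors, which is Frobenius reciprocity.\<close>
  have real: "of_nat (M i j k) = cnj (of_nat (M i j k))" by simp
  have "of_nat (M i j k) = (of_nat (M (d i) k j) :: complex)"
    using B d by (subst real) (simp add: ac_simps flip: M)
  thus "M i j k = M (d i) k j" by (simp only: of_nat_eq_iff)
  have "of_nat (M i j k) = (of_nat (M k (d j) i) :: complex)"
    using B d by (subst real) (simp add: ac_simps flip: M)
  thus "M i j k = M k (d j) i" by (simp only: of_nat_eq_iff)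
qed (use finite_B e d in auto)

lemma commutative: "commutative_fr B M"
  unfolding commutative_fr_def
proof (intro ballI)
  fix i j k assume B: "i \<in> B" "j \<in> B" "k \<in> B"
  have "of_nat (M i j k) = (of_nat (M j i k) :: complex)"
    using B by (simp add: ac_simps flip: M)
  thus "M i j k = M j i k" by (simp only: of_nat_eq_iff)
qed

lemma col_eqI: "s \<in> C \<Longrightarrow> t \<in> C \<Longrightarrow> (\<And>x. x \<in> B \<Longrightarrow> lam x s = lam x t) \<Longrightarrow> s = t"
  using col_orth[of s s] col_orth[of s t] w_pos[of s] by (auto split: if_splits)

text \<open>The pairing of \<open>h\<close> with the primitive idempotent of a column \<open>s\<close> is an eigenvector for
  multiplication, with eigenvalues \<open>lam y s\<close> and \<open>h y\<close> at the same time.\<close>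

lemma hom_eq_column:
  assumes he: "h e = 1" and mult: "\<And>x y. x \<in> B \<Longrightarrow> y \<in> B \<Longrightarrow> h x * h y = (\<Sum>z\<in>B. of_nat (M x y z) * h z)"
  obtains s where "s \<in> C" "\<And>x. x \<in> B \<Longrightarrow> h x = lam x s"
proof -
  define \<epsilon> where "\<epsilon> s = (\<Sum>x\<in>B. cnj (lam x s) * h x)" for s
  have expand: "(\<Sum>s\<in>C. lam y s / of_real (w s) * \<epsilon> s) = h y" if y: "y \<in> B" for y
  proof -
    have "(\<Sum>s\<in>C. lam y s / of_real (w s) * \<epsilon> s) = (\<Sum>x\<in>B. (\<Sum>s\<in>C. lam y s * cnj (lam x s) / of_real (w s)) * h x)"
      by (subst sum_distrib_right, subst sum.swap) (simp add: \<epsilon>_def sum_distrib_left ac_simps)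
    also have "\<dots> = (\<Sum>x\<in>B. if x = y then h x else 0)"
      using y by (intro sum.cong refl) (auto simp: row_orth)
    finally show ?thesis using y finite_B by simp
  qed
  have eigen: "h y * \<epsilon> s = lam y s * \<epsilon> s" if s: "s \<in> C" and y: "y \<in> B" for s y
  proof -
    have inner: "(\<Sum>x\<in>B. cnj (lam x s) * of_nat (M x y z)) = lam y s * cnj (lam z s)" if z: "z \<in> B" for z
    proof -
      have "(\<Sum>x\<in>B. cnj (lam x s) * of_nat (M x y z))
          = (\<Sum>x\<in>B. \<Sum>t\<in>C. lam y t * cnj (lam z t) / of_real (w t) * (cnj (lam x s) * lam x t))"
        using y z by (intro sum.cong refl) (simp add: sum_distrib_left ac_simps flip: M)
      also have "\<dots> = (\<Sum>t\<in>C. lam y t * cnj (lam z t) / of_real (w t) * (\<Sum>x\<in>B. cnj (lam x s) * lam x t))"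
        by (subst sum.swap) (simp add: sum_distrib_left)
      also have "\<dots> = (\<Sum>t\<in>C. if t = s then lam y t * cnj (lam z t) else 0)"
        using s w_nonzero by (intro sum.cong refl) (auto simp: col_orth)
      finally show ?thesis using s finite_C by simp
    qed
    have "h y * \<epsilon> s = (\<Sum>x\<in>B. cnj (lam x s) * (h x * h y))"
      by (simp add: \<epsilon>_def sum_distrib_left ac_simps)
    also have "\<dots> = (\<Sum>x\<in>B. \<Sum>z\<in>B. cnj (lam x s) * of_nat (M x y z) * h z)"
      using y by (intro sum.cong refl) (simp add: mult sum_distrib_left ac_simps)
    also have "\<dots> = (\<Sum>z\<in>B. (\<Sum>x\<in>B. cnj (lam x s) * of_nat (M x y z)) * h z)"
      by (subst sum.swap) (simp add: sum_distrib_right)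
    also have "\<dots> = (\<Sum>z\<in>B. lam y s * cnj (lam z s) * h z)" by (intro sum.cong refl) (simp add: inner)
    also have "\<dots> = lam y s * \<epsilon> s" by (simp add: \<epsilon>_def sum_distrib_left ac_simps)
    finally show ?thesis .
  qed
  \<comment> \<open>By \<open>expand\<close> the pairings determine \<open>h\<close>, so they cannot
    all vanish, because \<open>h e = 1\<close>.\<close>
  obtain s where s: "s \<in> C" "\<epsilon> s \<noteq> 0"
  proof (rule ccontr)
    assume "\<not> thesis"
    hence "\<epsilon> s = 0" if "s \<in> C" for s using that \<open>\<And>s. s \<in> C \<Longrightarrow> \<epsilon> s \<noteq> 0 \<Longrightarrow> thesis\<close> by blast
    hence "h e = 0" using expand[OF e(1)] by simp
    thus False using he by simp
  qed
  show ?thesis using that[OF s(1)] eigen[OF s(1)] s(2) by simp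
qed

text \<open>Two entrywise positive columns have a positive inner product and cannot be orthogonal.
  Used for dimension functions and for the column of the group identity.\<close>

lemma positive_column:
  assumes s: "s \<in> C" and torus_pos: "\<And>x. x \<in> B \<Longrightarrow> lam x s \<in> \<real> \<and> Re (lam x s) > 0"
  shows "s = c0"
proof (rule ccontr)
  assume "s \<noteq> c0"
  hence "Re (\<Sum>x\<in>B. cnj (lam x s) * lam x c0) = 0" using col_orth[OF s c0(1)] by simp
  moreover have "Re (\<Sum>x\<in>B. cnj (lam x s) * lam x c0) > 0"
  proof -
    have "Re (cnj (lam x s) * lam x c0) > 0" if "x \<in> B" for x
      using torus_pos[OF that] c0(2,3)[OF that] by (auto simp: complex_is_Real_iff)
    thus ?thesis unfolding Re_sum using finite_B e(1) by (intro sum_pos) auto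
  qed
  ultimately show False by simp
qed

text \<open>Uniqueness of the dimension function: any candidate is a column by
  \<open>hom_eq_column\<close>, and a positive one can only be \<open>c0\<close>.\<close>

lemma integral:
  assumes "\<And>x. x \<in> B \<Longrightarrow> Re (lam x c0) \<in> \<int>"
  shows "integral_fr B M e"
  unfolding integral_fr_def
proof (intro conjI allI impI ballI)
  define f where "f x = Re (lam x c0)" for x
  have f: "of_real (f x) = lam x c0" if "x \<in> B" for x
    using c0(2)[OF that] by (simp add: f_def)
  have "fpdim_hom B M e f"
    unfolding fpdim_hom_def
  proof (intro conjI ballI)
    show "f e = 1" using e c0 by (simp add: f_def)
    show "f i > 0" if "i \<in> B" for i using c0(3)[OF that] by (simp add: f_def)
    fix i j assume "i \<in> B" "j \<in> B"
    hence "of_real (f i * f j) = (of_real (\<Sum>k\<in>B. real (M i j k) * f k) :: complex)"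
      using lam_mult[of i j c0] c0(1) by (simp add: f)
    thus "f i * f j = (\<Sum>k\<in>B. real (M i j k) * f k)" by (simp only: of_real_eq_iff)
  qed
  thus "\<exists>f. fpdim_hom B M e f" by blast
next
  fix f i assume f: "fpdim_hom B M e f" and i: "i \<in> B"
  obtain s where s: "s \<in> C" "\<And>x. x \<in> B \<Longrightarrow> of_real (f x) = lam x s"
  proof (rule hom_eq_column[of "\<lambda>x. of_real (f x)"])
    fix x y assume "x \<in> B" "y \<in> B"
    hence "f x * f y = (\<Sum>k\<in>B. real (M x y k) * f k)" using f by (auto simp: fpdim_hom_def)
    hence "of_real (f x * f y) = (of_real (\<Sum>k\<in>B. real (M x y k) * f k) :: complex)" by simp
    thus "of_real (f x) * of_real (f y) = (\<Sum>z\<in>B. of_nat (M x y z) * (of_real (f z) :: complex))" by simp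
  qed (use f in \<open>auto simp: fpdim_hom_def\<close>)
  have "s = c0"
  proof (rule positive_column[OF s(1)])
    fix x assume x: "x \<in> B"
    have "f x > 0" using f x by (auto simp: fpdim_hom_def)
    thus "lam x s \<in> \<real> \<and> Re (lam x s) > 0" using s(2)[OF x, symmetric] by simp
  qed
  thus "f i \<in> \<int>" using assms[OF i] s(2)[OF i, symmetric] by simp
qed

text \<open>The fusion matrix of \<open>i\<close> sums over the middle index of
  \<open>M i j k\<close>, so its eigenvectors are the conjugated columns. Pairing with the columns
  shows their independence.\<close>

lemma eigentable: "is_eigentable B M C lam"
  unfolding is_eigentable_def
proof (intro conjI exI[of _ "\<lambda>s x. cnj (lam x s)"] allI impI ballI)
  fix a t assume a: "\<forall>x\<in>B. (\<Sum>s\<in>C. a s * cnj (lam x s)) = 0" and t: "t \<in> C"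
  have "0 = (\<Sum>x\<in>B. (\<Sum>s\<in>C. a s * cnj (lam x s)) * lam x t)" using a by simp
  also have "\<dots> = (\<Sum>s\<in>C. a s * (\<Sum>x\<in>B. cnj (lam x s) * lam x t))"
    by (simp only: sum_distrib_right sum_distrib_left mult.assoc) (rule sum.swap)
  also have "\<dots> = (\<Sum>s\<in>C. if s = t then a s * of_real (w s) else 0)"
    using t by (intro sum.cong refl) (auto simp: col_orth)
  also have "\<dots> = a t * of_real (w t)" using t finite_C by simp
  finally show "a t = 0" using w_pos[OF t] by simp
next
  fix i s k assume B: "i \<in> B" "s \<in> C" "k \<in> B"
  have "(\<Sum>j\<in>B. of_nat (M i j k) * cnj (lam j s))
      = (\<Sum>j\<in>B. \<Sum>t\<in>C. lam i t * cnj (lam k t) / of_real (w t) * (cnj (lam j s) * lam j t))"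
    using B by (intro sum.cong refl) (simp add: sum_distrib_right sum_distrib_left ac_simps flip: M)
  also have "\<dots> = (\<Sum>t\<in>C. lam i t * cnj (lam k t) / of_real (w t) * (\<Sum>j\<in>B. cnj (lam j s) * lam j t))"
    by (subst sum.swap) (simp add: sum_distrib_left)
  also have "\<dots> = (\<Sum>t\<in>C. if t = s then lam i t * cnj (lam k t) else 0)"
    using B w_nonzero by (intro sum.cong refl) (auto simp: col_orth)
  also have "\<dots> = lam i s * cnj (lam k s)" using B finite_C by simp
  finally show "(\<Sum>j\<in>B. of_nat (M i j k) * cnj (lam j s)) = lam i s * cnj (lam k s)" .
qed (use finite_C card_eq in auto)

end

section \<open>Finite groups with a given eigentable\<close>

locale eigentable_group = eigentable B C lam w e c0 d M + group G
  for B :: "'a set" and C :: "'c set" and lam w e c0 d M and G :: "('g, 'b) monoid_scheme" (structure) +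
  fixes \<phi> :: "'a \<Rightarrow> 'g \<Rightarrow> complex"
  assumes fin_G: "finite (carrier G)"
    and bij: "bij_betw \<phi> B (irr_chars G)"
    and unit: "\<phi> e = (\<lambda>g. if g \<in> carrier G then 1 else 0)"
    and struct: "x \<in> B \<Longrightarrow> y \<in> B \<Longrightarrow> z \<in> B \<Longrightarrow> of_nat (M x y z) = groth_N G (\<phi> x) (\<phi> y) (\<phi> z)"
begin

lemma card_G: "card (carrier G) \<noteq> 0"
  using fin_G by auto

lemma finite_irr: "finite (irr_chars G)"
  using bij finite_B bij_betw_finite by blast

text \<open>No representation theory is used: the value of \<open>M x e z\<close> is the unit axiom
  of the ring, and \<open>struct\<close> reads it as an inner product of characters.\<close>

lemma char_orth:
  assumes "x \<in> B" "z \<in> B"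
  shows "(\<Sum>g\<in>carrier G. \<phi> x g * cnj (\<phi> z g)) = (if x = z then of_nat (card (carrier G)) else 0)"
proof -
  have "M x e z = (if x = z then 1 else 0)" using fusion assms by (simp add: fusion_ring_def)
  hence "groth_N G (\<phi> x) (\<phi> e) (\<phi> z) = (if x = z then 1 else 0)"
    using struct[OF assms(1) e(1) assms(2)] by (simp split: if_splits)
  thus ?thesis using card_G by (simp add: groth_N_def unit split: if_splits)
qed

text \<open>\<open>struct\<close> only gives the inner products of the product with irreducible
  characters. As a class function the product lies in their span, so these inner products determine
  it.\<close>

lemma char_mult:
  assumes x: "x \<in> B" and y: "y \<in> B" and g: "g \<in> carrier G"
  shows "\<phi> x g * \<phi> y g = (\<Sum>z\<in>B. of_nat (M x y z) * \<phi> z g)"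
proof -
  have irr: "\<phi> x \<in> irr_chars G" if "x \<in> B" for x using bij that by (auto simp: bij_betw_def)
  have "(\<lambda>g. \<phi> x g * \<phi> y g) \<in> char_span G"
    by (intro class_function_in_char_span fin_G finite_irr)
      (simp add: irr_chars_class_function[OF irr[OF x]] irr_chars_class_function[OF irr[OF y]])
  then obtain a where a: "\<And>g. g \<in> carrier G \<Longrightarrow> \<phi> x g * \<phi> y g = (\<Sum>\<chi>\<in>irr_chars G. a \<chi> * \<chi> g)"
    by (auto simp: char_span_def)
  have expand: "\<phi> x g * \<phi> y g = (\<Sum>z\<in>B. a (\<phi> z) * \<phi> z g)" if "g \<in> carrier G" for g
    using a[OF that] sum.reindex_bij_betw[OF bij, of "\<lambda>\<chi>. a \<chi> * \<chi> g"] by simp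
  have coeff: "a (\<phi> z) = of_nat (M x y z)" if z: "z \<in> B" for z
  proof -
    have "(\<Sum>g\<in>carrier G. \<phi> x g * \<phi> y g * cnj (\<phi> z g))
        = (\<Sum>g\<in>carrier G. \<Sum>u\<in>B. a (\<phi> u) * (\<phi> u g * cnj (\<phi> z g)))"
      by (intro sum.cong refl) (simp add: expand sum_distrib_right mult.assoc)
    also have "\<dots> = (\<Sum>u\<in>B. a (\<phi> u) * (\<Sum>g\<in>carrier G. \<phi> u g * cnj (\<phi> z g)))"
      by (subst sum.swap) (simp add: sum_distrib_left)
    also have "\<dots> = (\<Sum>u\<in>B. if u = z then a (\<phi> u) * of_nat (card (carrier G)) else 0)"
      using z by (intro sum.cong refl) (simp add: char_orth)
    also have "\<dots> = a (\<phi> z) * of_nat (card (carrier G))" using z finite_B by simp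
    finally show ?thesis using struct[OF x y z] card_G by (simp add: groth_N_def)
  qed
  show ?thesis using expand[OF g] by (simp add: coeff)
qed

definition column :: "'g \<Rightarrow> 'c" where
  "column g = (SOME s. s \<in> C \<and> (\<forall>x\<in>B. \<phi> x g = lam x s))"

text \<open>Evaluating all characters at \<open>g\<close> is a ring homomorphism by
  \<open>char_mult\<close>, hence a column by \<open>hom_eq_column\<close>.\<close>

lemma column:
  assumes g: "g \<in> carrier G"
  shows "column g \<in> C" "x \<in> B \<Longrightarrow> \<phi> x g = lam x (column g)"
proof -
  obtain s where "s \<in> C" "\<And>x. x \<in> B \<Longrightarrow> \<phi> x g = lam x s"
    by (rule hom_eq_column[of "\<lambda>x. \<phi> x g"]) (use g in \<open>simp_all add: unit char_mult\<close>)
  hence "\<exists>s. s \<in> C \<and> (\<forall>x\<in>B. \<phi> x g = lam x s)" by blast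
  from someI_ex[OF this] show "column g \<in> C" "x \<in> B \<Longrightarrow> \<phi> x g = lam x (column g)"
    by (auto simp: column_def)
qed

lemma char_span_column:
  assumes "f \<in> char_span G" "g \<in> carrier G" "h \<in> carrier G" "column g = column h"
  shows "f g = f h"
proof -
  have "\<chi> g = \<chi> h" if "\<chi> \<in> irr_chars G" for \<chi>
  proof -
    have "\<chi> \<in> \<phi> ` B" using that bij_betw_imp_surj_on[OF bij] by simp
    then obtain x where "x \<in> B" "\<chi> = \<phi> x" by auto
    thus ?thesis using assms column(2)[of g x] column(2)[of h x] by simp
  qed
  hence "(\<Sum>\<chi>\<in>irr_chars G. a \<chi> * \<chi> g) = (\<Sum>\<chi>\<in>irr_chars G. a \<chi> * \<chi> h)" for a
    by (intro sum.cong) auto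
  thus ?thesis using assms(1-3) by (auto simp: char_span_def)
qed

lemma conj_count_column:
  assumes "g \<in> carrier G" "h \<in> carrier G" "column g = column h" "k \<in> carrier G"
  shows "conj_count G k g = conj_count G k h"
  using char_span_column[OF conj_count_in_char_span[OF fin_G finite_irr assms(4)] assms(1-3)] by simp

lemma conj_count_nonzero: "g \<in> carrier G \<Longrightarrow> conj_count G g g \<noteq> 0"
proof -
  assume "g \<in> carrier G"
  hence "\<one> \<in> {x \<in> carrier G. g \<otimes> x = x \<otimes> g}" by auto
  thus ?thesis using fin_G by (auto simp: conj_count_def)
qed

text \<open>Columns separate conjugacy classes: \<open>conj_count G h\<close> is a combination of
  characters, so it takes equal values on elements with the same column, and it does not vanish at
  \<open>h\<close>.\<close>

lemma column_eq_iff: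
  assumes g: "g \<in> carrier G" and h: "h \<in> carrier G"
  shows "column g = column h \<longleftrightarrow> conj_count G h g \<noteq> 0"
proof
  assume "column g = column h"
  from conj_count_column[OF g h this h] show "conj_count G h g \<noteq> 0" using conj_count_nonzero[OF h] by simp
next
  assume "conj_count G h g \<noteq> 0"
  hence "{x \<in> carrier G. g \<otimes> x = x \<otimes> h} \<noteq> {}" unfolding conj_count_def by (metis card.empty)
  then obtain x where x: "x \<in> carrier G" "g \<otimes> x = x \<otimes> h" by auto
  hence hx: "h = inv x \<otimes> g \<otimes> x" using g h by (metis inv_solve_left m_assoc m_closed inv_closed)
  show "column g = column h"
  proof (rule col_eqI)
    fix y assume y: "y \<in> B"
    hence "\<phi> y \<in> irr_chars G" using bij by (auto simp: bij_betw_def)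
    from irr_chars_class_function[OF this g x(1)] have "\<phi> y h = \<phi> y g" by (simp add: hx)
    thus "lam y (column g) = lam y (column h)" using column g h y by simp
  qed (use column g h in auto)
qed

lemma same_column_pow:
  assumes g: "g \<in> carrier G" and h: "h \<in> carrier G" and eq: "column g = column h" and pow: "g [^] (n :: nat) = \<one>"
  shows "h [^] n = \<one>"
proof -
  have "conj_count G g h \<noteq> 0" using column_eq_iff[OF h g] eq by simp
  hence "{x \<in> carrier G. h \<otimes> x = x \<otimes> g} \<noteq> {}" unfolding conj_count_def by (metis card.empty)
  then obtain x where x: "x \<in> carrier G" "h \<otimes> x = x \<otimes> g" by auto
  have "h [^] n \<otimes> x = x \<otimes> g [^] n"
  proof (induction n)
    case (Suc n)
    have "h [^] Suc n \<otimes> x = h [^] n \<otimes> (x \<otimes> g)" using g h x by (simp add: m_assoc)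
    also have "\<dots> = x \<otimes> g [^] Suc n" using g h x Suc by (simp flip: m_assoc)
    finally show ?case .
  qed (use x in simp)
  hence "h [^] n \<otimes> x = x" using x pow by simp
  thus ?thesis using x h by simp
qed

text \<open>Orthogonality to the trivial character says that the fibre sizes \<open>n t\<close>,
  weighted by row \<open>x\<close>, sum to |G| for \<open>x = e\<close> and to 0 otherwise. Column
  orthogonality inverts this system.\<close>

lemma card_column:
  assumes s: "s \<in> C"
  shows "real (card {g \<in> carrier G. column g = s}) * w s = real (card (carrier G))"
proof -
  define n where "n t = card {g \<in> carrier G. column g = t}" for t
  have fiber: "(\<Sum>g\<in>carrier G. F (column g)) = (\<Sum>t\<in>C. of_nat (n t) * F t)" for F :: "'c \<Rightarrow> complex"
  proof -
    have "(\<Sum>g\<in>carrier G. F (column g)) = (\<Sum>t\<in>C. \<Sum>g\<in>{g \<in> carrier G. column g = t}. F (column g))"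
      using fin_G finite_C column by (intro sum.group[symmetric]) auto
    thus ?thesis by (simp add: n_def)
  qed
  have orth: "(\<Sum>t\<in>C. of_nat (n t) * lam x t) = (if x = e then of_nat (card (carrier G)) else 0)" if x: "x \<in> B" for x
  proof -
    have "(\<Sum>t\<in>C. of_nat (n t) * lam x t) = (\<Sum>g\<in>carrier G. \<phi> x g * cnj (\<phi> e g))"
      unfolding fiber[symmetric] using x by (intro sum.cong refl) (simp add: column unit)
    thus ?thesis using char_orth[OF x e(1)] by simp
  qed
  have "of_nat (n s) * of_real (w s) = (\<Sum>t\<in>C. if t = s then of_nat (n t) * of_real (w t) else (0 :: complex))"
    using s finite_C by simp
  also have "\<dots> = (\<Sum>t\<in>C. of_nat (n t) * (\<Sum>x\<in>B. cnj (lam x s) * lam x t))"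
    using s by (intro sum.cong refl) (auto simp: col_orth)
  also have "\<dots> = (\<Sum>x\<in>B. cnj (lam x s) * (\<Sum>t\<in>C. of_nat (n t) * lam x t))"
    by (simp only: sum_distrib_left) (subst sum.swap, simp add: ac_simps)
  also have "\<dots> = (\<Sum>x\<in>B. if x = e then of_nat (card (carrier G)) else 0)"
    using s e by (intro sum.cong refl) (simp add: orth)
  also have "\<dots> = of_nat (card (carrier G))" using e finite_B by simp
  finally have "(of_real (real (n s) * w s) :: complex) = of_real (real (card (carrier G)))" by simp
  thus ?thesis by (simp only: n_def of_real_eq_iff)
qed

text \<open>On the elements sharing the column of \<open>g\<close> the count
  \<open>conj_count G h g\<close> is constant, so |G| is fibre size times centralizer order;
  \<open>card_column\<close> supplies the fibre size.\<close>

lemma card_centralizer: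
  assumes g: "g \<in> carrier G"
  shows "real (card {x \<in> carrier G. g \<otimes> x = x \<otimes> g}) = w (column g)"
proof -
  let ?K = "{h \<in> carrier G. column h = column g}"
  have "card (carrier G) = (\<Sum>h\<in>carrier G. conj_count G h g)" using sum_conj_count[OF fin_G g] by simp
  also have "\<dots> = (\<Sum>h\<in>?K. conj_count G h g)"
  proof (intro sum.mono_neutral_right ballI)
    fix h assume "h \<in> carrier G - ?K"
    thus "conj_count G h g = 0" using column_eq_iff[OF g, of h] by (metis (mono_tags, lifting) DiffE mem_Collect_eq)
  qed (use fin_G in auto)
  also have "\<dots> = (\<Sum>h\<in>?K. conj_count G g g)"
  proof (intro sum.cong refl)
    fix h assume "h \<in> ?K"
    hence h: "h \<in> carrier G" "column h = column g" by auto
    have "conj_count G h g = conj_count G g h" using g h by (intro conj_count_commute)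
    also have "\<dots> = conj_count G g g" by (rule conj_count_column) (use g h in auto)
    finally show "conj_count G h g = conj_count G g g" .
  qed
  finally have 1: "real (card (carrier G)) = real (card ?K) * real (conj_count G g g)" by simp
  have 2: "real (card ?K) * w (column g) = real (card (carrier G))" using card_column column g by blast
  have "card ?K \<noteq> 0" using 1 card_G by (intro notI) simp
  hence "real (conj_count G g g) = w (column g)" using 1 2 by simp
  thus ?thesis by (simp add: conj_count_def)
qed

lemma column_one: "column \<one> = c0"
proof (rule positive_column)
  fix x assume x: "x \<in> B"
  hence "\<phi> x \<in> irr_chars G" using bij by (auto simp: bij_betw_def)
  then obtain n \<rho> where n: "n > 0" "\<rho> \<one> = 1\<^sub>m n" and \<chi>: "\<phi> x = (\<lambda>g. if g \<in> carrier G then mat_trace n (\<rho> g) else 0)"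
    by (auto simp: irr_chars_def irreducible_rep_def is_rep_def)
  have "lam x (column \<one>) = of_nat n" using column(2)[OF one_closed x] n by (simp add: \<chi> mat_trace_def)
  thus "lam x (column \<one>) \<in> \<real> \<and> Re (lam x (column \<one>)) > 0" using n by simp
qed (simp add: column)

text \<open>If \<open>g\<close> and \<open>b\<close> commute and have prime orders \<open>p1 \<noteq> p2\<close>, then \<open>g\<close>, \<open>b\<close> and \<open>g b\<close> have different
  orders, so they lie in three different columns of \<open>D\<close>.\<close>

lemma two_primes_contradiction:
  fixes p1 p2 m :: nat
  assumes p: "prime p1" "prime p2" "p1 \<noteq> p2"
    and W: "\<And>s. s \<in> C \<Longrightarrow> w s = real (W s)"
    and Wc0: "p1 dvd W c0"
    and WD: "\<And>s. s \<in> D \<Longrightarrow> p2 dvd W s"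
    and other: "\<And>s. s \<in> C \<Longrightarrow> s \<noteq> c0 \<Longrightarrow> s \<notin> D \<Longrightarrow> \<not> p1 dvd W s \<and> \<not> p2 dvd W s"
    and D: "finite D" "card D \<le> 2"
  shows False
proof -
  define Z where "Z g = {x \<in> carrier G. g \<otimes> x = x \<otimes> g}" for g
  have Z: "card (Z g) = W (column g)" if "g \<in> carrier G" for g
    using card_centralizer[OF that] W column(1)[OF that] by (simp add: Z_def)
  have subZ: "subgroup (Z g) G" if "g \<in> carrier G" for g
    using centralizer_subgroup[OF that] by (simp add: Z_def)
  have finZ: "finite (Z g)" for g using fin_G by (simp add: Z_def)
  \<comment> \<open>A nontrivial element that commutes with one of order \<open>p1\<close> or
    \<open>p2\<close> has a centralizer order divisible by that prime. This leaves \<open>D\<close>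
    and \<open>c0\<close>, and \<open>c0\<close> is the column of the identity alone.\<close>
  have in_D: "column g \<in> D" if g: "g \<in> carrier G" "g \<noteq> \<one>" and x: "x \<in> Z g" "x \<noteq> \<one>" "x [^] p = \<one>"
    and p: "p = p1 \<or> p = p2" for g x p
  proof (rule ccontr)
    assume nD: "column g \<notin> D"
    have "p dvd card (Z g)"
      using subZ[OF g(1)] finZ x p assms(1,2) by (intro prime_dvd_card_subgroup[of _ x]) auto
    hence "p dvd W (column g)" using Z[OF g(1)] by simp
    hence c: "column g = c0" using other[OF column(1)[OF g(1)] _ nD] p by auto
    hence "column \<one> = column g" using column_one by simp
    hence "g [^] (1 :: nat) = \<one>" by (rule same_column_pow[OF one_closed g(1)]) simp
    thus False using g by simp
  qed
  have "p1 dvd card (carrier G)"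
  proof -
    have "Z \<one> = carrier G" unfolding Z_def by auto
    thus ?thesis using Z[OF one_closed] column_one Wc0 by simp
  qed
  then obtain g where g: "g \<in> carrier G" "g \<noteq> \<one>" "g [^] p1 = \<one>"
    using ex_prime_order[OF subgroup_self fin_G p(1)] by blast
  have self: "x \<in> Z x" if "x \<in> carrier G" for x using that by (simp add: Z_def)
  have gD: "column g \<in> D" by (rule in_D[OF g(1,2) self[OF g(1)] g(2,3)]) simp
  have "p2 dvd card (Z g)" using WD[OF gD] Z g by simp
  then obtain b where b: "b \<in> Z g" "b \<noteq> \<one>" "b [^] p2 = \<one>"
    using ex_prime_order[OF subZ finZ p(2)] g by blast
  have bG: "b \<in> carrier G" and comm: "g \<otimes> b = b \<otimes> g" using b by (auto simp: Z_def)
  have bD: "column b \<in> D" by (rule in_D[OF bG b(2) self[OF bG] b(2,3)]) simp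
  have coprime_pow: "x = \<one>" if "x \<in> carrier G" "x [^] p1 = \<one>" "x [^] p2 = \<one>" for x
  proof -
    have "ord x dvd p1" "ord x dvd p2" using that pow_eq_id by auto
    hence "ord x dvd gcd p1 p2" by simp
    hence "ord x = 1" using primes_coprime[OF p] by simp
    thus ?thesis using that ord_eq_1 by blast
  qed
  have pow: "(g \<otimes> b) [^] k = g [^] k \<otimes> b [^] k" for k :: nat
    using pow_mult_distrib[OF comm] g bG by simp
  have gb1: "(g \<otimes> b) [^] p1 \<noteq> \<one>" using pow g b bG coprime_pow[OF bG] by auto
  have gb2: "(g \<otimes> b) [^] p2 \<noteq> \<one>" using pow g b bG coprime_pow[OF g(1,3)] by auto
  have gb: "g \<otimes> b \<in> carrier G" "g \<otimes> b \<noteq> \<one>" using g bG gb1 by auto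
  \<comment> \<open>The product has order \<open>p1 * p2\<close>, so \<open>g\<close> serves as the
    element of prime order in its centralizer.\<close>
  have "g \<in> Z (g \<otimes> b)" using g bG by (simp add: Z_def m_assoc flip: comm)
  note gZ = this
  have gbD: "column (g \<otimes> b) \<in> D" by (rule in_D[OF gb gZ g(2,3)]) simp
  have "column (g \<otimes> b) \<noteq> column g" using same_column_pow[OF g(1) gb(1) _ g(3)] gb1 by auto
  moreover have "column (g \<otimes> b) \<noteq> column b" using same_column_pow[OF bG gb(1) _ b(3)] gb2 by auto
  moreover have "column g \<noteq> column b"
    using same_column_pow[OF g(1) bG _ g(3)] coprime_pow[OF bG _ b(3)] b by auto
  ultimately have "card {column g, column b, column (g \<otimes> b)} = 3" by simp
  moreover have "card {column g, column b, column (g \<otimes> b)} \<le> card D"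
    using gD bD gbD D by (intro card_mono) auto
  ultimately show False using D by simp
qed

end

section \<open>Sums of cosines\<close>

definition two_cos :: "nat \<Rightarrow> int \<Rightarrow> real" where
  "two_cos n m = 2 * cos (2 * pi * of_int m / of_nat n)"

definition dvd_ind :: "nat \<Rightarrow> int \<Rightarrow> real" where
  "dvd_ind n m = (if int n dvd m then 1 else 0)"

lemma cs_two_cos: "cs n m = of_real (two_cos n (int m))"
proof -
  have "zeta n = cis (2 * pi / n)" by (simp add: zeta_def cis_conv_exp mult_ac)
  hence "cs n m = cis (of_int (int m) * (2 * pi / n)) + cis (of_int (- int m) * (2 * pi / n))"
    by (simp only: cs_def cis_power_int)
  thus ?thesis by (simp add: complex_eq_iff two_cos_def mult_ac)
qed

lemma two_cos_minus [simp]: "two_cos n (- m) = two_cos n m"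
  by (simp add: two_cos_def)

lemma two_cos_0 [simp]: "two_cos n 0 = 2"
  by (simp add: two_cos_def)

lemma two_cos_mult: "two_cos n a * two_cos n b = two_cos n (a + b) + two_cos n (a - b)"
  by (simp add: two_cos_def cos_times_cos add_divide_distrib diff_divide_distrib algebra_simps)

lemma two_cos_reflect:
  assumes "k \<le> n"
  shows "two_cos n (int (n - k) * a) = two_cos n (int k * a)"
proof (cases "n = 0")
  case False
  have "2 * pi * of_int (int (n - k) * a) / n = 2 * pi * of_int a - 2 * pi * of_int (int k * a) / n"
    using False assms by (simp add: field_simps of_nat_diff)
  hence "cos (2 * pi * of_int (int (n - k) * a) / n) = cos (2 * pi * of_int a - 2 * pi * of_int (int k * a) / n)"
    by (simp only:)
  also have "\<dots> = cos (2 * pi * of_int (int k * a) / n)"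
    by (simp only: cos_diff cos_int_2pin sin_int_2pin)
  finally show ?thesis by (simp add: two_cos_def)
qed (use assms in simp)

lemma cos_eq_1_iff_dvd:
  assumes "n > 0"
  shows "cos (2 * pi * of_int m / of_nat n) = 1 \<longleftrightarrow> int n dvd m"
proof -
  have "cos (2 * pi * of_int m / of_nat n) = 1 \<longleftrightarrow> (\<exists>k :: int. 2 * pi * of_int m / of_nat n = of_int k * 2 * pi)"
    by (rule cos_one_2pi_int)
  also have "\<dots> \<longleftrightarrow> (\<exists>k :: int. (of_int m :: real) = of_int (k * int n))"
    using assms by (intro ex_cong1) (auto simp: field_simps)
  also have "\<dots> \<longleftrightarrow> int n dvd m" unfolding of_int_eq_iff by (auto simp: dvd_def mult.commute)
  finally show ?thesis .
qed

text \<open>Twice the real part of a geometric sum of powers of an n-th root of unity.\<close>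

lemma sum_two_cos:
  assumes n: "n > 0"
  shows "(\<Sum>k<n. two_cos n (int k * a)) = 2 * n * dvd_ind n a"
proof -
  define z where "z = cis (2 * pi * of_int a / n)"
  have zk: "Re (z ^ k) = two_cos n (int k * a) / 2" for k
    by (simp add: z_def DeMoivre two_cos_def mult_ac)
  have "z ^ n = cis (2 * pi * of_int a)" using n by (simp add: z_def DeMoivre)
  hence zn: "z ^ n = 1" by (simp add: complex_eq_iff)
  have "(\<Sum>k<n. z ^ k) = of_real (n * dvd_ind n a)"
  proof (cases "int n dvd a")
    case True
    hence "cos (2 * pi * of_int a / n) = 1" using cos_eq_1_iff_dvd[OF n] by simp
    moreover from this have "sin (2 * pi * of_int a / n) = 0" by (rule cos_one_sin_zero)
    ultimately have "z = 1" by (simp add: z_def complex_eq_iff)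
    thus ?thesis using True by (simp add: dvd_ind_def)
  next
    case False
    hence "z \<noteq> 1" using cos_eq_1_iff_dvd[OF n] by (auto simp: z_def complex_eq_iff)
    thus ?thesis using zn False by (simp add: geometric_sum dvd_ind_def)
  qed
  hence "Re (\<Sum>k<n. z ^ k) = n * dvd_ind n a" by simp
  thus ?thesis by (simp add: Re_sum zk flip: sum_divide_distrib)
qed

text \<open>The index k = 0 belongs to no torus column, so its term 2 is removed; the products of
  two and three factors lose 4 and 8 in the same way.\<close>

lemma sum_two_cos_1:
  assumes n: "n > 0"
  shows "(\<Sum>k=1..<n. two_cos n (int k * a)) = 2 * n * dvd_ind n a - 2"
proof -
  have "(\<Sum>k<n. two_cos n (int k * a)) = 2 + (\<Sum>k=1..<n. two_cos n (int k * a))"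
    using n by (simp add: lessThan_atLeast0 sum.atLeast_Suc_lessThan)
  thus ?thesis using sum_two_cos[OF n, of a] by simp
qed

lemma sum_two_cos_2:
  assumes n: "n > 0"
  shows "(\<Sum>k=1..<n. two_cos n (int k * a) * two_cos n (int k * b))
    = 2 * n * (dvd_ind n (a + b) + dvd_ind n (a - b)) - 4"
proof -
  have "two_cos n (int k * a) * two_cos n (int k * b) = two_cos n (int k * (a + b)) + two_cos n (int k * (a - b))" for k
    by (simp add: two_cos_mult algebra_simps)
  thus ?thesis by (simp only: sum.distrib sum_two_cos_1[OF n]) (simp add: algebra_simps)
qed

lemma sum_two_cos_3:
  assumes n: "n > 0"
  shows "(\<Sum>k=1..<n. two_cos n (int k * a) * two_cos n (int k * b) * two_cos n (int k * c))
    = 2 * n * (dvd_ind n (a + b + c) + dvd_ind n (a + b - c) + dvd_ind n (a - b + c) + dvd_ind n (a - b - c)) - 8"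
proof -
  have "two_cos n (int k * a) * two_cos n (int k * b) * two_cos n (int k * c)
      = two_cos n (int k * (a + b)) * two_cos n (int k * c) + two_cos n (int k * (a - b)) * two_cos n (int k * c)" for k
    unfolding two_cos_mult[of n "int k * a" "int k * b"] by (simp add: algebra_simps)
  thus ?thesis by (simp only: sum.distrib sum_two_cos_2[OF n]) (simp add: algebra_simps)
qed

text \<open>The table entries depend on k only up to sign modulo n, so a sum over all nonzero
  residues counts each torus column twice, except that the residue n / 2 is its own mirror
  image.\<close>

lemma sum_reflect:
  fixes f :: "nat \<Rightarrow> 'a :: comm_ring_1"
  assumes "\<And>k. 0 < k \<Longrightarrow> k < n \<Longrightarrow> f (n - k) = f k"
  shows "(\<Sum>k=1..<n. f k) = 2 * (\<Sum>k=1..(n - 1) div 2. f k) + (if even n \<and> n > 0 then f (n div 2) else 0)"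
proof -
  define h where "h = (n - 1) div 2"
  have upper: "(\<Sum>k=n-h..<n. f k) = (\<Sum>k=1..h. f k)"
    by (rule sum.reindex_bij_witness[of _ "\<lambda>k. n - k" "\<lambda>k. n - k"]) (auto simp: h_def assms)
  have split: "{1..<n} = {1..h} \<union> {n - h..<n} \<union> (if even n \<and> n > 0 then {n div 2} else {})"
  proof (rule Set.set_eqI)
    fix x
    have "2 * h + (if even n \<and> n > 0 then 2 else 1) = n \<or> n = 0 \<and> h = 0"
      by (auto simp: h_def elim!: evenE oddE)
    hence "1 \<le> x \<and> x < n \<longleftrightarrow> (1 \<le> x \<and> x \<le> h) \<or> (n - h \<le> x \<and> x < n) \<or> (even n \<and> n > 0 \<and> x = n div 2)"
      by (auto split: if_splits)
    thus "x \<in> {1..<n} \<longleftrightarrow> x \<in> {1..h} \<union> {n - h..<n} \<union> (if even n \<and> n > 0 then {n div 2} else {})" by auto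
  qed
  have "(\<Sum>k=1..<n. f k) = (\<Sum>k\<in>{1..h} \<union> {n - h..<n}. f k) + (if even n \<and> n > 0 then f (n div 2) else 0)"
    unfolding split by (subst sum.union_disjoint) (auto simp: h_def elim!: evenE)
  also have "(\<Sum>k\<in>{1..h} \<union> {n - h..<n}. f k) = (\<Sum>k=1..h. f k) + (\<Sum>k=n-h..<n. f k)"
    by (intro sum.union_disjoint) (auto simp: h_def)
  finally show ?thesis using upper by (simp add: h_def)
qed

section \<open>Fusion coefficients of the table\<close>

text \<open>\<open>nA\<close> and \<open>nB\<close> are the orders of the split and the nonsplit torus. For odd \<open>q\<close> the exponents \<open>2 * k * c\<close>
  modulo \<open>q - 1\<close> and \<open>q + 1\<close> become \<open>k * c\<close> modulo \<open>nA\<close> and \<open>nB\<close>, and the column \<open>CE\<close> is the missing middle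
  column \<open>k = nB / 2\<close> or \<open>k = nA / 2\<close> with half the weight.\<close>

definition ee :: "nat \<Rightarrow> nat" where "ee q = (if even q then 1 else 2)"
definition nA :: "nat \<Rightarrow> nat" where "nA q = (q - 1) div ee q"
definition nB :: "nat \<Rightarrow> nat" where "nB q = (q + 1) div ee q"

text \<open>For a prime power q these are the centralizer orders in PSL(2,q). The factor 2 at
  \<open>CE\<close> reflects that the centralizer of an involution is a torus extended by an element
  inverting it.\<close>

definition weight :: "nat \<Rightarrow> col \<Rightarrow> real" where
  "weight q s = (case s of C0 \<Rightarrow> real q * ((real q - 1) * (real q + 1)) / real (ee q) | C1 \<Rightarrow> real q | CD _ \<Rightarrow> real q
    | CA _ \<Rightarrow> real (nA q) | CB _ \<Rightarrow> real (nB q) | CE \<Rightarrow> 2 * real (if q mod 4 = 3 then nB q else nA q))"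

text \<open>All unipotent columns share the value \<open>v\<close>; what distinguishes two of them
  is left to \<open>Df\<close>.\<close>

definition generic_fun :: "nat \<Rightarrow> real \<Rightarrow> real \<Rightarrow> (nat \<Rightarrow> real) \<Rightarrow> (nat \<Rightarrow> real) \<Rightarrow> col \<Rightarrow> real" where
  "generic_fun q u v f g s = (case s of C0 \<Rightarrow> u | C1 \<Rightarrow> v | CD _ \<Rightarrow> v | CA k \<Rightarrow> f k | CB k \<Rightarrow> g k
    | CE \<Rightarrow> if q mod 4 = 3 then g (nB q div 2) else f (nA q div 2))"

lemma generic_fun_mult: "generic_fun q u v f g s * generic_fun q u' v' f' g' s = generic_fun q (u * u') (v * v') (\<lambda>k. f k * f' k) (\<lambda>k. g k * g' k) s"
  by (auto simp: generic_fun_def split: col.splits)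

definition unipotent_cols :: "nat \<Rightarrow> col set" where "unipotent_cols q = (if even q then {C1} else {CD 1, CD 2})"

locale psl_table =
  fixes q :: nat
  assumes q2: "q \<ge> 2"
begin

text \<open>Each parametrization starts at the least admissible \<open>q\<close> of its class,
  namely 2, 5 and 3, so that \<open>nA\<close> and \<open>nB\<close> become free of subtraction and
  division.\<close>

lemma q_cases:
  obtains (even) i where "q = 2 * i + 2" "even q" "q mod 4 \<noteq> 3" "ee q = 1" "nA q = 2 * i + 1" "nB q = 2 * i + 3"
  | (one) i where "q = 4 * i + 5" "odd q" "q mod 4 \<noteq> 3" "ee q = 2" "nA q = 2 * i + 2" "nB q = 2 * i + 3"
  | (three) i where "q = 4 * i + 3" "odd q" "q mod 4 = 3" "ee q = 2" "nA q = 2 * i + 1" "nB q = 2 * i + 2"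
proof -
  define j where "j = q div 4"
  have j: "q = 4 * j + q mod 4" by (simp add: j_def)
  consider "q mod 4 = 0" | "q mod 4 = 1" | "q mod 4 = 2" | "q mod 4 = 3" by linarith
  thus thesis
  proof cases
    case 1
    hence "q = 4 * j" "j \<ge> 1" using q2 j by linarith+
    thus thesis using 1 by (intro even[of "2 * j - 1"]) (auto simp: nA_def nB_def ee_def)
  next
    case 2
    hence q: "q = 4 * j + 1" "j \<ge> 1" using q2 j by linarith+
    thus thesis using 2 by (intro one[of "j - 1"]) (auto simp: nA_def nB_def ee_def)
  next
    case 3
    hence q: "q = 4 * j + 2" using j by linarith
    thus thesis using 3 by (intro even[of "2 * j"]) (auto simp: nA_def nB_def ee_def)
  next
    case 4
    hence q: "q = 4 * j + 3" using j by linarith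
    thus thesis using 4 by (intro three[of j]) (auto simp: nA_def nB_def ee_def)
  qed
qed

lemma nA_real: "real (nA q) = (real q - 1) / real (ee q)"
  by (cases rule: q_cases) simp_all

lemma nB_real: "real (nB q) = (real q + 1) / real (ee q)"
  by (cases rule: q_cases) simp_all

lemma torus_pos: "nA q > 0" "nB q > 1" "ee q > 0"
  by (cases rule: q_cases, simp_all)+

lemma torus_parity:
  "even (nA q) \<longleftrightarrow> odd q \<and> q mod 4 \<noteq> 3" "even (nB q) \<longleftrightarrow> odd q \<and> q mod 4 = 3"
  by (cases rule: q_cases, simp_all)+

text \<open>The three cases have one shape: the torus columns run over the nonzero residues modulo
  the torus order up to sign, without the middle one.\<close>

lemma cols_eq: "cols q = {C0} \<union> unipotent_cols q \<union> CA ` {1..(nA q - 1) div 2} \<union> CB ` {1..(nB q - 1) div 2} \<union> (if even q then {} else {CE})"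
  by (cases rule: q_cases) (auto simp: cols_def unipotent_cols_def)

lemma rows_eq: "rows q = {X1, Xq} \<union> Xp ` {1..(nA q - 1) div 2} \<union> Xm ` {1..(nB q - 1) div 2} \<union> (if even q then {} else Xh ` {1, 2})"
  by (cases rule: q_cases) (auto simp: rows_def)

lemma card_unipotent_cols: "finite (unipotent_cols q)" "card (unipotent_cols q) = ee q" by (auto simp: unipotent_cols_def ee_def)

lemma finite_cols: "finite (cols q)" by (simp add: cols_eq card_unipotent_cols)

lemma finite_rows: "finite (rows q)" by (simp add: rows_eq)

lemma sum_cols:
  fixes F :: "col \<Rightarrow> 'a :: comm_monoid_add"
  shows "(\<Sum>s\<in>cols q. F s) = F C0 + (\<Sum>s\<in>unipotent_cols q. F s) + (\<Sum>k=1..(nA q - 1) div 2. F (CA k))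
    + (\<Sum>k=1..(nB q - 1) div 2. F (CB k)) + (if even q then 0 else F CE)"
proof -
  have "(\<Sum>s\<in>cols q. F s) = (\<Sum>s\<in>{C0} \<union> unipotent_cols q \<union> CA ` {1..(nA q - 1) div 2} \<union> CB ` {1..(nB q - 1) div 2}. F s) + (if even q then 0 else F CE)"
    unfolding cols_eq by (subst sum.union_disjoint) (auto simp: card_unipotent_cols(1), auto simp: unipotent_cols_def split: if_splits)
  also have "(\<Sum>s\<in>{C0} \<union> unipotent_cols q \<union> CA ` {1..(nA q - 1) div 2} \<union> CB ` {1..(nB q - 1) div 2}. F s)
    = (\<Sum>s\<in>{C0} \<union> unipotent_cols q \<union> CA ` {1..(nA q - 1) div 2}. F s) + (\<Sum>s\<in>CB ` {1..(nB q - 1) div 2}. F s)"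
    by (subst sum.union_disjoint) (auto simp: card_unipotent_cols(1), auto simp: unipotent_cols_def split: if_splits)
  also have "(\<Sum>s\<in>{C0} \<union> unipotent_cols q \<union> CA ` {1..(nA q - 1) div 2}. F s)
    = (\<Sum>s\<in>{C0} \<union> unipotent_cols q. F s) + (\<Sum>s\<in>CA ` {1..(nA q - 1) div 2}. F s)"
    by (subst sum.union_disjoint) (auto simp: card_unipotent_cols(1), auto simp: unipotent_cols_def split: if_splits)
  also have "(\<Sum>s\<in>{C0} \<union> unipotent_cols q. F s) = F C0 + (\<Sum>s\<in>unipotent_cols q. F s)"
    by (subst sum.union_disjoint) (auto simp: card_unipotent_cols(1), auto simp: unipotent_cols_def split: if_splits)
  finally show ?thesis by (simp add: sum.reindex inj_on_def)
qed

text \<open>For odd \<open>q\<close> the two rows \<open>Xh\<close> are matched by the second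
  unipotent column and \<open>CE\<close>.\<close>

lemma card_cols: "card (cols q) = card (rows q)"
proof -
  have "card (rows q) = card ({X1, Xq} \<union> Xp ` {1..(nA q - 1) div 2} \<union> Xm ` {1..(nB q - 1) div 2}) + (if even q then 0 else 2)"
    unfolding rows_eq by (subst card_Un_disjoint) auto
  also have "card ({X1, Xq} \<union> Xp ` {1..(nA q - 1) div 2} \<union> Xm ` {1..(nB q - 1) div 2})
    = card ({X1, Xq} \<union> Xp ` {1..(nA q - 1) div 2}) + (nB q - 1) div 2"
    by (subst card_Un_disjoint) (auto simp: card_image inj_on_def)
  also have "card ({X1, Xq} \<union> Xp ` {1..(nA q - 1) div 2}) = 2 + (nA q - 1) div 2"
    by (subst card_Un_disjoint) (auto simp: card_image inj_on_def)
  finally have rows: "card (rows q) = 2 + (nA q - 1) div 2 + (nB q - 1) div 2 + (if even q then 0 else 2)" .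
  have "card (cols q) = (\<Sum>s\<in>cols q. 1)" by simp
  also have "\<dots> = 1 + ee q + (nA q - 1) div 2 + (nB q - 1) div 2 + (if even q then 0 else 1)"
    unfolding sum_cols by (simp add: card_unipotent_cols)
  finally show ?thesis using rows by (simp add: ee_def)
qed

text \<open>The columns of a torus, together with the middle column at half weight, make up half of the sum
  over all nonzero residues.\<close>

lemma sum_generic_fun:
  assumes f: "\<And>k. 0 < k \<Longrightarrow> k < nA q \<Longrightarrow> f (nA q - k) = f k"
    and g: "\<And>k. 0 < k \<Longrightarrow> k < nB q \<Longrightarrow> g (nB q - k) = g k"
  shows "(\<Sum>s\<in>cols q. generic_fun q u v f g s / weight q s) = u * real (ee q) / (real q * ((real q - 1) * (real q + 1)))
    + real (ee q) * v / real q + (\<Sum>k=1..<nA q. f k) / (2 * real (nA q)) + (\<Sum>k=1..<nB q. g k) / (2 * real (nB q))"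
proof -
  have D: "(\<Sum>s\<in>unipotent_cols q. generic_fun q u v f g s / weight q s) = real (ee q) * v / real q"
    by (auto simp: unipotent_cols_def ee_def generic_fun_def weight_def)
  have A: "(\<Sum>k=1..(nA q - 1) div 2. generic_fun q u v f g (CA k) / weight q (CA k)) = (\<Sum>k=1..(nA q - 1) div 2. f k) / nA q"
    by (simp add: generic_fun_def weight_def sum_divide_distrib)
  have B: "(\<Sum>k=1..(nB q - 1) div 2. generic_fun q u v f g (CB k) / weight q (CB k)) = (\<Sum>k=1..(nB q - 1) div 2. g k) / nB q"
    by (simp add: generic_fun_def weight_def sum_divide_distrib)
  have E: "(if even q then 0 else generic_fun q u v f g CE / weight q CE)
      = (if even (nA q) \<and> nA q > 0 then f (nA q div 2) else 0) / (2 * real (nA q))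
      + (if even (nB q) \<and> nB q > 0 then g (nB q div 2) else 0) / (2 * real (nB q))"
    using torus_pos by (auto simp: torus_parity generic_fun_def weight_def)
  have f': "(\<Sum>k=1..<nA q. f k) = 2 * (\<Sum>k=1..(nA q - 1) div 2. f k) + (if even (nA q) \<and> nA q > 0 then f (nA q div 2) else 0)"
    by (rule sum_reflect) (rule f)
  have g': "(\<Sum>k=1..<nB q. g k) = 2 * (\<Sum>k=1..(nB q - 1) div 2. g k) + (if even (nB q) \<and> nB q > 0 then g (nB q div 2) else 0)"
    by (rule sum_reflect) (rule g)
  show ?thesis
    unfolding sum_cols D A B E f' g' by (simp add: generic_fun_def weight_def add_divide_distrib)
qed

text \<open>No factor is conjugated, which makes the form symmetric in all three arguments; the
  conjugate in the Verlinde sum is absorbed by \<open>dual\<close>.\<close>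

definition tri :: "(col \<Rightarrow> complex) \<Rightarrow> (col \<Rightarrow> complex) \<Rightarrow> (col \<Rightarrow> complex) \<Rightarrow> complex" where
  "tri f g h = (\<Sum>s\<in>cols q. f s * g s * h s / of_real (weight q s))"

lemma tri_comm: "tri f g h = tri g f h" "tri f g h = tri f h g"
  by (simp_all add: tri_def ac_simps)

text \<open>\<open>Pf a\<close> and \<open>Mf a\<close> are defined for all \<open>a\<close>; the degenerate parameters account for the remaining rows:
  \<open>Pf 0 = x\<^bsub>q,1\<^esub> + 1\<close>, \<open>Mf 0 = x\<^bsub>q,1\<^esub> - 1\<close>, and for \<open>a\<close> of order two \<open>Pf a\<close> or \<open>Mf a\<close> is the sum of the two
  rows \<open>Xh 1\<close>, \<open>Xh 2\<close>. In lemma names, \<open>1\<close>, \<open>Q\<close>, \<open>P\<close>, \<open>M\<close>, \<open>H\<close> stand for the five kinds of rows.\<close>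

definition Onef :: "col \<Rightarrow> complex" where "Onef s = of_real (generic_fun q 1 1 (\<lambda>_. 1) (\<lambda>_. 1) s)"
definition Pf :: "int \<Rightarrow> col \<Rightarrow> complex" where
  "Pf a s = of_real (generic_fun q (real q + 1) 1 (\<lambda>k. two_cos (nA q) (int k * a)) (\<lambda>_. 0) s)"
definition Mf :: "int \<Rightarrow> col \<Rightarrow> complex" where
  "Mf a s = of_real (generic_fun q (real q - 1) (- 1) (\<lambda>_. 0) (\<lambda>k. - two_cos (nB q) (int k * a)) s)"

abbreviation "KA \<equiv> dvd_ind (nA q)"
abbreviation "KB \<equiv> dvd_ind (nB q)"

lemma tri_generic_fun:
  assumes "\<And>k. 0 < k \<Longrightarrow> k < nA q \<Longrightarrow> f1 (nA q - k) * f2 (nA q - k) * f3 (nA q - k) = f1 k * f2 k * f3 k"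
    and "\<And>k. 0 < k \<Longrightarrow> k < nB q \<Longrightarrow> g1 (nB q - k) * g2 (nB q - k) * g3 (nB q - k) = g1 k * g2 k * g3 k"
  shows "tri (\<lambda>s. of_real (generic_fun q u1 v1 f1 g1 s)) (\<lambda>s. of_real (generic_fun q u2 v2 f2 g2 s)) (\<lambda>s. of_real (generic_fun q u3 v3 f3 g3 s))
    = of_real (u1 * u2 * u3 * real (ee q) / (real q * ((real q - 1) * (real q + 1)))
    + real (ee q) * (v1 * v2 * v3) / real q + (\<Sum>k=1..<nA q. f1 k * f2 k * f3 k) / (2 * real (nA q))
    + (\<Sum>k=1..<nB q. g1 k * g2 k * g3 k) / (2 * real (nB q)))"
  unfolding tri_def of_real_mult[symmetric] of_real_divide[symmetric] of_real_sum[symmetric] generic_fun_mult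
  by (rule arg_cong[where f = of_real], rule sum_generic_fun) (use assms in auto)

lemma two_cos_torus_reflect:
  "k < nA q \<Longrightarrow> two_cos (nA q) ((int (nA q) - int k) * a) = two_cos (nA q) (int k * a)"
  "k < nB q \<Longrightarrow> two_cos (nB q) ((int (nB q) - int k) * a) = two_cos (nB q) (int k * a)"
  using two_cos_reflect[of k "nA q" a] two_cos_reflect[of k "nB q" a] by (simp_all add: of_nat_diff)

lemma q_nonzero: "real q \<noteq> 0" "real q - 1 \<noteq> 0" "real q + 1 \<noteq> 0" "real (ee q) \<noteq> 0"
  using q2 by (auto simp: ee_def)

section \<open>Triple products of \<open>Onef\<close>, \<open>Pf\<close> and
  \<open>Mf\<close>\<close>

lemmas tri_unfold = Onef_def[abs_def] Pf_def[abs_def] Mf_def[abs_def]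

lemma tri_111: "tri Onef Onef Onef = of_real (1)"
proof -
  have SA: "(\<Sum>k=1..<nA q. 1 * 1 * 1) = (real (nA q) - 1 :: real)"
    using torus_pos by (simp add: sum_two_cos_1 sum_two_cos_2 sum_two_cos_3 of_nat_diff Suc_leI flip: One_nat_def)
  have SB: "(\<Sum>k=1..<nB q. 1 * 1 * 1) = (real (nB q) - 1 :: real)"
    using torus_pos by (simp add: sum_two_cos_1 sum_two_cos_2 sum_two_cos_3 of_nat_diff Suc_leI sum_negf flip: One_nat_def)
  have "tri Onef Onef Onef = of_real (1 * 1 * 1 * real (ee q) / (real q * ((real q - 1) * (real q + 1)))
    + real (ee q) * (1 * 1 * 1) / real q + (\<Sum>k=1..<nA q. 1 * 1 * 1) / (2 * real (nA q))
    + (\<Sum>k=1..<nB q. 1 * 1 * 1) / (2 * real (nB q)))"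
    unfolding tri_unfold by (rule tri_generic_fun) (simp_all add: two_cos_torus_reflect)
  also have "\<dots> = of_real (1)"
    unfolding SA SB nA_real nB_real of_real_eq_iff using q_nonzero by (simp add: divide_simps; simp add: algebra_simps)
  finally show ?thesis .
qed

lemma tri_11P: "tri Onef Onef (Pf a) = of_real (KA a)"
proof -
  have SA: "(\<Sum>k=1..<nA q. 1 * 1 * two_cos (nA q) (int k * a)) = (2 * real (nA q) * KA a - 2 :: real)"
    using torus_pos by (simp add: sum_two_cos_1 sum_two_cos_2 sum_two_cos_3 of_nat_diff Suc_leI flip: One_nat_def)
  have SB: "(\<Sum>k=1..<nB q. 1 * 1 * 0) = (0 :: real)"
    using torus_pos by (simp add: sum_two_cos_1 sum_two_cos_2 sum_two_cos_3 of_nat_diff Suc_leI sum_negf flip: One_nat_def)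
  have "tri Onef Onef (Pf a) = of_real (1 * 1 * (real q + 1) * real (ee q) / (real q * ((real q - 1) * (real q + 1)))
    + real (ee q) * (1 * 1 * 1) / real q + (\<Sum>k=1..<nA q. 1 * 1 * two_cos (nA q) (int k * a)) / (2 * real (nA q))
    + (\<Sum>k=1..<nB q. 1 * 1 * 0) / (2 * real (nB q)))"
    unfolding tri_unfold by (rule tri_generic_fun) (simp_all add: two_cos_torus_reflect)
  also have "\<dots> = of_real (KA a)"
    unfolding SA SB nA_real nB_real of_real_eq_iff using q_nonzero by (simp add: divide_simps; simp add: algebra_simps)
  finally show ?thesis .
qed

lemma tri_11M: "tri Onef Onef (Mf a) = of_real (- KB a)"
proof -
  have SA: "(\<Sum>k=1..<nA q. 1 * 1 * 0) = (0 :: real)"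
    using torus_pos by (simp add: sum_two_cos_1 sum_two_cos_2 sum_two_cos_3 of_nat_diff Suc_leI flip: One_nat_def)
  have SB: "(\<Sum>k=1..<nB q. 1 * 1 * (- two_cos (nB q) (int k * a))) = (- (2 * real (nB q) * KB a - 2) :: real)"
    using torus_pos by (simp add: sum_two_cos_1 sum_two_cos_2 sum_two_cos_3 of_nat_diff Suc_leI sum_negf flip: One_nat_def)
  have "tri Onef Onef (Mf a) = of_real (1 * 1 * (real q - 1) * real (ee q) / (real q * ((real q - 1) * (real q + 1)))
    + real (ee q) * (1 * 1 * (- 1)) / real q + (\<Sum>k=1..<nA q. 1 * 1 * 0) / (2 * real (nA q))
    + (\<Sum>k=1..<nB q. 1 * 1 * (- two_cos (nB q) (int k * a))) / (2 * real (nB q)))"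
    unfolding tri_unfold by (rule tri_generic_fun) (simp_all add: two_cos_torus_reflect)
  also have "\<dots> = of_real (- KB a)"
    unfolding SA SB nA_real nB_real of_real_eq_iff using q_nonzero by (simp add: divide_simps; simp add: algebra_simps)
  finally show ?thesis .
qed

lemma tri_1PP: "tri Onef (Pf a) (Pf b) = of_real (KA (a + b) + KA (a - b))"
proof -
  have SA: "(\<Sum>k=1..<nA q. 1 * two_cos (nA q) (int k * a) * two_cos (nA q) (int k * b)) = (2 * real (nA q) * (KA (a + b) + KA (a - b)) - 4 :: real)"
    using torus_pos by (simp add: sum_two_cos_1 sum_two_cos_2 sum_two_cos_3 of_nat_diff Suc_leI flip: One_nat_def)
  have SB: "(\<Sum>k=1..<nB q. 1 * 0 * 0) = (0 :: real)"
    using torus_pos by (simp add: sum_two_cos_1 sum_two_cos_2 sum_two_cos_3 of_nat_diff Suc_leI sum_negf flip: One_nat_def)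
  have "tri Onef (Pf a) (Pf b) = of_real (1 * (real q + 1) * (real q + 1) * real (ee q) / (real q * ((real q - 1) * (real q + 1)))
    + real (ee q) * (1 * 1 * 1) / real q + (\<Sum>k=1..<nA q. 1 * two_cos (nA q) (int k * a) * two_cos (nA q) (int k * b)) / (2 * real (nA q))
    + (\<Sum>k=1..<nB q. 1 * 0 * 0) / (2 * real (nB q)))"
    unfolding tri_unfold by (rule tri_generic_fun) (simp_all add: two_cos_torus_reflect)
  also have "\<dots> = of_real (KA (a + b) + KA (a - b))"
    unfolding SA SB nA_real nB_real of_real_eq_iff using q_nonzero by (simp add: divide_simps; simp add: algebra_simps)
  finally show ?thesis .
qed

lemma tri_1PM: "tri Onef (Pf a) (Mf b) = of_real (0)"
proof -
  have SA: "(\<Sum>k=1..<nA q. 1 * two_cos (nA q) (int k * a) * 0) = (0 :: real)"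
    using torus_pos by (simp add: sum_two_cos_1 sum_two_cos_2 sum_two_cos_3 of_nat_diff Suc_leI flip: One_nat_def)
  have SB: "(\<Sum>k=1..<nB q. 1 * 0 * (- two_cos (nB q) (int k * b))) = (0 :: real)"
    using torus_pos by (simp add: sum_two_cos_1 sum_two_cos_2 sum_two_cos_3 of_nat_diff Suc_leI sum_negf flip: One_nat_def)
  have "tri Onef (Pf a) (Mf b) = of_real (1 * (real q + 1) * (real q - 1) * real (ee q) / (real q * ((real q - 1) * (real q + 1)))
    + real (ee q) * (1 * 1 * (- 1)) / real q + (\<Sum>k=1..<nA q. 1 * two_cos (nA q) (int k * a) * 0) / (2 * real (nA q))
    + (\<Sum>k=1..<nB q. 1 * 0 * (- two_cos (nB q) (int k * b))) / (2 * real (nB q)))"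
    unfolding tri_unfold by (rule tri_generic_fun) (simp_all add: two_cos_torus_reflect)
  also have "\<dots> = of_real (0)"
    unfolding SA SB nA_real nB_real of_real_eq_iff using q_nonzero by (simp add: divide_simps; simp add: algebra_simps)
  finally show ?thesis .
qed

lemma tri_1MM: "tri Onef (Mf a) (Mf b) = of_real (KB (a + b) + KB (a - b))"
proof -
  have SA: "(\<Sum>k=1..<nA q. 1 * 0 * 0) = (0 :: real)"
    using torus_pos by (simp add: sum_two_cos_1 sum_two_cos_2 sum_two_cos_3 of_nat_diff Suc_leI flip: One_nat_def)
  have SB: "(\<Sum>k=1..<nB q. 1 * (- two_cos (nB q) (int k * a)) * (- two_cos (nB q) (int k * b))) = (2 * real (nB q) * (KB (a + b) + KB (a - b)) - 4 :: real)"
    using torus_pos by (simp add: sum_two_cos_1 sum_two_cos_2 sum_two_cos_3 of_nat_diff Suc_leI sum_negf flip: One_nat_def)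
  have "tri Onef (Mf a) (Mf b) = of_real (1 * (real q - 1) * (real q - 1) * real (ee q) / (real q * ((real q - 1) * (real q + 1)))
    + real (ee q) * (1 * (- 1) * (- 1)) / real q + (\<Sum>k=1..<nA q. 1 * 0 * 0) / (2 * real (nA q))
    + (\<Sum>k=1..<nB q. 1 * (- two_cos (nB q) (int k * a)) * (- two_cos (nB q) (int k * b))) / (2 * real (nB q)))"
    unfolding tri_unfold by (rule tri_generic_fun) (simp_all add: two_cos_torus_reflect)
  also have "\<dots> = of_real (KB (a + b) + KB (a - b))"
    unfolding SA SB nA_real nB_real of_real_eq_iff using q_nonzero by (simp add: divide_simps; simp add: algebra_simps)
  finally show ?thesis .
qed

text \<open>Origin of the constant: in units of e / (q (q - 1)) the dimension column, the unipotent
  columns and the missing index k = 0 contribute (q + 1)^2, q - 1 and - 4 q, which add up to q (q -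
  1).\<close>

lemma tri_PPP: "tri (Pf a) (Pf b) (Pf c) = of_real (real (ee q) + KA (a + b + c) + KA (a + b - c) + KA (a - b + c) + KA (a - b - c))"
proof -
  have SA: "(\<Sum>k=1..<nA q. two_cos (nA q) (int k * a) * two_cos (nA q) (int k * b) * two_cos (nA q) (int k * c)) = (2 * real (nA q) * (KA (a + b + c) + KA (a + b - c) + KA (a - b + c) + KA (a - b - c)) - 8 :: real)"
    using torus_pos by (simp add: sum_two_cos_1 sum_two_cos_2 sum_two_cos_3 of_nat_diff Suc_leI flip: One_nat_def)
  have SB: "(\<Sum>k=1..<nB q. 0 * 0 * 0) = (0 :: real)"
    using torus_pos by (simp add: sum_two_cos_1 sum_two_cos_2 sum_two_cos_3 of_nat_diff Suc_leI sum_negf flip: One_nat_def)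
  have "tri (Pf a) (Pf b) (Pf c) = of_real ((real q + 1) * (real q + 1) * (real q + 1) * real (ee q) / (real q * ((real q - 1) * (real q + 1)))
    + real (ee q) * (1 * 1 * 1) / real q + (\<Sum>k=1..<nA q. two_cos (nA q) (int k * a) * two_cos (nA q) (int k * b) * two_cos (nA q) (int k * c)) / (2 * real (nA q))
    + (\<Sum>k=1..<nB q. 0 * 0 * 0) / (2 * real (nB q)))"
    unfolding tri_unfold by (rule tri_generic_fun) (simp_all add: two_cos_torus_reflect)
  also have "\<dots> = of_real (real (ee q) + KA (a + b + c) + KA (a + b - c) + KA (a - b + c) + KA (a - b - c))"
    unfolding SA SB nA_real nB_real of_real_eq_iff using q_nonzero by (simp add: divide_simps; simp add: algebra_simps)
  finally show ?thesis .
qed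

lemma tri_PPM: "tri (Pf a) (Pf b) (Mf c) = of_real (real (ee q))"
proof -
  have SA: "(\<Sum>k=1..<nA q. two_cos (nA q) (int k * a) * two_cos (nA q) (int k * b) * 0) = (0 :: real)"
    using torus_pos by (simp add: sum_two_cos_1 sum_two_cos_2 sum_two_cos_3 of_nat_diff Suc_leI flip: One_nat_def)
  have SB: "(\<Sum>k=1..<nB q. 0 * 0 * (- two_cos (nB q) (int k * c))) = (0 :: real)"
    using torus_pos by (simp add: sum_two_cos_1 sum_two_cos_2 sum_two_cos_3 of_nat_diff Suc_leI sum_negf flip: One_nat_def)
  have "tri (Pf a) (Pf b) (Mf c) = of_real ((real q + 1) * (real q + 1) * (real q - 1) * real (ee q) / (real q * ((real q - 1) * (real q + 1)))
    + real (ee q) * (1 * 1 * (- 1)) / real q + (\<Sum>k=1..<nA q. two_cos (nA q) (int k * a) * two_cos (nA q) (int k * b) * 0) / (2 * real (nA q))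
    + (\<Sum>k=1..<nB q. 0 * 0 * (- two_cos (nB q) (int k * c))) / (2 * real (nB q)))"
    unfolding tri_unfold by (rule tri_generic_fun) (simp_all add: two_cos_torus_reflect)
  also have "\<dots> = of_real (real (ee q))"
    unfolding SA SB nA_real nB_real of_real_eq_iff using q_nonzero by (simp add: divide_simps; simp add: algebra_simps)
  finally show ?thesis .
qed

lemma tri_PMM: "tri (Pf a) (Mf b) (Mf c) = of_real (real (ee q))"
proof -
  have SA: "(\<Sum>k=1..<nA q. two_cos (nA q) (int k * a) * 0 * 0) = (0 :: real)"
    using torus_pos by (simp add: sum_two_cos_1 sum_two_cos_2 sum_two_cos_3 of_nat_diff Suc_leI flip: One_nat_def)
  have SB: "(\<Sum>k=1..<nB q. 0 * (- two_cos (nB q) (int k * b)) * (- two_cos (nB q) (int k * c))) = (0 :: real)"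
    using torus_pos by (simp add: sum_two_cos_1 sum_two_cos_2 sum_two_cos_3 of_nat_diff Suc_leI sum_negf flip: One_nat_def)
  have "tri (Pf a) (Mf b) (Mf c) = of_real ((real q + 1) * (real q - 1) * (real q - 1) * real (ee q) / (real q * ((real q - 1) * (real q + 1)))
    + real (ee q) * (1 * (- 1) * (- 1)) / real q + (\<Sum>k=1..<nA q. two_cos (nA q) (int k * a) * 0 * 0) / (2 * real (nA q))
    + (\<Sum>k=1..<nB q. 0 * (- two_cos (nB q) (int k * b)) * (- two_cos (nB q) (int k * c))) / (2 * real (nB q)))"
    unfolding tri_unfold by (rule tri_generic_fun) (simp_all add: two_cos_torus_reflect)
  also have "\<dots> = of_real (real (ee q))"
    unfolding SA SB nA_real nB_real of_real_eq_iff using q_nonzero by (simp add: divide_simps; simp add: algebra_simps)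
  finally show ?thesis .
qed

text \<open>The three minus signs in \<open>Mf\<close> leave one, so the congruences are subtracted
  from \<open>ee q\<close> and nonnegativity depends on \<open>dvd_ind_triple\<close>.\<close>

lemma tri_MMM: "tri (Mf a) (Mf b) (Mf c) = of_real (real (ee q) - (KB (a + b + c) + KB (a + b - c) + KB (a - b + c) + KB (a - b - c)))"
proof -
  have SA: "(\<Sum>k=1..<nA q. 0 * 0 * 0) = (0 :: real)"
    using torus_pos by (simp add: sum_two_cos_1 sum_two_cos_2 sum_two_cos_3 of_nat_diff Suc_leI flip: One_nat_def)
  have SB: "(\<Sum>k=1..<nB q. (- two_cos (nB q) (int k * a)) * (- two_cos (nB q) (int k * b)) * (- two_cos (nB q) (int k * c))) = (- (2 * real (nB q) * (KB (a + b + c) + KB (a + b - c) + KB (a - b + c) + KB (a - b - c)) - 8) :: real)"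
    using torus_pos by (simp add: sum_two_cos_1 sum_two_cos_2 sum_two_cos_3 of_nat_diff Suc_leI sum_negf flip: One_nat_def)
  have "tri (Mf a) (Mf b) (Mf c) = of_real ((real q - 1) * (real q - 1) * (real q - 1) * real (ee q) / (real q * ((real q - 1) * (real q + 1)))
    + real (ee q) * ((- 1) * (- 1) * (- 1)) / real q + (\<Sum>k=1..<nA q. 0 * 0 * 0) / (2 * real (nA q))
    + (\<Sum>k=1..<nB q. (- two_cos (nB q) (int k * a)) * (- two_cos (nB q) (int k * b)) * (- two_cos (nB q) (int k * c))) / (2 * real (nB q)))"
    unfolding tri_unfold by (rule tri_generic_fun) (simp_all add: two_cos_torus_reflect)
  also have "\<dots> = of_real (real (ee q) - (KB (a + b + c) + KB (a + b - c) + KB (a - b + c) + KB (a - b - c)))"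
    unfolding SA SB nA_real nB_real of_real_eq_iff using q_nonzero by (simp add: divide_simps; simp add: algebra_simps)
  finally show ?thesis .
qed

end

lemma two_cos_double: "two_cos (2 * n) (2 * m) = two_cos n m"
proof -
  have "2 * pi * of_int (2 * m) / of_nat (2 * n) = 2 * pi * of_int m / (of_nat n :: real)" by simp
  thus ?thesis unfolding two_cos_def by (simp only:)
qed

lemma two_cos_half: "n > 0 \<Longrightarrow> two_cos (2 * n) (int n * int c) = 2 * (- 1) ^ c" "n > 0 \<Longrightarrow> two_cos (2 * n) (int c * int n) = 2 * (- 1) ^ c"
  by (simp_all add: two_cos_def mult.commute)

lemma dvd_ind_0 [simp]: "dvd_ind n 0 = 1"
  by (simp add: dvd_ind_def)

lemma dvd_ind_uminus [simp]: "dvd_ind n (- m) = dvd_ind n m"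
  by (simp add: dvd_ind_def)

lemma dvd_ind_nat: obtains b :: nat where "dvd_ind n m = real b"
  by (rule that[of "if int n dvd m then 1 else 0"]) (simp add: dvd_ind_def)

lemma dvd_ind_small: "m \<noteq> 0 \<Longrightarrow> \<bar>m\<bar> < int n \<Longrightarrow> dvd_ind n m = 0"
  using dvd_imp_le_int[of m "int n"] by (auto simp: dvd_ind_def)

lemma dvd_ind_eq: "\<bar>m\<bar> < int n \<Longrightarrow> dvd_ind n m = (if m = 0 then 1 else 0)"
  by (simp add: dvd_ind_small)

lemma dvd_ind_between: "0 < m \<Longrightarrow> m < 2 * int n \<Longrightarrow> dvd_ind n m = (if m = int n then 1 else 0)"
  using dvd_ind_eq[of "m - int n" n] dvd_add_left_iff[OF dvd_refl, of "int n" "m - int n"]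
  by (auto simp: dvd_ind_def split: if_splits)

lemma dvd_ind_half:
  assumes "0 < a" "2 * a < n"
  shows "dvd_ind n (int a) = 0"
  using assms by (intro dvd_ind_small) auto

lemma dvd_ind_half_add:
  assumes "0 < a" "2 * a < n" "2 * b < n"
  shows "dvd_ind n (int a + int b) = 0" "dvd_ind n (int a - int b) = (if a = b then 1 else 0)"
  using assms by (simp_all add: dvd_ind_small dvd_ind_eq)

text \<open>The fusion coefficients of three discrete series characters: at most one of the four
  congruences can hold, because \<open>2 * a\<close>, \<open>2 * b\<close>, \<open>2 * c\<close> are nonzero modulo \<open>n\<close>.\<close>

lemma dvd_ind_triple:
  assumes "0 < a" "2 * a < n" "0 < b" "2 * b < n" "0 < c" "2 * c < n"
  obtains k :: nat where "k \<le> 1"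
    "dvd_ind n (int a + int b + int c) + dvd_ind n (int a + int b - int c)
     + dvd_ind n (int a - int b + int c) + dvd_ind n (int a - int b - int c) = real k"
proof -
  have "dvd_ind n (int a + int b + int c) = (if a + b + c = n then 1 else 0)"
    using assms by (subst dvd_ind_between) auto
  moreover have "dvd_ind n (int a + int b - int c) = (if a + b = c then 1 else 0)"
    using assms by (subst dvd_ind_eq) auto
  moreover have "dvd_ind n (int a - int b + int c) = (if a + c = b then 1 else 0)"
    using assms by (subst dvd_ind_eq) auto
  moreover have "dvd_ind n (int a - int b - int c) = (if a = b + c then 1 else 0)"
    using assms by (subst dvd_ind_eq) auto
  ultimately show ?thesis
    using assms by (intro that[of "if a + b + c = n \<or> a + b = c \<or> a + c = b \<or> a = b + c then 1 else 0"]) auto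
qed

context psl_table
begin

definition Qf :: "col \<Rightarrow> complex" where "Qf s = Pf 0 s - Onef s"
definition Sf :: "col \<Rightarrow> complex" where
  "Sf = (if q mod 4 = 3 then Mf (int (nB q div 2)) else Pf (int (nA q div 2)))"
text \<open>The difference of the rows \<open>Xh 2\<close> and \<open>Xh 1\<close>. On the unipotent
  columns its square is q or - q, as for a quadratic Gauss sum; the factor \<i> makes the two rows
  conjugate to each other when \<open>q mod 4 = 3\<close>.\<close>

definition Df :: "col \<Rightarrow> complex" where
  "Df s = (case s of CD k \<Rightarrow> (if q mod 4 = 3 then \<i> else 1) * (- 1) ^ k * of_real (sqrt (real q)) | _ \<Rightarrow> 0)"
definition Hf :: "nat \<Rightarrow> col \<Rightarrow> complex" where "Hf c s = (Sf s + (- 1) ^ c * Df s) / 2"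

fun row_fun :: "row \<Rightarrow> col \<Rightarrow> complex" where
  "row_fun X1 = Onef"
| "row_fun Xq = Qf"
| "row_fun (Xp c) = Pf (int c)"
| "row_fun (Xm c) = Mf (int c)"
| "row_fun (Xh c) = Hf c"

text \<open>Only the rows \<open>Xh\<close> for \<open>q mod 4 = 3\<close> are not real;
  \<open>3 - c\<close> exchanges 1 and 2.\<close>

definition dual :: "row \<Rightarrow> row" where
  "dual x = (case x of Xh c \<Rightarrow> if q mod 4 = 3 then Xh (3 - c) else Xh c | _ \<Rightarrow> x)"

text \<open>For odd \<open>q\<close> the exponents \<open>2 * k * c\<close> are halved by
  \<open>two_cos_double\<close>, and the entries in \<open>CE\<close> are values at the middle
  index, where the cosine is a sign by \<open>two_cos_half\<close>.\<close>

lemma lam_row_fun: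
  assumes x: "x \<in> rows q" and s: "s \<in> cols q"
  shows "lam q x s = row_fun x s"
proof (cases rule: q_cases)
  case (even i)
  have "nA q = q - 1" "nB q = q + 1" using even by auto
  thus ?thesis using x s even(2-4) unfolding rows_eq cols_eq lam_def
    by (auto simp: unipotent_cols_def Onef_def Qf_def Pf_def Mf_def generic_fun_def cs_two_cos)
next
  case (one i)
  have "q - Suc 0 = 2 * nA q" "Suc q = 2 * nB q" "(q - Suc 0) div 4 = nA q div 2" "nA q = 2 * (nA q div 2)" "nA q div 2 > 0" using one by auto
  note * = this
  have A: "two_cos (q - Suc 0) (2 * m) = two_cos (nA q) m" "two_cos (Suc q) (2 * m) = two_cos (nB q) m" for m
    unfolding *(1,2) by (rule two_cos_double)+
  have H: "two_cos (nA q) (int (nA q div 2) * int c) = 2 * (- 1) ^ c" "two_cos (nA q) (int c * int (nA q div 2)) = 2 * (- 1) ^ c" for c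
    using two_cos_half[OF *(5), of c] *(4) by simp_all
  show ?thesis using x s one(2,3) unfolding rows_eq cols_eq lam_def
    by (auto simp: unipotent_cols_def Onef_def Qf_def Pf_def Mf_def Hf_def Sf_def Df_def generic_fun_def cs_two_cos A H *(3) mult.assoc power_add mult.left_commute[of _ 2])
next
  case (three i)
  have "q - Suc 0 = 2 * nA q" "Suc q = 2 * nB q" "Suc q div 4 = nB q div 2" "nB q = 2 * (nB q div 2)" "nB q div 2 > 0" using three by auto
  note * = this
  have A: "two_cos (q - Suc 0) (2 * m) = two_cos (nA q) m" "two_cos (Suc q) (2 * m) = two_cos (nB q) m" for m
    unfolding *(1,2) by (rule two_cos_double)+
  have H: "two_cos (nB q) (int (nB q div 2) * int c) = 2 * (- 1) ^ c" "two_cos (nB q) (int c * int (nB q div 2)) = 2 * (- 1) ^ c" for c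
    using two_cos_half[OF *(5), of c] *(4) by simp_all
  show ?thesis using x s three(2,3) unfolding rows_eq cols_eq lam_def
    by (auto simp: unipotent_cols_def Onef_def Qf_def Pf_def Mf_def Hf_def Sf_def Df_def generic_fun_def cs_two_cos A H *(3) mult.assoc power_add mult.left_commute[of _ 2])
qed

lemma dual_rows: "x \<in> rows q \<Longrightarrow> dual x \<in> rows q"
  by (auto simp: dual_def rows_eq split: if_splits)

lemma cnj_row_fun:
  assumes "x \<in> rows q"
  shows "cnj (row_fun x s) = row_fun (dual x) s"
proof -
  have "cnj (Sf s) = Sf s" "cnj (Df s) = (if q mod 4 = 3 then - Df s else Df s)"
    by (auto simp: Sf_def Mf_def Pf_def Df_def split: col.splits)
  thus ?thesis using assms
    by (auto simp: rows_eq dual_def Onef_def Qf_def Pf_def Mf_def Hf_def split: if_splits)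
qed

lemma tri_Q:
  "tri Qf g h = tri (Pf 0) g h - tri Onef g h"
  "tri g Qf h = tri g (Pf 0) h - tri g Onef h"
  "tri g h Qf = tri g h (Pf 0) - tri g h Onef"
  by (simp_all add: tri_def Qf_def algebra_simps diff_divide_distrib sum_subtractf)

lemma tri_H:
  "tri (Hf c) g h = (tri Sf g h + (- 1) ^ c * tri Df g h) / 2"
  "tri g (Hf c) h = (tri g Sf h + (- 1) ^ c * tri g Df h) / 2"
  "tri g h (Hf c) = (tri g h Sf + (- 1) ^ c * tri g h Df) / 2"
  by (simp_all add: tri_def Hf_def algebra_simps add_divide_distrib sum.distrib sum_distrib_left sum_divide_distrib)

lemma fun_CD [simp]: "Onef (CD k) = 1" "Pf a (CD k) = 1" "Mf a (CD k) = - 1" "Qf (CD k) = 0"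
  by (simp_all add: Onef_def Pf_def Mf_def Qf_def generic_fun_def)

text \<open>\<open>Df\<close> takes opposite values on two columns of equal weight, so the form
  measures how the product of the other two factors differs between these columns.\<close>

lemma tri_D_eq:
  assumes "odd q"
  shows "tri Df f g = (if q mod 4 = 3 then \<i> else 1) * of_real (sqrt (real q)) * (f (CD 2) * g (CD 2) - f (CD 1) * g (CD 1)) / of_nat q"
  using assms by (simp add: tri_def sum_cols Df_def unipotent_cols_def weight_def diff_divide_distrib algebra_simps)

lemma tri_D:
  assumes "odd q" "f (CD 1) = f (CD 2)" "g (CD 1) = g (CD 2)"
  shows "tri Df f g = 0" "tri f Df g = 0" "tri f g Df = 0"
  using tri_D_eq[OF assms(1), of f g] assms tri_comm by (metis (no_types) diff_self mult_zero_right div_0)+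

lemma tri_DD:
  assumes "odd q" "f (CD 1) = f (CD 2)"
  shows "tri Df Df f = (if q mod 4 = 3 then - 2 else 2) * f (CD 2)"
    "tri Df f Df = (if q mod 4 = 3 then - 2 else 2) * f (CD 2)"
    "tri f Df Df = (if q mod 4 = 3 then - 2 else 2) * f (CD 2)"
proof -
  have "complex_of_real (sqrt (real q)) * of_real (sqrt (real q)) = of_nat q"
    by (simp flip: of_real_mult)
  hence s: "complex_of_real (sqrt (real q)) * (of_real (sqrt (real q)) * x) = of_nat q * x" for x
    by (simp flip: mult.assoc)
  show *: "tri Df Df f = (if q mod 4 = 3 then - 2 else 2) * f (CD 2)"
    using tri_D_eq[OF assms(1), of Df f] assms q2 by (simp add: Df_def s field_simps)
  show "tri Df f Df = (if q mod 4 = 3 then - 2 else 2) * f (CD 2)"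
    "tri f Df Df = (if q mod 4 = 3 then - 2 else 2) * f (CD 2)"
    using * tri_comm by metis+
qed

lemma tri_DDD: "odd q \<Longrightarrow> tri Df Df Df = 0"
  by (simp add: tri_D_eq Df_def)

end

context psl_table
begin

lemma tri_perms:
  "tri Onef (Pf a) Onef = of_real (KA a)"
  "tri (Pf a) Onef Onef = of_real (KA a)"
  "tri Onef (Mf a) Onef = of_real (- KB a)"
  "tri (Mf a) Onef Onef = of_real (- KB a)"
  "tri (Pf a) Onef (Pf b) = of_real (KA (a + b) + KA (a - b))"
  "tri (Pf a) (Pf b) Onef = of_real (KA (a + b) + KA (a - b))"
  "tri Onef (Mf c) (Pf a) = of_real (0)"
  "tri (Pf a) Onef (Mf c) = of_real (0)"
  "tri (Pf a) (Mf c) Onef = of_real (0)"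
  "tri (Mf c) Onef (Pf a) = of_real (0)"
  "tri (Mf c) (Pf a) Onef = of_real (0)"
  "tri (Mf a) Onef (Mf b) = of_real (KB (a + b) + KB (a - b))"
  "tri (Mf a) (Mf b) Onef = of_real (KB (a + b) + KB (a - b))"
  "tri (Pf a) (Mf c) (Pf b) = of_real (real (ee q))"
  "tri (Mf c) (Pf a) (Pf b) = of_real (real (ee q))"
  "tri (Mf a) (Pf c) (Mf b) = of_real (real (ee q))"
  "tri (Mf a) (Mf b) (Pf c) = of_real (real (ee q))"
  by (metis tri_comm tri_11P tri_11M tri_1PP tri_1PM tri_1MM tri_PPM tri_PMM)+

lemmas tri_base = tri_111 tri_11P tri_11M tri_1PP tri_1PM tri_1MM tri_PPP tri_PPM tri_PMM tri_MMM tri_perms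

lemma mem_rows [simp]:
  "X1 \<in> rows q" "Xq \<in> rows q"
  "Xp a \<in> rows q \<longleftrightarrow> 0 < a \<and> 2 * a < nA q" "Xm a \<in> rows q \<longleftrightarrow> 0 < a \<and> 2 * a < nB q"
  "Xh c \<in> rows q \<longleftrightarrow> odd q \<and> (c = 1 \<or> c = 2)"
  by (auto simp: rows_eq)

definition is_nat :: "complex \<Rightarrow> bool" where "is_nat z \<longleftrightarrow> (\<exists>n :: nat. z = of_nat n)"

lemma is_natI: "z = of_nat n \<Longrightarrow> is_nat z" by (auto simp: is_nat_def)

lemma dvd_ind_neg_sum:
  assumes "0 < a" "2 * a < n" "2 * b < n"
  shows "dvd_ind n (- int a - int b) = 0" "dvd_ind n (int b - int a) = (if a = b then 1 else 0)"
    "dvd_ind n (2 * int a) = 0"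
  using assms dvd_ind_half_add[OF assms] dvd_ind_half_add[of a n a]
    dvd_ind_uminus[of n "int a + int b"] dvd_ind_uminus[of n "int a - int b"] by simp_all

lemma fusion_QQ:
  "tri Qf Qf Qf = of_nat (ee q)"
  "0 < a \<Longrightarrow> 2 * a < nA q \<Longrightarrow> tri Qf Qf (Pf (int a)) = of_nat (ee q)"
  "0 < a \<Longrightarrow> 2 * a < nB q \<Longrightarrow> tri Qf Qf (Mf (int a)) = of_nat (ee q)"
  by (simp_all add: tri_Q tri_base dvd_ind_half)

text \<open>The truncated subtraction is exact because \<open>ee q\<close> is at least 1. For even
  \<open>q\<close> and \<open>a = b\<close> the coefficient is 0: the square of \<open>Xm a\<close>
  misses \<open>Xq\<close>, which forces a detour in the proof of simplicity.\<close>

lemma fusion_Q: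
  "0 < a \<Longrightarrow> 2 * a < nA q \<Longrightarrow> 0 < b \<Longrightarrow> 2 * b < nA q \<Longrightarrow>
    tri Qf (Pf (int a)) (Pf (int b)) = of_nat (ee q + (if a = b then 1 else 0))"
  "tri Qf (Pf a') (Mf b') = of_nat (ee q)"
  "0 < a \<Longrightarrow> 2 * a < nB q \<Longrightarrow> 0 < b \<Longrightarrow> 2 * b < nB q \<Longrightarrow>
    tri Qf (Mf (int a)) (Mf (int b)) = of_nat (ee q - (if a = b then 1 else 0))"
  using torus_pos by (auto simp: tri_Q tri_base dvd_ind_half_add dvd_ind_half dvd_ind_neg_sum)

lemma fusion_PPP: "is_nat (tri (Pf a) (Pf b) (Pf c))"
proof -
  obtain n1 n2 n3 n4 where "KA (a + b + c) = real n1" "KA (a + b - c) = real n2" "KA (a - b + c) = real n3" "KA (a - b - c) = real n4"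
    using dvd_ind_nat by metis
  thus ?thesis by (intro is_natI[of _ "ee q + n1 + n2 + n3 + n4"]) (simp add: tri_base)
qed

lemma fusion_MMM:
  assumes "0 < a" "2 * a < nB q" "0 < b" "2 * b < nB q" "0 < c" "2 * c < nB q"
  shows "is_nat (tri (Mf (int a)) (Mf (int b)) (Mf (int c)))"
proof -
  obtain k where "k \<le> 1" and k: "KB (int a + int b + int c) + KB (int a + int b - int c)
     + KB (int a - int b + int c) + KB (int a - int b - int c) = real k"
    using dvd_ind_triple[OF assms] .
  thus ?thesis using torus_pos by (intro is_natI[of _ "ee q - k"]) (simp add: tri_base k of_nat_diff)
qed

lemma fusion_mixed: "is_nat (tri (Pf a) (Pf b) (Mf c))" "is_nat (tri (Pf a) (Mf b) (Mf c))"
  by (simp_all add: tri_base is_natI)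

text \<open>\<open>j\<close> is the residue of order two modulo \<open>n\<close>, the parameter at
  which \<open>Pf\<close> or \<open>Mf\<close> splits into the two rows \<open>Xh\<close>. As
  \<open>j\<close> and \<open>- j\<close> agree modulo \<open>n\<close>, congruences with a single
  \<open>j\<close> come in pairs.\<close>

lemma dvd_ind_mid:
  assumes "n = 2 * j" "0 < j"
  shows "dvd_ind n (int j) = 0" "dvd_ind n (int j + int j) = 1" "dvd_ind n (int j + int j + int j) = 0"
    "0 < a \<Longrightarrow> 2 * a < n \<Longrightarrow> dvd_ind n (int a + int j) = 0"
    "0 < a \<Longrightarrow> 2 * a < n \<Longrightarrow> dvd_ind n (int a - int j) = 0"
    "0 < a \<Longrightarrow> 2 * a < n \<Longrightarrow> dvd_ind n (int j + int a) = 0"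
    "0 < a \<Longrightarrow> 2 * a < n \<Longrightarrow> dvd_ind n (int j - int a) = 0"
    "0 < a \<Longrightarrow> 2 * a < n \<Longrightarrow> dvd_ind n (int a + int j + int j) = 0"
    "0 < a \<Longrightarrow> 2 * a < n \<Longrightarrow> dvd_ind n (int a - int j - int j) = 0"
    "0 < a \<Longrightarrow> 2 * a < n \<Longrightarrow> 0 < b \<Longrightarrow> 2 * b < n \<Longrightarrow> dvd_ind n (int a + int b + int j) = (if a + b = j then 1 else 0)"
    "0 < a \<Longrightarrow> 2 * a < n \<Longrightarrow> 0 < b \<Longrightarrow> 2 * b < n \<Longrightarrow> dvd_ind n (int a + int b - int j) = (if a + b = j then 1 else 0)"
    "0 < a \<Longrightarrow> 2 * a < n \<Longrightarrow> 0 < b \<Longrightarrow> 2 * b < n \<Longrightarrow> dvd_ind n (int a - int b + int j) = 0"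
    "0 < a \<Longrightarrow> 2 * a < n \<Longrightarrow> 0 < b \<Longrightarrow> 2 * b < n \<Longrightarrow> dvd_ind n (int a - int b - int j) = 0"
proof -
  show "dvd_ind n (int j) = 0" using assms by (subst dvd_ind_eq) auto
  show "dvd_ind n (int j + int j) = 1" using assms by (subst dvd_ind_between) auto
  show "dvd_ind n (int j + int j + int j) = 0" using assms by (subst dvd_ind_between) auto
  assume a: "0 < a" "2 * a < n"
  show "dvd_ind n (int a + int j) = 0" "dvd_ind n (int a - int j) = 0" "dvd_ind n (int j + int a) = 0" "dvd_ind n (int j - int a) = 0"
    using assms a by (auto intro!: dvd_ind_small)
  show "dvd_ind n (int a + int j + int j) = 0" using assms a by (subst dvd_ind_between) auto
  show "dvd_ind n (int a - int j - int j) = 0" using assms a by (intro dvd_ind_small) auto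
  assume b: "0 < b" "2 * b < n"
  show "dvd_ind n (int a + int b + int j) = (if a + b = j then 1 else 0)"
    using assms a b by (subst dvd_ind_between) auto
  show "dvd_ind n (int a + int b - int j) = (if a + b = j then 1 else 0)"
    using assms a b by (subst dvd_ind_eq) auto
  show "dvd_ind n (int a - int b + int j) = 0" "dvd_ind n (int a - int b - int j) = 0"
    using assms a b by (auto intro!: dvd_ind_small)
qed

lemma dvd_ind_mid':
  assumes "n = 2 * j" "0 < j"
  shows "dvd_ind n (2 * int j) = 1" "dvd_ind n (3 * int j) = 0"
    "0 < a \<Longrightarrow> 2 * a < n \<Longrightarrow> dvd_ind n (int a + 2 * int j) = 0"
    "0 < a \<Longrightarrow> 2 * a < n \<Longrightarrow> dvd_ind n (int a - 2 * int j) = 0"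
    "0 < a \<Longrightarrow> 2 * a < n \<Longrightarrow> dvd_ind n (2 * int j + int a) = 0"
    "0 < a \<Longrightarrow> 2 * a < n \<Longrightarrow> dvd_ind n (- int a - int j) = 0"
  using dvd_ind_mid(2,3,4,8,9)[OF assms] dvd_ind_uminus[of n "int a + int j"] by (simp_all add: algebra_simps)

section \<open>The rows of dimension (q - 1) / 2, for q congruent to 3 modulo 4\<close>

context
  fixes j :: nat
  assumes oddq: "odd q" and q4: "q mod 4 = 3" and j: "nB q = 2 * j" "0 < j"
begin

lemma mod3_facts: "ee q = 2" "Sf = Mf (int j)"
  using oddq q4 j by (auto simp: ee_def Sf_def)

lemmas mod3_simps = tri_H mod3_facts tri_Q tri_base tri_D[OF oddq] tri_DD[OF oddq] tri_DDD[OF oddq] q4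
  dvd_ind_half dvd_ind_half_add dvd_ind_mid[OF j] dvd_ind_mid'[OF j]

lemma mod3_11H:
  assumes "c = 1 \<or> c = 2"
  shows "tri Onef Onef (Hf c) = 0"
  using assms by (elim disjE; simp add: mod3_simps)

lemma mod3_1QH:
  assumes "c = 1 \<or> c = 2"
  shows "tri Onef Qf (Hf c) = 0"
  using assms by (elim disjE; simp add: mod3_simps)

lemma mod3_1PH:
  assumes "c = 1 \<or> c = 2"
  shows "tri Onef (Pf b) (Hf c) = 0"
  using assms by (elim disjE; simp add: mod3_simps)

lemma mod3_1MH:
  assumes "c = 1 \<or> c = 2"
  shows "0 < a \<Longrightarrow> 2 * a < nB q \<Longrightarrow> tri Onef (Mf (int a)) (Hf c) = 0"
  using assms by (elim disjE; simp add: mod3_simps)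

text \<open>\<open>tri Onef Sf Sf\<close> is 2 and \<open>tri Onef Df Df\<close> is - 2. For equal
  rows they cancel, so each of the two rows is dual to the other.\<close>

lemma mod3_1HH:
  assumes "c = 1 \<or> c = 2"
  shows "d = 1 \<or> d = 2 \<Longrightarrow> tri Onef (Hf c) (Hf d) = (if c = d then 0 else 1)"
  using assms by (elim disjE; simp add: mod3_simps)

lemma mod3_QQH:
  assumes "c = 1 \<or> c = 2"
  shows "tri Qf Qf (Hf c) = 1"
  using assms by (elim disjE; simp add: mod3_simps)

lemma mod3_QPH:
  assumes "c = 1 \<or> c = 2"
  shows "tri Qf (Pf b) (Hf c) = 1"
  using assms by (elim disjE; simp add: mod3_simps)

lemma mod3_QMH:
  assumes "c = 1 \<or> c = 2"
  shows "0 < a \<Longrightarrow> 2 * a < nB q \<Longrightarrow> tri Qf (Mf (int a)) (Hf c) = 1"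
  using assms by (elim disjE; simp add: mod3_simps)

lemma mod3_PPH:
  assumes "c = 1 \<or> c = 2"
  shows "tri (Pf b) (Pf b') (Hf c) = 1"
  using assms by (elim disjE; simp add: mod3_simps)

lemma mod3_PMH:
  assumes "c = 1 \<or> c = 2"
  shows "tri (Pf b) (Mf b') (Hf c) = 1"
  using assms by (elim disjE; simp add: mod3_simps)

text \<open>If \<open>a + a' = j\<close>, the congruences with \<open>j\<close> and with
  \<open>- j\<close> both hold and reduce the form with \<open>Sf\<close> from 2 to 0, so its half
  stays integral.\<close>

lemma mod3_MMH:
  assumes "c = 1 \<or> c = 2"
  shows "0 < a \<Longrightarrow> 2 * a < nB q \<Longrightarrow> 0 < a' \<Longrightarrow> 2 * a' < nB q \<Longrightarrow> tri (Mf (int a)) (Mf (int a')) (Hf c) = (if a + a' = j then 0 else 1)"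
  using assms by (elim disjE; simp add: mod3_simps)

lemma mod3_QHH:
  assumes "c = 1 \<or> c = 2" "d = 1 \<or> d = 2"
  shows "tri Qf (Hf c) (Hf d) = 0"
  using assms by (elim disjE; simp add: mod3_simps)

lemma mod3_PHH:
  assumes "c = 1 \<or> c = 2" "d = 1 \<or> d = 2"
  shows "tri (Pf b) (Hf c) (Hf d) = (if c = d then 0 else 1)"
  using assms by (elim disjE; simp add: mod3_simps)

lemma mod3_MHH:
  assumes "c = 1 \<or> c = 2" "d = 1 \<or> d = 2"
  shows "0 < a \<Longrightarrow> 2 * a < nB q \<Longrightarrow> tri (Mf (int a)) (Hf c) (Hf d) = (if c = d then 1 else 0)"
  using assms by (elim disjE; simp add: mod3_simps)

text \<open>\<open>tri Sf Sf Sf\<close> and \<open>tri Sf Df Df\<close> are both 2, the latter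
  entering with three pairwise signs: the total is 8 if all rows agree and 0 otherwise, to be
  divided by 8.\<close>

lemma mod3_HHH:
  assumes "c = 1 \<or> c = 2" "d = 1 \<or> d = 2"
  shows "e = 1 \<or> e = 2 \<Longrightarrow> tri (Hf c) (Hf d) (Hf e) = (if c = d \<and> d = e then 1 else 0)"
  using assms by (elim disjE; simp add: mod3_simps)

end

section \<open>The rows of dimension (q + 1) / 2, for q congruent to 1 modulo 4\<close>

context
  fixes j :: nat
  assumes oddq: "odd q" and q4: "q mod 4 \<noteq> 3" and j: "nA q = 2 * j" "0 < j"
begin

lemma mod1_facts: "ee q = 2" "Sf = Pf (int j)"
  using oddq q4 j by (auto simp: ee_def Sf_def)

lemmas mod1_simps = tri_H mod1_facts tri_Q tri_base tri_D[OF oddq] tri_DD[OF oddq] tri_DDD[OF oddq] q4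
  dvd_ind_half dvd_ind_half_add dvd_ind_mid[OF j] dvd_ind_mid'[OF j]

lemma mod1_11H:
  assumes "c = 1 \<or> c = 2"
  shows "tri Onef Onef (Hf c) = 0"
  using assms by (elim disjE; simp add: mod1_simps)

lemma mod1_1QH:
  assumes "c = 1 \<or> c = 2"
  shows "tri Onef Qf (Hf c) = 0"
  using assms by (elim disjE; simp add: mod1_simps)

lemma mod1_1MH:
  assumes "c = 1 \<or> c = 2"
  shows "tri Onef (Mf b) (Hf c) = 0"
  using assms by (elim disjE; simp add: mod1_simps)

lemma mod1_1PH:
  assumes "c = 1 \<or> c = 2"
  shows "0 < a \<Longrightarrow> 2 * a < nA q \<Longrightarrow> tri Onef (Pf (int a)) (Hf c) = 0"
  using assms by (elim disjE; simp add: mod1_simps)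

lemma mod1_1HH:
  assumes "c = 1 \<or> c = 2"
  shows "d = 1 \<or> d = 2 \<Longrightarrow> tri Onef (Hf c) (Hf d) = (if c = d then 1 else 0)"
  using assms by (elim disjE; simp add: mod1_simps)

lemma mod1_QQH:
  assumes "c = 1 \<or> c = 2"
  shows "tri Qf Qf (Hf c) = 1"
  using assms by (elim disjE; simp add: mod1_simps)

lemma mod1_QMH:
  assumes "c = 1 \<or> c = 2"
  shows "tri Qf (Mf b) (Hf c) = 1"
  using assms by (elim disjE; simp add: mod1_simps)

lemma mod1_QPH:
  assumes "c = 1 \<or> c = 2"
  shows "0 < a \<Longrightarrow> 2 * a < nA q \<Longrightarrow> tri Qf (Pf (int a)) (Hf c) = 1"
  using assms by (elim disjE; simp add: mod1_simps)

lemma mod1_MMH: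
  assumes "c = 1 \<or> c = 2"
  shows "tri (Mf b) (Mf b') (Hf c) = 1"
  using assms by (elim disjE; simp add: mod1_simps)

lemma mod1_PMH:
  assumes "c = 1 \<or> c = 2"
  shows "tri (Pf b) (Mf b') (Hf c) = 1"
  using assms by (elim disjE; simp add: mod1_simps)

lemma mod1_PPH:
  assumes "c = 1 \<or> c = 2"
  shows "0 < a \<Longrightarrow> 2 * a < nA q \<Longrightarrow> 0 < a' \<Longrightarrow> 2 * a' < nA q \<Longrightarrow> tri (Pf (int a)) (Pf (int a')) (Hf c) = (if a + a' = j then 2 else 1)"
  using assms by (elim disjE; simp add: mod1_simps)

lemma mod1_QHH:
  assumes "c = 1 \<or> c = 2" "d = 1 \<or> d = 2"
  shows "tri Qf (Hf c) (Hf d) = 1"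
  using assms by (elim disjE; simp add: mod1_simps)

lemma mod1_MHH:
  assumes "c = 1 \<or> c = 2" "d = 1 \<or> d = 2"
  shows "tri (Mf b) (Hf c) (Hf d) = (if c = d then 0 else 1)"
  using assms by (elim disjE; simp add: mod1_simps)

lemma mod1_PHH:
  assumes "c = 1 \<or> c = 2" "d = 1 \<or> d = 2"
  shows "0 < a \<Longrightarrow> 2 * a < nA q \<Longrightarrow> tri (Pf (int a)) (Hf c) (Hf d) = (if c = d then 1 else 0)"
  using assms by (elim disjE; simp add: mod1_simps)

lemma mod1_HHH:
  assumes "c = 1 \<or> c = 2" "d = 1 \<or> d = 2"
  shows "e = 1 \<or> e = 2 \<Longrightarrow> tri (Hf c) (Hf d) (Hf e) = (if c = d \<and> d = e then 1 else 0)"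
  using assms by (elim disjE; simp add: mod1_simps)

end

end

section \<open>From triple products to the fusion ring\<close>

context psl_table
begin

lemma is_nat_simps [simp]: "is_nat 0" "is_nat 1" "is_nat 2" "is_nat (if b then x else y) \<longleftrightarrow> (if b then is_nat x else is_nat y)"
  using is_natI[of 0 0] is_natI[of 1 1] is_natI[of 2 2] by auto

lemma mod3_mid: "odd q \<Longrightarrow> q mod 4 = 3 \<Longrightarrow> nB q = 2 * (nB q div 2) \<and> 0 < nB q div 2"
  by (cases rule: q_cases) auto

lemma mod1_mid: "odd q \<Longrightarrow> q mod 4 \<noteq> 3 \<Longrightarrow> nA q = 2 * (nA q div 2) \<and> 0 < nA q div 2"
  by (cases rule: q_cases) auto

text \<open>As \<open>tri\<close> is symmetric, only triples of rows sorted by kind are evaluated.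
  With \<open>Xh\<close> last, the final argument alone tells whether a half-dimensional row
  occurs.\<close>

fun rank :: "row \<Rightarrow> nat" where
  "rank X1 = 0" | "rank Xq = 1" | "rank (Xp _) = 2" | "rank (Xm _) = 3" | "rank (Xh _) = 4"

lemma tri_unit_sorted:
  assumes "x \<in> rows q" "y \<in> rows q" "rank x \<le> rank y"
  shows "tri Onef (row_fun x) (row_fun y) = (if y = dual x then 1 else 0)"
proof (cases "\<exists>c. y = Xh c")
  case False
  thus ?thesis using assms
    by (cases x; cases y) (auto simp: dual_def tri_Q tri_base dvd_ind_half dvd_ind_half_add)
next
  case h: True
  hence odd: "odd q" using assms by auto
  show ?thesis
  proof (cases "q mod 4 = 3")
    case True
    note j = mod3_mid[OF odd True]
    note r = mod3_11H mod3_1QH mod3_1PH mod3_1MH mod3_1HH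
    note r' = r[OF odd True conjunct1[OF j] conjunct2[OF j]]
    show ?thesis using assms h odd True
      by (cases x; cases y) (auto simp: r' dual_def)
  next
    case False
    note j = mod1_mid[OF odd False]
    note r = mod1_11H mod1_1QH mod1_1MH mod1_1PH mod1_1HH
    note r' = r[OF odd False conjunct1[OF j] conjunct2[OF j]]
    show ?thesis using assms h odd False
      by (cases x; cases y) (auto simp: r' dual_def)
  qed
qed

lemma dual_dual: "x \<in> rows q \<Longrightarrow> dual (dual x) = x"
  by (cases x) (auto simp: dual_def)

lemma tri_unit:
  assumes "x \<in> rows q" "y \<in> rows q"
  shows "tri Onef (row_fun x) (row_fun y) = (if y = dual x then 1 else 0)"
proof (cases "rank x \<le> rank y")
  case False
  hence "tri Onef (row_fun y) (row_fun x) = (if x = dual y then 1 else 0)"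
    using assms by (intro tri_unit_sorted) auto
  moreover have "x = dual y \<longleftrightarrow> y = dual x" using assms dual_dual by metis
  ultimately show ?thesis by (simp add: tri_comm(2)[of Onef "row_fun x"])
qed (use tri_unit_sorted assms in auto)

lemma tri_is_nat_sorted:
  assumes "x \<in> rows q" "y \<in> rows q" "z \<in> rows q" "rank x \<le> rank y" "rank y \<le> rank z"
  shows "is_nat (tri (row_fun x) (row_fun y) (row_fun z))"
proof (cases "x = X1")
  case True
  thus ?thesis using tri_unit[OF assms(2,3)] by simp
next
  case x: False
  show ?thesis
  proof (cases "\<exists>c. z = Xh c")
    case False
    thus ?thesis using assms x
      by (cases x; cases y; cases z)
        (auto intro: fusion_QQ[THEN is_natI] fusion_Q[THEN is_natI] fusion_PPP fusion_MMM fusion_mixed)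
  next
    case True
    hence odd: "odd q" using assms by auto
    show ?thesis
    proof (cases "q mod 4 = 3")
      case q4: True
      note j = mod3_mid[OF odd q4]
      note r = mod3_QQH mod3_QPH mod3_QMH mod3_PPH mod3_PMH mod3_MMH
        mod3_QHH mod3_PHH mod3_MHH mod3_HHH
      note r' = r[OF odd q4 conjunct1[OF j] conjunct2[OF j]]
      show ?thesis using assms x True odd
        by (cases x; cases y; cases z) (auto simp: r')
    next
      case q4: False
      note j = mod1_mid[OF odd q4]
      note r = mod1_QQH mod1_QMH mod1_QPH mod1_MMH mod1_PMH mod1_PPH
        mod1_QHH mod1_MHH mod1_PHH mod1_HHH
      note r' = r[OF odd q4 conjunct1[OF j] conjunct2[OF j]]
      show ?thesis using assms x True odd
        by (cases x; cases y; cases z) (auto simp: r')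
    qed
  qed
qed

lemma tri_is_nat:
  assumes "x \<in> rows q" "y \<in> rows q" "z \<in> rows q"
  shows "is_nat (tri (row_fun x) (row_fun y) (row_fun z))"
  using tri_is_nat_sorted assms tri_comm by (metis nat_le_linear)

definition fusion_coeff :: "row \<Rightarrow> row \<Rightarrow> row \<Rightarrow> nat" where
  "fusion_coeff x y z = (SOME n. tri (row_fun x) (row_fun y) (row_fun (dual z)) = of_nat n)"

lemma fusion_coeff:
  assumes "x \<in> rows q" "y \<in> rows q" "z \<in> rows q"
  shows "tri (row_fun x) (row_fun y) (row_fun (dual z)) = of_nat (fusion_coeff x y z)"
proof -
  have "\<exists>n :: nat. tri (row_fun x) (row_fun y) (row_fun (dual z)) = of_nat n"
    using tri_is_nat[OF assms(1,2) dual_rows[OF assms(3)]] by (simp add: is_nat_def)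
  thus ?thesis unfolding fusion_coeff_def by (rule someI_ex)
qed

lemma row_fun_C0:
  assumes "x \<in> rows q"
  obtains n :: nat where "n > 0" "row_fun x C0 = of_nat n"
proof -
  have "\<exists>n :: nat. n > 0 \<and> row_fun x C0 = of_nat n"
  proof (cases x)
    case X1
    thus ?thesis by (intro exI[of _ 1]) (simp add: Onef_def generic_fun_def)
  next
    case Xq
    thus ?thesis using q2 by (intro exI[of _ q]) (simp add: Qf_def Pf_def Onef_def generic_fun_def)
  next
    case (Xp a)
    thus ?thesis by (intro exI[of _ "q + 1"]) (simp add: Pf_def generic_fun_def)
  next
    case (Xm a)
    thus ?thesis using q2 by (intro exI[of _ "q - 1"]) (simp add: Mf_def generic_fun_def of_nat_diff)
  next
    case (Xh c)
    hence odd: "odd q" using assms by simp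
    show ?thesis
    proof (cases "q mod 4 = 3")
      case True
      have "real (q - 1) = 2 * real ((q - 1) div 2)" using odd q2 by (auto elim!: oddE)
      hence "real q - 1 = 2 * real ((q - 1) div 2)" using q2 by (simp add: of_nat_diff)
      thus ?thesis using True Xh odd q2
        by (intro exI[of _ "(q - 1) div 2"]) (auto simp: Hf_def Sf_def Df_def Mf_def generic_fun_def elim!: oddE)
    next
      case False
      have "real q + 1 = 2 * real ((q + 1) div 2)" using odd by (auto elim!: oddE)
      thus ?thesis using False Xh odd q2
        by (intro exI[of _ "(q + 1) div 2"]) (auto simp: Hf_def Sf_def Df_def Pf_def generic_fun_def elim!: oddE)
    qed
  qed
  thus thesis using that by blast
qed

lemma Onef_eq_1: "Onef s = 1"
  by (simp add: Onef_def generic_fun_def split: col.splits)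

lemma sum_lam_tri:
  assumes "x \<in> rows q" "y \<in> rows q" "z \<in> rows q"
  shows "(\<Sum>s\<in>cols q. lam q x s * lam q y s * cnj (lam q z s) / of_real (weight q s))
    = tri (row_fun x) (row_fun y) (row_fun (dual z))"
  unfolding tri_def using assms
  by (intro sum.cong refl) (simp add: lam_row_fun cnj_row_fun)

sublocale eigentable "rows q" "cols q" "lam q" "weight q" X1 C0 dual fusion_coeff
proof
  show "finite (rows q)" "finite (cols q)" "card (cols q) = card (rows q)"
    by (fact finite_rows finite_cols card_cols)+
  show "weight q s > 0" for s
    using q2 torus_pos by (auto simp: weight_def split: col.splits)
  show "X1 \<in> rows q" "C0 \<in> cols q" by (auto simp: cols_eq)
  show lam1: "lam q X1 s = 1" if "s \<in> cols q" for s
    using lam_row_fun[OF _ that, of X1] by (simp add: Onef_eq_1)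
  show "dual x \<in> rows q" if "x \<in> rows q" for x using dual_rows[OF that] .
  show "lam q (dual x) s = cnj (lam q x s)" if "x \<in> rows q" "s \<in> cols q" for x s
    using that by (simp add: lam_row_fun dual_rows cnj_row_fun)
  show "(\<Sum>s\<in>cols q. lam q x s * cnj (lam q z s) / of_real (weight q s)) = (if x = z then 1 else 0)"
    if "x \<in> rows q" "z \<in> rows q" for x z
  proof -
    have "(\<Sum>s\<in>cols q. lam q x s * cnj (lam q z s) / of_real (weight q s)) = tri Onef (row_fun x) (row_fun (dual z))"
      using sum_lam_tri[of X1 x z] that by (simp add: lam1)
    also have "\<dots> = (if dual z = dual x then 1 else 0)" using that dual_rows by (intro tri_unit) auto
    also have "dual z = dual x \<longleftrightarrow> x = z" using that dual_dual by metis
    finally show ?thesis .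
  qed
  have C0: "C0 \<in> cols q" by (auto simp: cols_eq)
  show "lam q x C0 \<in> \<real>" "Re (lam q x C0) > 0" if "x \<in> rows q" for x
    using row_fun_C0[OF that] lam_row_fun[OF that C0] by (metis Reals_of_nat, metis complex_Re_of_nat of_nat_0_less_iff)
  show "(\<Sum>s\<in>cols q. lam q x s * lam q y s * cnj (lam q z s) / of_real (weight q s)) = of_nat (fusion_coeff x y z)"
    if "x \<in> rows q" "y \<in> rows q" "z \<in> rows q" for x y z
    using sum_lam_tri[OF that] fusion_coeff[OF that] by simp
qed

text \<open>\<open>Ncoef\<close> divides by the column norm \<open>cc\<close>, the computations by
  the closed formula \<open>weight\<close>; \<open>col_norm\<close> identifies the two.\<close>

lemma Ncoef_fusion_coeff:
  assumes "x \<in> rows q" "y \<in> rows q" "z \<in> rows q"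
  shows "Ncoef q x y z = of_nat (fusion_coeff x y z)"
  using M[OF assms] col_norm by (simp add: Ncoef_def cc_def)

lemma integral_fusion: "integral_fr (rows q) fusion_coeff X1"
proof (rule integral)
  fix x assume x: "x \<in> rows q"
  show "Re (lam q x C0) \<in> \<int>"
    using row_fun_C0[OF x] lam_row_fun[OF x c0(1)] by (metis Ints_of_nat complex_Re_of_nat)
qed

text \<open>The bound on \<open>q\<close> provides the row \<open>Xp 1\<close> where it is needed,
  for even \<open>q\<close> and for \<open>q mod 4 = 3\<close>. For q = 2 and q = 3 there are no
  rows \<open>Xp\<close>: these tables belong to the symmetric group on 3 letters and the
  alternating group on 4, which are not simple.\<close>

lemma simple_fusion:
  assumes q4: "q \<ge> 4"
  shows "simple_fr (rows q) fusion_coeff X1"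
  unfolding simple_fr_def
proof (intro allI impI)
  fix S
  assume "S \<subseteq> rows q \<and> X1 \<in> S \<and> (\<forall>i\<in>S. \<forall>k\<in>rows q. fusion_coeff i k X1 \<noteq> 0 \<longrightarrow> k \<in> S)
    \<and> (\<forall>i\<in>S. \<forall>j\<in>S. \<forall>k\<in>rows q. fusion_coeff i j k \<noteq> 0 \<longrightarrow> k \<in> S)"
  hence S: "S \<subseteq> rows q" "X1 \<in> S" and dualS: "\<And>i k. i \<in> S \<Longrightarrow> k \<in> rows q \<Longrightarrow> fusion_coeff i k X1 \<noteq> 0 \<Longrightarrow> k \<in> S"
    and multS: "\<And>i j k. i \<in> S \<Longrightarrow> j \<in> S \<Longrightarrow> k \<in> rows q \<Longrightarrow> fusion_coeff i j k \<noteq> 0 \<Longrightarrow> k \<in> S" by blast+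
  have closed: "k \<in> S" if "i \<in> S" "j \<in> S" "k \<in> rows q" "tri (row_fun i) (row_fun j) (row_fun (dual k)) \<noteq> 0" for i j k
  proof (rule multS[OF that(1-3)])
    have "i \<in> rows q" "j \<in> rows q" using that S by blast+
    thus "fusion_coeff i j k \<noteq> 0" using fusion_coeff[of i j k] that(3,4) by (metis of_nat_0)
  qed
  have dual_closed: "dual i \<in> S" if i: "i \<in> S" for i
  proof (rule dualS[OF i])
    show "dual i \<in> rows q" using i S dual_rows by auto
    have "tri (row_fun i) (row_fun (dual i)) (row_fun (dual X1)) = tri Onef (row_fun i) (row_fun (dual i))"
      using tri_comm by (simp add: dual_def)
    also have "\<dots> = 1" using i S dual_rows by (subst tri_unit) auto
    finally show "fusion_coeff i (dual i) X1 \<noteq> 0" using fusion_coeff[of i "dual i" X1] i S dual_rows by auto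
  qed
  have Xq: "S = rows q" if "Xq \<in> S"
  proof (rule equalityI)
    show "rows q \<subseteq> S"
    proof
      fix k assume k: "k \<in> rows q"
      have "tri Qf Qf (row_fun y) \<noteq> 0" if y: "y \<in> rows q" for y
      proof (cases y)
        case X1
        have "tri Qf Qf Onef = tri Onef Qf Qf" using tri_comm by metis
        also have "\<dots> = 1" using tri_unit[of Xq Xq] by (simp add: dual_def)
        finally show ?thesis using X1 by simp
      next
        case (Xh c)
        hence c: "odd q" "c = 1 \<or> c = 2" using y by auto
        show ?thesis
        proof (cases "q mod 4 = 3")
          case q4: True
          note j = mod3_mid[OF c(1) q4]
          show ?thesis using mod3_QQH[OF c(1) q4 conjunct1[OF j] conjunct2[OF j] c(2)] Xh by simp
        next
          case q4: False
          note j = mod1_mid[OF c(1) q4]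
          show ?thesis using mod1_QQH[OF c(1) q4 conjunct1[OF j] conjunct2[OF j] c(2)] Xh by simp
        qed
      qed (use y fusion_QQ torus_pos in auto)
      from this[OF dual_rows[OF k]] show "k \<in> S" using closed[OF that that k] by simp
    qed
  qed (use S in auto)
  have Xp_imp: "Xq \<in> S" if a: "Xp a \<in> S" for a
  proof (rule closed[OF a a])
    have "Xp a \<in> rows q" using a S by blast
    hence "tri Qf (Pf (int a)) (Pf (int a)) = of_nat (Suc (ee q))" using fusion_Q(1)[of a a] by simp
    hence "tri Qf (Pf (int a)) (Pf (int a)) \<noteq> 0" by (simp only: of_nat_eq_0_iff nat.distinct not_False_eq_True)
    moreover have "tri Qf (Pf (int a)) (Pf (int a)) = tri (Pf (int a)) (Pf (int a)) Qf" using tri_comm by metis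
    ultimately show "tri (row_fun (Xp a)) (row_fun (Xp a)) (row_fun (dual Xq)) \<noteq> 0" by (simp add: dual_def)
  qed simp
  have "Xq \<in> S" if x: "x \<in> S" "x \<noteq> X1" for x
  proof (cases x)
    case (Xm a)
    show ?thesis
    proof (cases "even q")
      case True
      \<comment> \<open>For even \<open>q\<close> the square of \<open>Xm a\<close> does not contain
        \<open>Xq\<close>, so \<open>Xp 1\<close> is reached first; it occurs with multiplicity
        \<open>ee q\<close>.\<close>
      have "Xp 1 \<in> S"
      proof (rule closed[OF x(1) x(1)])
        show "Xp 1 \<in> rows q" using True q4 by (auto simp: nA_def ee_def)
        show "tri (row_fun x) (row_fun x) (row_fun (dual (Xp 1))) \<noteq> 0"
          using torus_pos by (simp add: Xm dual_def tri_base)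
      qed
      thus ?thesis by (rule Xp_imp)
    next
      case False
      have "Xm a \<in> rows q" using x S Xm by blast
      hence "tri Qf (Mf (int a)) (Mf (int a)) \<noteq> 0" using False fusion_Q(3)[of a a] by (simp add: ee_def)
      moreover have "tri Qf (Mf (int a)) (Mf (int a)) = tri (Mf (int a)) (Mf (int a)) Qf" using tri_comm by metis
      ultimately have "tri (row_fun x) (row_fun x) (row_fun (dual Xq)) \<noteq> 0" by (simp add: dual_def Xm)
      thus ?thesis by (rule closed[OF x(1) x(1) mem_rows(2)])
    qed
  next
    case (Xh c)
    have "Xh c \<in> rows q" using x S Xh by blast
    hence c: "odd q" "c = 1 \<or> c = 2" by auto
    show ?thesis
    proof (cases "q mod 4 = 3")
      case True
      note j = mod3_mid[OF c(1) True]
      \<comment> \<open>By \<open>mod3_QHH\<close> no product of two rows \<open>Xh\<close> contains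
        \<open>Xq\<close> here. By \<open>mod3_PHH\<close> the product with the dual row contains
        \<open>Xp 1\<close>, whereas the square does not.\<close>
      have "Xp 1 \<in> S"
      proof (rule closed[OF x(1) dual_closed[OF x(1)]])
        have "2 < nA q" using True q4 by (cases rule: q_cases) auto
        thus "Xp 1 \<in> rows q" by simp
        have "tri (Pf (int 1)) (Hf c) (Hf (3 - c)) = 1"
          using mod3_PHH[OF c(1) True conjunct1[OF j] conjunct2[OF j] c(2), of "3 - c" "int 1"] c by auto
        moreover have "tri (Pf (int 1)) (Hf c) (Hf (3 - c)) = tri (Hf c) (Hf (3 - c)) (Pf (int 1))" using tri_comm by metis
        ultimately show "tri (row_fun x) (row_fun (dual x)) (row_fun (dual (Xp 1))) \<noteq> 0"
          using True by (simp add: Xh dual_def)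
      qed
      thus ?thesis by (rule Xp_imp)
    next
      case False
      note j = mod1_mid[OF c(1) False]
      have "tri Qf (Hf c) (Hf c) = 1"
        using mod1_QHH[OF c(1) False conjunct1[OF j] conjunct2[OF j] c(2) c(2)] .
      moreover have "tri Qf (Hf c) (Hf c) = tri (Hf c) (Hf c) Qf" using tri_comm by metis
      ultimately have "tri (row_fun x) (row_fun x) (row_fun (dual Xq)) \<noteq> 0" using False by (simp add: Xh dual_def)
      thus ?thesis by (rule closed[OF x(1) x(1) mem_rows(2)])
    qed
  next
    case X1
    thus ?thesis using x by simp
  next
    case Xq
    thus ?thesis using x by simp
  next
    case (Xp a)
    thus ?thesis using Xp_imp[of a] x by simp
  qed
  thus "S = {X1} \<or> S = rows q" using Xq S by blast
qed

lemma not_RepG: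
  fixes G :: "('g, 'b) monoid_scheme"
  assumes npp: "\<not> prime_power q" and G: "group G" "finite (carrier G)"
  shows "\<not> iso_to_RepG (rows q) fusion_coeff X1 G"
proof
  assume "iso_to_RepG (rows q) fusion_coeff X1 G"
  then obtain \<phi> where "bij_betw \<phi> (rows q) (irr_chars G)" "\<phi> X1 = (\<lambda>g. if g \<in> carrier G then 1 else 0)"
      "\<forall>x\<in>rows q. \<forall>y\<in>rows q. \<forall>z\<in>rows q. of_nat (fusion_coeff x y z) = groth_N G (\<phi> x) (\<phi> y) (\<phi> z)"
    unfolding iso_to_RepG_def by blast
  then interpret R: eigentable_group "rows q" "cols q" "lam q" "weight q" X1 C0 dual fusion_coeff G \<phi>
    using G by (intro eigentable_group.intro eigentable_axioms eigentable_group_axioms.intro) auto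
  have "q \<noteq> 1" "q \<noteq> 0" using q2 by simp_all
  then obtain p1 where p1: "prime p1" "p1 dvd q" using prime_factor_nat by blast
  have unit: "\<not> is_unit p1" using p1(1) not_prime_unit by blast
  \<comment> \<open>As \<open>q\<close> is not a power of \<open>p1\<close>, the cofactor
    \<open>m\<close> has a prime divisor \<open>p2\<close>, which differs from \<open>p1\<close>
    because \<open>p1\<close> does not divide \<open>m\<close>.\<close>
  define k where "k = multiplicity p1 q"
  obtain m where "q = p1 ^ multiplicity p1 q * m" and m: "\<not> p1 dvd m"
    by (rule multiplicity_decompose'[OF \<open>q \<noteq> 0\<close> unit])
  hence qm: "q = p1 ^ k * m" by (simp only: k_def)
  have "k > 0"
  proof (rule ccontr)
    assume "\<not> k > 0"
    hence "q = m" using qm by simp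
    thus False using m p1(2) by simp
  qed
  have "m \<noteq> 1"
  proof
    assume "m = 1"
    hence "q = p1 ^ k" using qm by simp
    thus False using npp p1(1) \<open>k > 0\<close> unfolding prime_power_def by blast
  qed
  then obtain p2 where p2: "prime p2" "p2 dvd m" using prime_factor_nat by blast
  have p2q: "p2 dvd q" unfolding qm using p2(2) by (rule dvd_mult)
  \<comment> \<open>The weights as natural numbers; \<open>q * (nA q * (q + 1))\<close> avoids the
    division by \<open>ee q\<close> at \<open>C0\<close>.\<close>
  define W where "W s = (case s of C0 \<Rightarrow> q * (nA q * (q + 1)) | C1 \<Rightarrow> q | CD _ \<Rightarrow> q | CA _ \<Rightarrow> nA q | CB _ \<Rightarrow> nB q
    | CE \<Rightarrow> 2 * (if q mod 4 = 3 then nB q else nA q))" for s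
  \<comment> \<open>\<open>nA q\<close> and \<open>nB q\<close> divide q - 1 and q + 1, which are
    prime to q. For odd q the doubled orders, one of which is the weight of \<open>CE\<close>, are q
    - 1 and q + 1 themselves.\<close>
  have coprime: "\<not> p dvd nA q \<and> \<not> p dvd nB q \<and> (odd q \<longrightarrow> \<not> p dvd 2 * nA q \<and> \<not> p dvd 2 * nB q)"
    if p: "prime p" "p dvd q" for p
  proof -
    have up: "\<not> p dvd q + 1"
    proof
      assume "p dvd q + 1"
      hence "p dvd 1" using dvd_add_right_iff[OF p(2), of 1] by simp
      thus False using p(1) not_prime_unit by blast
    qed
    have down: "\<not> p dvd q - 1"
    proof
      assume "p dvd q - 1"
      with p(2) have "p dvd q - (q - 1)" by (rule dvd_diff_nat)
      moreover have "q - (q - 1) = 1" using q2 by linarith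
      ultimately have "is_unit p" by (simp only:)
      thus False using p(1) not_prime_unit by blast
    qed
    have A: "nA q * ee q = q - 1" by (cases rule: q_cases) simp_all
    have B: "nB q * ee q = q + 1" by (cases rule: q_cases) simp_all
    have "\<not> p dvd nA q" "\<not> p dvd nB q"
      using up down dvd_mult2[of p "nA q" "ee q"] dvd_mult2[of p "nB q" "ee q"] unfolding A B by blast+
    moreover have "\<not> p dvd 2 * nA q \<and> \<not> p dvd 2 * nB q" if "odd q"
    proof -
      have "2 * nA q = q - 1" "2 * nB q = q + 1" using A B that by (simp_all add: ee_def)
      thus ?thesis using up down by (simp only: simp_thms)
    qed
    ultimately show ?thesis by blast
  qed
  show False
  proof (rule R.two_primes_contradiction[of p1 p2 W "unipotent_cols q"])
    have "real (q * (nA q * (q + 1))) = real q * ((real q - 1) * (real q + 1)) / real (ee q)"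
      by (simp only: of_nat_mult of_nat_add of_nat_1 nA_real) simp
    thus "weight q s = real (W s)" for s
      by (cases s) (simp_all add: weight_def W_def del: mult_Suc_right)
    show "p1 dvd W C0" using p1 by (simp add: W_def)
    show "p2 dvd W s" if "s \<in> unipotent_cols q" for s using that p2q by (auto simp: W_def unipotent_cols_def split: if_splits)
    show "\<not> p1 dvd W s \<and> \<not> p2 dvd W s" if "s \<in> cols q" "s \<noteq> C0" "s \<notin> unipotent_cols q" for s
      using that coprime[OF p1] coprime[OF p2(1) p2q] by (auto simp: cols_eq W_def split: if_splits)
    show "p1 \<noteq> p2" using m p2 by auto
    show "finite (unipotent_cols q)" "card (unipotent_cols q) \<le> 2" by (auto simp: card_unipotent_cols ee_def)
  qed (use p1 p2 in auto)
qed

end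

theorem theorem4p1:
  fixes q :: nat
  assumes "q \<ge> 2"
  shows "\<exists>M :: row \<Rightarrow> row \<Rightarrow> row \<Rightarrow> nat.
     (\<forall>x\<in>rows q. \<forall>y\<in>rows q. \<forall>z\<in>rows q. Ncoef q x y z = of_nat (M x y z)) \<and>
     fusion_ring (rows q) M X1 \<and> commutative_fr (rows q) M \<and> integral_fr (rows q) M X1 \<and>
     is_eigentable (rows q) M (cols q) (lam q) \<and>
     (q \<ge> 4 \<longrightarrow> simple_fr (rows q) M X1) \<and>
     (\<not> prime_power q \<longrightarrow>
        (\<forall>G :: 'g monoid. group G \<and> finite (carrier G) \<longrightarrow> \<not> iso_to_RepG (rows q) M X1 G))"
proof -
  interpret psl_table q using assms by unfold_locales
  show ?thesis
    using Ncoef_fusion_coeff fusion commutative integral_fusion eigentable simple_fusion not_RepG by (intro exI[of _ fusion_coeff]) blast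
qed

end
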